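(* Let $\lambda>0$, $\alpha>0$ and let $f\in C^2$ be excessive for $\overline B$, where $\overline B$ is Brownian motion on $\mathbb R^1$ killed after an independent exponential time with parameter $\lambda^2/2$. Let $\widehat X_{\alpha,f}=\{\widehat X_{\alpha,f}(t),t\in[0,\infty)\}$ be an $\alpha$-permanental process, with continuous sample paths, with kernel $$\widehat u_f(s,t)=e^{-\lambda|s-t|}+f(t),\qquad s,t\in[0,\infty).$$ Then $$\limsup_{t\to\infty}\frac{\widehat X_{\alpha,f}(t)}{(1+f(t))\log t}\le1\qquad a.s.,$$ and when $\lim_{t\to\infty}f(t)=0$, $$\limsup_{t\to\infty}\frac{\widehat X_{\alpha,f}(t)}{\log t}=1\qquad a.s.$$ In particular this last equality holds if $f$ is a potential for $\overline B$ of a function $h\in L^1_+(0,\infty)$.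
   Context: For $\alpha>0$, a random vector $(X_1,\dots,X_n)$ with nonnegative components is $\alpha$-permanental with kernel $U$ (a real $n\times n$ matrix) if $E\big(e^{-\sum_{i=1}^n s_iX_i}\big)=|I+US|^{-\alpha}$ for every diagonal matrix $S$ with positive diagonal entries $s_1,\dots,s_n$, where $|\cdot|$ denotes the determinant. A stochastic process $\{X_\alpha(t),t\in\mathcal T\}$ is an $\alpha$-permanental process with kernel $\{u(s,t),s,t\in\mathcal T\}$ if for all $t_1,\dots,t_n\in\mathcal T$ the vector $(X_\alpha(t_1),\dots,X_\alpha(t_n))$ is $\alpha$-permanental with kernel $\{u(t_i,t_j)\}_{i,j=1}^n$. A function $f$ is excessive for a process with state space $S$ and laws $P^x$ if $f\ge0$ and $E^x(f(X_t))\uparrow f(x)$ as $t\to0$ for all $x\in S$. A function $f\in C^2$ on $\mathbb R^1$ is excessive for $\overline B$ if and only if it is positive and $f''(x)\le\lambda^2f(x)$ for all $x\in\mathbb R^1$. $\overline B$ has potential densities $\overline u(x,y)=e^{-\lambda|y-x|}/\lambda$ with respect to Lebesgue measure, and $f$ is a potential for $\overline B$ of a nonnegative $h\in L^1_+(0,\infty)$ if $f(x)=\int_0^\infty\overline u(x,y)h(y)\,dy$. $L^1_+(0,\infty)$ denotes the nonnegative functions in $L^1(0,\infty)$. *)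

theory Defs
  imports "HOL-Probability.Probability" "Jordan_Normal_Form.Determinant"
begin

text \<open>
  The powr on the right-hand side takes the absolute value of a negative base and has
  0 powr a = 0.  This does no harm: the left-hand side is positive, so the determinant cannot
  vanish, and as it is continuous in s and tends to 1 as s tends to 0, it is positive for all
  positive s.
\<close>

definition permanental_vector ::
  "'a measure \<Rightarrow> real \<Rightarrow> nat \<Rightarrow> (nat \<Rightarrow> 'a \<Rightarrow> real) \<Rightarrow> real mat \<Rightarrow> bool" where
  "permanental_vector M \<alpha> n X U \<longleftrightarrow>
     U \<in> carrier_mat n n \<and>
     (\<forall>i<n. X i \<in> borel_measurable M \<and> (AE \<omega> in M. 0 \<le> X i \<omega>)) \<and>
     (\<forall>s :: nat \<Rightarrow> real. (\<forall>i<n. 0 < s i) \<longrightarrow>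
        (\<integral>\<omega>. exp (- (\<Sum>i<n. s i * X i \<omega>)) \<partial>M) =
          Determinant.det (1\<^sub>m n + U * mat_diag n s) powr (- \<alpha>))"

definition permanental_process ::
  "'a measure \<Rightarrow> real \<Rightarrow> 't set \<Rightarrow> ('t \<Rightarrow> 'a \<Rightarrow> real) \<Rightarrow> ('t \<Rightarrow> 't \<Rightarrow> real) \<Rightarrow> bool" where
  "permanental_process M \<alpha> T X u \<longleftrightarrow>
     (\<forall>n. \<forall>t :: nat \<Rightarrow> 't. (\<forall>i<n. t i \<in> T) \<longrightarrow>
        permanental_vector M \<alpha> n (\<lambda>i. X (t i)) (Matrix.mat n n (\<lambda>(i, j). u (t i) (t j))))"

text \<open>
  A process that may be killed takes values in an option type; None is the cemetery, where
  every function is 0 by convention.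
\<close>

definition excessive ::
  "'s set \<Rightarrow> ('s \<Rightarrow> 'b measure) \<Rightarrow> (real \<Rightarrow> 'b \<Rightarrow> 's option) \<Rightarrow> ('s \<Rightarrow> real) \<Rightarrow> bool" where
  "excessive S P X f \<longleftrightarrow>
     (\<forall>x\<in>S. 0 \<le> f x) \<and>
     (\<forall>x\<in>S. let E = (\<lambda>t. \<integral>\<^sup>+\<omega>. (case X t \<omega> of None \<Rightarrow> 0 | Some y \<Rightarrow> ennreal (f y)) \<partial>(P x)) in
        antimono_on {0<..} E \<and> (E \<longlongrightarrow> ennreal (f x)) (at_right 0))"

definition brownian_motion_from :: "real \<Rightarrow> 'b measure \<Rightarrow> (real \<Rightarrow> 'b \<Rightarrow> real) \<Rightarrow> bool" where
  "brownian_motion_from x M W \<longleftrightarrow>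
     prob_space M \<and>
     (\<forall>t\<ge>0. W t \<in> borel_measurable M) \<and>
     (AE \<omega> in M. W 0 \<omega> = x) \<and>
     (AE \<omega> in M. continuous_on {0..} (\<lambda>t. W t \<omega>)) \<and>
     (\<forall>s t. 0 \<le> s \<longrightarrow> s < t \<longrightarrow>
        distributed M lborel (\<lambda>\<omega>. W t \<omega> - W s \<omega>) (normal_density 0 (sqrt (t - s)))) \<and>
     (\<forall>n. \<forall>t :: nat \<Rightarrow> real. 0 \<le> t 0 \<longrightarrow> (\<forall>i<n. t i < t (Suc i)) \<longrightarrow>
        prob_space.indep_vars M (\<lambda>_. borel) (\<lambda>i \<omega>. W (t (Suc i)) \<omega> - W (t i) \<omega>) {..<n})"

text \<open>
  The independence of the path of W and the killing time is stated for the generated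
  sigma-algebras, because indep_var only relates random variables of the same type.
\<close>

definition killed_brownian_motion ::
  "real \<Rightarrow> (real \<Rightarrow> 'b measure) \<Rightarrow> (real \<Rightarrow> 'b \<Rightarrow> real option) \<Rightarrow> bool" where
  "killed_brownian_motion \<kappa> P B \<longleftrightarrow>
     (\<exists>W \<zeta>.
        (\<forall>x. brownian_motion_from x (P x) W \<and>
             distributed (P x) lborel \<zeta> (exponential_density \<kappa>) \<and>
             prob_space.indep_set (P x)
               {(\<lambda>\<omega>. \<lambda>t\<in>{0..}. W t \<omega>) -` A \<inter> space (P x) | A.
                  A \<in> sets (\<Pi>\<^sub>M t\<in>{0::real..}. (borel :: real measure))}
               {\<zeta> -` A \<inter> space (P x) | A. A \<in> sets borel}) \<and>
        B = (\<lambda>t \<omega>. if t < \<zeta> \<omega> then Some (W t \<omega>) else None))"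

definition C2 :: "(real \<Rightarrow> real) \<Rightarrow> bool" where
  "C2 f \<longleftrightarrow> f differentiable_on UNIV \<and> deriv f differentiable_on UNIV \<and>
     continuous_on UNIV (deriv (deriv f))"

text \<open>
  Density, with respect to Lebesgue measure, of the potential measure of Brownian motion
  killed at an independent exponential time with rate lam^2 / 2.
\<close>

definition potential_density :: "real \<Rightarrow> real \<Rightarrow> real \<Rightarrow> real" where
  "potential_density lam x y = exp (- lam * \<bar>y - x\<bar>) / lam"

definition L1_plus :: "(real \<Rightarrow> real) \<Rightarrow> bool" where
  "L1_plus h \<longleftrightarrow> set_integrable lebesgue {0<..} h \<and> (\<forall>y>0. 0 \<le> h y)"

definition is_potential_of :: "real \<Rightarrow> (real \<Rightarrow> real) \<Rightarrow> (real \<Rightarrow> real) \<Rightarrow> bool" where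
  "is_potential_of lam f h \<longleftrightarrow>
     (\<forall>x. f x = (LINT y:{0<..}|lebesgue. potential_density lam x y * h y))"

end

theory Submission
  imports Defs "HOL-Real_Asymp.Real_Asymp"
begin

text \<open>
  The law of one value of the process, and the law of an increment, are governed by
  determinants of size one and two. The value at \<open>t\<close> is a gamma variable of shape \<open>\<alpha>\<close> and
  scale \<open>1 + f t\<close>, whose tail is \<open>exp (- y / (1 + f t))\<close> up to powers of \<open>y\<close>. The increment from
  \<open>s\<close> to \<open>t\<close> has, for \<open>\<bar>t - s\<bar> \<le> 1\<close>, an exponential tail at scale \<open>(1 + f s) * sqrt \<bar>t - s\<bar>\<close>.
  The Laplace transforms are given at positive arguments only; lemma \<open>exponential_moment_of_laplace\<close>
  continues them to those negative arguments that are needed for the tails.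

  For the upper bound, the Borel-Cantelli lemma gives the estimate along every grid of fixed mesh. Between
  grid points the path is controlled by dyadic chaining, and the error is small relative to
  \<open>(1 + f t) * ln t\<close> when the mesh is small. This needs that \<open>f\<close> varies slowly: a nonnegative function
  with \<open>f'' \<le> lam\<^sup>2 * f\<close> on the whole line satisfies \<open>f y \<le> exp (lam * \<bar>y - x\<bar>) * f x\<close>
  (lemma \<open>harnack_two_sided\<close>).

  The difficulty of the lower bound is that the common term \<open>f\<close> of the kernel correlates the values of the process at all times.
  As \<open>f\<close> may tend to \<open>0\<close> more slowly than \<open>1 / ln t\<close>, a comparison of second moments with the
  independent case does not suffice. The argument is instead a one-sided comparison at the level of
  laws. Let \<open>U\<close> be the kernel on an equally spaced grid. Excessiveness of \<open>f\<close> makes \<open>P = U\<^sup>-\<^sup>1\<close> a matrix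
  with nonpositive entries off the diagonal and nonnegative row sums
  (lemma \<open>exp_plus_rank_one_inverse\<close>). If \<open>d\<close> bounds the diagonal of \<open>P\<close> and \<open>S\<close> is
  the diagonal matrix of the arguments \<open>s i\<close> of the Laplace transform, Gaussian elimination expands
  \<open>det (P + S) powr (- \<alpha>)\<close> into monomials in \<open>1 / (d + s i)\<close> with nonnegative coefficients
  (lemma \<open>det_neg_powr_series\<close>). So the vector of values is a mixture of vectors of independent
  gamma variables of rate \<open>d\<close> and shapes \<open>\<alpha> + k i\<close> with natural numbers \<open>k i\<close>. Larger shapes only
  make the variables larger, so the probability that all values are small is at most what it would be
  for independent gamma variables of shape \<open>\<alpha>\<close> and rate \<open>d\<close>
  (lemma \<open>permanental_joint_small_values\<close>). For grids of spacing \<open>h\<close> one may take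
  \<open>d = (1 + \<rho>\<^sup>2) / (1 - \<rho>\<^sup>2)\<close> with \<open>\<rho> = exp (- lam * h)\<close>, which tends to \<open>1\<close> as \<open>h\<close> grows, and the
  divergence of the harmonic series gives the lower bound \<open>1\<close>. When \<open>f\<close> tends to \<open>0\<close>, the factor \<open>1 + f t\<close>
  disappears from the upper bound and the two bounds agree.
\<close>

section \<open>Power series with nonnegative coefficients and determinants\<close>

text \<open>
  The index \<open>m\<close> enumerates the terms and not the monomials, so the same multi-index \<open>k m\<close> may occur for
  several \<open>m\<close>. Closure under sums and products then needs no regrouping.
\<close>

definition nonneg_series :: "nat \<Rightarrow> (nat \<Rightarrow> real) set \<Rightarrow> ((nat \<Rightarrow> real) \<Rightarrow> real) \<Rightarrow> bool" where
  "nonneg_series n D F \<longleftrightarrow> (\<exists>(c :: nat \<Rightarrow> real) (k :: nat \<Rightarrow> nat \<Rightarrow> nat). (\<forall>m. 0 \<le> c m) \<and>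
     (\<forall>w\<in>D. 0 \<le> F w \<and> ennreal (F w) = (\<Sum>m. ennreal (c m * (\<Prod>i<n. w i ^ k m i)))))"

lemma nonneg_series_nonneg: "nonneg_series n D F \<Longrightarrow> w \<in> D \<Longrightarrow> 0 \<le> F w"
  by (auto simp: nonneg_series_def)

lemma nonneg_series_cong:
  assumes "nonneg_series n D F" and "\<And>w. w \<in> D \<Longrightarrow> F w = G w"
  shows "nonneg_series n D G"
  using assms(1) unfolding nonneg_series_def by (simp add: assms(2) cong: ball_cong)

lemma nonneg_series_monomial:
  assumes "0 \<le> c" and D: "\<And>w i. w \<in> D \<Longrightarrow> i < n \<Longrightarrow> 0 \<le> w i"
  shows "nonneg_series n D (\<lambda>w. c * (\<Prod>i<n. w i ^ k i))"
proof -
  define C :: "nat \<Rightarrow> real" where "C m = (if m = 0 then c else 0)" for m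
  have "ennreal (c * (\<Prod>i<n. w i ^ k i)) = (\<Sum>m. ennreal (C m * (\<Prod>i<n. w i ^ k i)))" for w
    by (subst suminf_finite[where N = "{0}"]) (auto simp: C_def)
  moreover have "0 \<le> c * (\<Prod>i<n. w i ^ k i)" if "w \<in> D" for w
    using D[OF that] \<open>0 \<le> c\<close> by (intro mult_nonneg_nonneg prod_nonneg) auto
  moreover have "0 \<le> C m" for m using \<open>0 \<le> c\<close> by (simp add: C_def)
  ultimately show ?thesis
    unfolding nonneg_series_def by (intro exI[of _ C] exI[of _ "\<lambda>_. k"]) blast
qed

lemma nonneg_series_const:
  assumes "0 \<le> c" and D: "\<And>w i. w \<in> D \<Longrightarrow> i < n \<Longrightarrow> 0 \<le> w i"
  shows "nonneg_series n D (\<lambda>_. c)"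
  using nonneg_series_monomial[of c D n "\<lambda>_. 0"] assms by simp

lemma nonneg_series_var:
  assumes "i < n" and D: "\<And>w i. w \<in> D \<Longrightarrow> i < n \<Longrightarrow> 0 \<le> w i"
  shows "nonneg_series n D (\<lambda>w. w i)"
proof -
  have "(\<Prod>j<n. w j ^ (if j = i then 1 else 0)) = w i" for w :: "nat \<Rightarrow> real"
    using \<open>i < n\<close> by (subst prod.remove[of _ i]) auto
  with nonneg_series_monomial[of 1 D n "\<lambda>j. if j = i then 1 else 0"] D show ?thesis by simp
qed

text \<open>
  A double series with nonnegative terms may be summed in any order, so the terms of all the \<open>F m\<close> can
  be listed in one sequence by \<open>prod_decode\<close>.
\<close>

lemma nonneg_series_sums:
  assumes F: "\<And>m. nonneg_series n D (F m)" and G: "\<And>w. w \<in> D \<Longrightarrow> (\<lambda>m. F m w) sums G w"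
  shows "nonneg_series n D G"
proof -
  from F obtain c k where ck: "\<And>m j. 0 \<le> (c m j :: real)"
    "\<And>m w. w \<in> D \<Longrightarrow> ennreal (F m w) = (\<Sum>j. ennreal (c m j * (\<Prod>i<n. w i ^ k m j i)))"
    unfolding nonneg_series_def by metis
  have nn: "0 \<le> F m w" if "w \<in> D" for m w using F[of m] that by (rule nonneg_series_nonneg)
  define C K where "C p = case_prod c (prod_decode p)" and "K p = case_prod k (prod_decode p)" for p
  have "ennreal (G w) = (\<Sum>p. ennreal (C p * (\<Prod>i<n. w i ^ K p i)))" if w: "w \<in> D" for w
  proof -
    have "ennreal (G w) = (\<Sum>m. ennreal (F m w))"
      by (rule suminf_ennreal_eq[symmetric, OF nn[OF w] G[OF w]])
    also have "\<dots> = (\<Sum>p. (\<lambda>(m, j). ennreal (c m j * (\<Prod>i<n. w i ^ k m j i))) (prod_decode p))"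
      by (rule suminf_ennreal_2dimen[symmetric]) (simp add: ck(2)[OF w])
    also have "\<dots> = (\<Sum>p. ennreal (C p * (\<Prod>i<n. w i ^ K p i)))"
      by (simp add: case_prod_beta C_def K_def)
    finally show ?thesis .
  qed
  moreover have "0 \<le> G w" if "w \<in> D" for w
    using sums_le[OF _ sums_zero G[OF that]] nn[OF that] by simp
  moreover have "0 \<le> C p" for p using ck(1) by (simp add: C_def case_prod_beta)
  ultimately show ?thesis unfolding nonneg_series_def by blast
qed

lemma nonneg_series_zero: "nonneg_series n D (\<lambda>_. 0)"
  unfolding nonneg_series_def by (intro exI[of _ "\<lambda>_. 0"]) auto

lemma nonneg_series_add:
  assumes "nonneg_series n D F" "nonneg_series n D G"
  shows "nonneg_series n D (\<lambda>w. F w + G w)"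
proof (rule nonneg_series_sums)
  show "nonneg_series n D ((\<lambda>m. if m = 0 then F else if m = 1 then G else (\<lambda>_. 0)) m)" for m :: nat
    using assms nonneg_series_zero[of n D] by simp
  show "(\<lambda>m. (if m = 0 then F else if m = 1 then G else (\<lambda>_. 0)) w) sums (F w + G w)" for w
    using sums_finite[of "{0, 1::nat}" "\<lambda>m. (if m = 0 then F else if m = 1 then G else (\<lambda>_. 0)) w"]
    by simp
qed

lemma sums_of_ennreal_suminf:
  assumes eq: "(\<Sum>m. ennreal (f m)) = ennreal x" and "0 \<le> x" "\<And>m. 0 \<le> f m"
  shows "f sums x"
proof -
  have s: "summable f" by (rule summable_suminf_not_top[OF assms(3)]) (simp add: eq)
  have "ennreal (suminf f) = ennreal x" using suminf_ennreal2[OF assms(3) s] eq by simp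
  then have "suminf f = x" using suminf_nonneg[OF s assms(3)] \<open>0 \<le> x\<close> by simp
  with s show ?thesis by (simp add: sums_iff)
qed

lemma nonneg_series_mult:
  assumes F: "nonneg_series n D F" and G: "nonneg_series n D G"
    and D: "\<And>w i. w \<in> D \<Longrightarrow> i < n \<Longrightarrow> 0 \<le> w i"
  shows "nonneg_series n D (\<lambda>w. F w * G w)"
proof -
  have mono: "nonneg_series n D (\<lambda>w. c * (\<Prod>i<n. w i ^ k i) * G w)" if c: "0 \<le> c" for c k
  proof -
    from G obtain c' k' where G': "\<And>m. 0 \<le> (c' m :: real)" "\<And>w. w \<in> D \<Longrightarrow> 0 \<le> G w"
       "\<And>w. w \<in> D \<Longrightarrow> ennreal (G w) = (\<Sum>m. ennreal (c' m * (\<Prod>i<n. w i ^ k' m i)))"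
      unfolding nonneg_series_def by blast
    have nn: "0 \<le> (\<Prod>i<n. w i ^ k i)" if "w \<in> D" for w k
      using D[OF that] by (intro prod_nonneg) auto
    have "ennreal (c * (\<Prod>i<n. w i ^ k i) * G w) =
       (\<Sum>m. ennreal (c * c' m * (\<Prod>i<n. w i ^ (k i + k' m i))))" if w: "w \<in> D" for w
    proof -
      have "ennreal (c * (\<Prod>i<n. w i ^ k i) * G w) =
          ennreal (c * (\<Prod>i<n. w i ^ k i)) * (\<Sum>m. ennreal (c' m * (\<Prod>i<n. w i ^ k' m i)))"
        using G'(2,3)[OF w] c nn[OF w] by (simp add: ennreal_mult)
      also have "\<dots> = (\<Sum>m. ennreal (c * (\<Prod>i<n. w i ^ k i)) * ennreal (c' m * (\<Prod>i<n. w i ^ k' m i)))"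
        by simp
      also have "\<dots> = (\<Sum>m. ennreal (c * c' m * (\<Prod>i<n. w i ^ (k i + k' m i))))"
        using G'(1) c nn[OF w]
        by (intro suminf_cong) (simp add: ennreal_mult[symmetric] power_add prod.distrib ac_simps)
      finally show ?thesis .
    qed
    moreover have "0 \<le> c * (\<Prod>i<n. w i ^ k i) * G w" if "w \<in> D" for w
      using c nn[OF that] G'(2)[OF that] by auto
    ultimately show ?thesis
      unfolding nonneg_series_def using mult_nonneg_nonneg[OF c G'(1)]
      by (intro exI[of _ "\<lambda>m. c * c' m"] exI[of _ "\<lambda>m i. k i + k' m i"]) blast
  qed
  from F obtain c k where F': "\<And>m. 0 \<le> (c m :: real)" "\<And>w. w \<in> D \<Longrightarrow> 0 \<le> F w"
       "\<And>w. w \<in> D \<Longrightarrow> ennreal (F w) = (\<Sum>m. ennreal (c m * (\<Prod>i<n. w i ^ k m i)))"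
    unfolding nonneg_series_def by blast
  show ?thesis
  proof (rule nonneg_series_sums)
    show "nonneg_series n D ((\<lambda>m w. c m * (\<Prod>i<n. w i ^ k m i) * G w) m)" for m
      using mono[OF F'(1)] .
    show "(\<lambda>m. (\<lambda>m w. c m * (\<Prod>i<n. w i ^ k m i) * G w) m w) sums (F w * G w)" if w: "w \<in> D" for w
    proof -
      have nn: "0 \<le> c m * (\<Prod>i<n. w i ^ k m i)" for m
        using D[OF w] F'(1) by (intro mult_nonneg_nonneg prod_nonneg) auto
      have "(\<Sum>m. ennreal (c m * (\<Prod>i<n. w i ^ k m i))) = ennreal (F w)" using F'(3)[OF w] ..
      then have "(\<lambda>m. c m * (\<Prod>i<n. w i ^ k m i)) sums F w"
        by (rule sums_of_ennreal_suminf[OF _ F'(2)[OF w] nn])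
      from sums_mult2[OF this] show ?thesis by simp
    qed
  qed
qed

lemma nonneg_series_power:
  assumes F: "nonneg_series n D F" and D: "\<And>w i. w \<in> D \<Longrightarrow> i < n \<Longrightarrow> 0 \<le> w i"
  shows "nonneg_series n D (\<lambda>w. F w ^ m)"
  using D by (induction m) (auto intro: nonneg_series_const nonneg_series_mult F)

text \<open>
  The binomial coefficient \<open>- a gchoose k\<close> is \<open>(- 1) ^ k * pochhammer a k / fact k\<close>, and its sign cancels
  that of \<open>(- x) ^ k\<close>. So all coefficients are nonnegative for \<open>0 < a\<close>.
\<close>

lemma neg_binomial_series:
  fixes a x :: real
  assumes "0 \<le> x" "x < 1"
  shows "(\<lambda>k. pochhammer a k / fact k * x ^ k) sums (1 - x) powr (- a)"
proof -
  have "(- a gchoose k) * (- x) ^ k = pochhammer a k / fact k * x ^ k" for k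
    by (simp add: gbinomial_pochhammer power_mult_distrib[symmetric] flip: power_minus[of x k])
  with gen_binomial_real[of "- x" "- a"] assms show ?thesis by simp
qed

lemma nonneg_series_neg_powr:
  assumes F: "nonneg_series n D F" and D: "\<And>w i. w \<in> D \<Longrightarrow> i < n \<Longrightarrow> 0 \<le> w i"
    and F1: "\<And>w. w \<in> D \<Longrightarrow> F w < 1" and a: "0 < a"
  shows "nonneg_series n D (\<lambda>w. (1 - F w) powr (- a))"
proof (rule nonneg_series_sums)
  show "nonneg_series n D ((\<lambda>m w. pochhammer a m / fact m * F w ^ m) m)" for m
    by (intro nonneg_series_mult nonneg_series_const nonneg_series_power F D divide_nonneg_nonneg
        pochhammer_nonneg a fact_ge_zero)
  show "(\<lambda>m. (\<lambda>m w. pochhammer a m / fact m * F w ^ m) m w) sums ((1 - F w) powr (- a))"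
    if "w \<in> D" for w
    using neg_binomial_series[of "F w" a] F1[OF that] nonneg_series_nonneg[OF F that] by simp
qed

text \<open>
  One step of Gaussian elimination: the last row and column are removed by a factorization into block
  triangular matrices.
\<close>

lemma det_schur_last:
  fixes T :: "nat \<Rightarrow> nat \<Rightarrow> real"
  assumes "T n n \<noteq> 0"
  shows "Determinant.det (Matrix.mat (Suc n) (Suc n) (\<lambda>(i, j). T i j)) =
     T n n * Determinant.det (Matrix.mat n n (\<lambda>(i, j). T i j - T i n * T n j / T n n))"
proof -
  let ?S = "Matrix.mat n n (\<lambda>(i, j). T i j - T i n * T n j / T n n)"
  let ?b = "Matrix.mat n 1 (\<lambda>(i, j). T i n / T n n)"
  let ?c = "Matrix.mat 1 n (\<lambda>(i, j). T n j)"
  let ?d = "Matrix.mat 1 1 (\<lambda>(i, j). T n n)"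
  let ?L = "four_block_mat (1\<^sub>m n) ?b (0\<^sub>m 1 n) (1\<^sub>m 1)"
  let ?R = "four_block_mat ?S (0\<^sub>m n 1) ?c ?d"
  have "?L * ?R = Matrix.mat (Suc n) (Suc n) (\<lambda>(i, j). T i j)"
    using assms
    by (subst mult_four_block_mat[where ?nr1.0 = n and ?n1.0 = n and ?n2.0 = 1 and ?nr2.0 = 1
          and ?nc1.0 = n and ?nc2.0 = 1])
      (auto intro!: eq_matI simp: four_block_mat_def Let_def scalar_prod_def less_Suc_eq)
  moreover have "Determinant.det (?L * ?R) = Determinant.det ?L * Determinant.det ?R"
    by (rule det_mult[of _ "n + 1"]) auto
  moreover have "Determinant.det ?L = 1"
    by (subst det_four_block_mat_lower_left_zero[where n = n and m = 1]) auto
  moreover have "Determinant.det ?R = Determinant.det ?S * T n n"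
    by (subst det_four_block_mat_upper_right_zero[where n = n and m = 1]) (auto simp: det_single)
  ultimately show ?thesis by simp
qed

text \<open>
  The matrix is diagonal in \<open>1 / w i\<close> up to the matrix \<open>R\<close>, whose entries are themselves nonnegative
  power series. Eliminating the last index keeps this form: the pivot is
  \<open>(1 - w n * R n n w) / w n\<close>, so its reciprocal is a geometric series, and the Schur complement adds
  products of nonnegative series to \<open>R\<close>. Positive row sums also survive, and they yield
  \<open>w n * R n n w < 1\<close>. The determinant is the product of the pivots, and each pivot contributes
  to its power \<open>- a\<close> the factor \<open>w n powr a * (1 - w n * R n n w) powr (- a)\<close>.
\<close>

lemma det_neg_powr_series:
  fixes R :: "nat \<Rightarrow> nat \<Rightarrow> (nat \<Rightarrow> real) \<Rightarrow> real"
  defines "T \<equiv> \<lambda>R w i j. (if i = j then 1 / w i else 0) - R i j w"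
  assumes D: "\<And>w i. w \<in> D \<Longrightarrow> i < N \<Longrightarrow> 0 < w i" and a: "0 < a" and "n \<le> N"
    and R: "\<And>i j. i < n \<Longrightarrow> j < n \<Longrightarrow> nonneg_series N D (R i j)"
    and pos: "\<And>w i. w \<in> D \<Longrightarrow> i < n \<Longrightarrow> 0 < (\<Sum>j<n. T R w i j)"
  shows "\<exists>F. nonneg_series N D F \<and> (\<forall>w\<in>D.
     0 < Determinant.det (Matrix.mat n n (\<lambda>(i, j). T R w i j)) \<and>
     Determinant.det (Matrix.mat n n (\<lambda>(i, j). T R w i j)) powr (- a) = (\<Prod>i<n. w i powr a) * F w)"
  using \<open>n \<le> N\<close> R pos
proof (induction n arbitrary: R)
  case 0
  have "nonneg_series N D (\<lambda>_. 1)" using D by (intro nonneg_series_const) (auto intro: less_imp_le)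
  then show ?case by auto
next
  case (Suc n)
  have D0: "0 \<le> w i" if "w \<in> D" "i < N" for w i using D[OF that] by simp
  have nN: "n < N" using Suc.prems by simp
  have Rnn: "0 \<le> R i j w" if "w \<in> D" "i \<le> n" "j \<le> n" for w i j
    using Suc.prems(2)[of i j] that nonneg_series_nonneg by auto
  have Tneg: "T R w i j \<le> 0" if "w \<in> D" "i \<le> n" "j \<le> n" "i \<noteq> j" for w i j
    using Rnn[OF that(1-3)] that by (simp add: T_def)
  have row: "- T R w n n < (\<Sum>j<n. T R w n j)" if "w \<in> D" for w
    using Suc.prems(3)[OF that, of n] by simp
  have piv: "0 < T R w n n" if w: "w \<in> D" for w
  proof -
    have "(\<Sum>j<n. T R w n j) \<le> 0" using Tneg[OF w] by (intro sum_nonpos) auto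
    with row[OF w] show ?thesis by simp
  qed
  let ?r = "\<lambda>w. w n * R n n w"
  have r: "nonneg_series N D ?r"
    using Suc.prems(2)[of n n] nN D0 by (intro nonneg_series_mult nonneg_series_var) auto
  have Tnn: "T R w n n = (1 - ?r w) / w n" if "w \<in> D" for w
    using D[OF that nN] by (simp add: T_def field_simps)
  have r1: "?r w < 1" if "w \<in> D" for w
    using piv[OF that] D[OF that nN] unfolding Tnn[OF that] by (simp add: zero_less_divide_iff)
  have inv: "nonneg_series N D (\<lambda>w. 1 / T R w n n)"
  proof (rule nonneg_series_cong)
    show "nonneg_series N D (\<lambda>w. w n * (1 - ?r w) powr (- 1))"
      by (intro nonneg_series_mult[OF nonneg_series_var nonneg_series_neg_powr[OF r]])
        (use nN D0 r1 in auto)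
    show "w n * (1 - ?r w) powr (- 1) = 1 / T R w n n" if "w \<in> D" for w
      using powr_neg_one[of "1 - ?r w"] r1[OF that] unfolding Tnn[OF that] by simp
  qed
  define R' where "R' i j w = R i j w + R i n w * R n j w * (1 / T R w n n)" for i j w
  have R': "nonneg_series N D (R' i j)" if "i < n" "j < n" for i j
    unfolding R'_def
    by (intro nonneg_series_add nonneg_series_mult inv D0 Suc.prems(2)) (use that in auto)
  have T': "T R' w i j = T R w i j - T R w i n * T R w n j / T R w n n" if "i < n" "j < n" for w i j
    using that by (simp add: T_def R'_def)
  have pos': "0 < (\<Sum>j<n. T R' w i j)" if w: "w \<in> D" and i: "i < n" for w i
  proof -
    have "0 < (\<Sum>j<n. T R w i j) + T R w i n" using Suc.prems(3)[OF w, of i] i by simp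
    also have "T R w i n = (- T R w i n / T R w n n) * (- T R w n n)" using piv[OF w] by simp
    also have "\<dots> \<le> (- T R w i n / T R w n n) * (\<Sum>j<n. T R w n j)"
      using row[OF w] Tneg[OF w, of i n] i piv[OF w] by (intro mult_left_mono divide_nonneg_pos) auto
    also have "(\<Sum>j<n. T R w i j) + \<dots> = (\<Sum>j<n. T R' w i j)"
      using i by (simp add: T' sum_subtractf sum_distrib_left[symmetric] sum_divide_distrib[symmetric])
    finally show ?thesis by simp
  qed
  obtain F where F: "nonneg_series N D F" "\<And>w. w \<in> D \<Longrightarrow> 
     0 < Determinant.det (Matrix.mat n n (\<lambda>(i, j). T R' w i j)) \<and>
     Determinant.det (Matrix.mat n n (\<lambda>(i, j). T R' w i j)) powr (- a) = (\<Prod>i<n. w i powr a) * F w"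
    using Suc.IH[of R'] Suc.prems(1) R' pos' by auto
  let ?G = "\<lambda>w. F w * (1 - ?r w) powr (- a)"
  have "nonneg_series N D ?G"
    by (intro nonneg_series_mult[OF F(1) nonneg_series_neg_powr[OF r]] D0 r1 a)
  moreover have "0 < Determinant.det (Matrix.mat (Suc n) (Suc n) (\<lambda>(i, j). T R w i j)) \<and>
     Determinant.det (Matrix.mat (Suc n) (Suc n) (\<lambda>(i, j). T R w i j)) powr (- a) =
       (\<Prod>i<Suc n. w i powr a) * ?G w" if w: "w \<in> D" for w
  proof -
    have "Matrix.mat n n (\<lambda>(i, j). T R w i j - T R w i n * T R w n j / T R w n n) =
        Matrix.mat n n (\<lambda>(i, j). T R' w i j)"
      by (rule eq_matI) (auto simp: T')
    then have eq: "Determinant.det (Matrix.mat (Suc n) (Suc n) (\<lambda>(i, j). T R w i j)) =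
        T R w n n * Determinant.det (Matrix.mat n n (\<lambda>(i, j). T R' w i j))"
      using det_schur_last[of "T R w" n] piv[OF w] by simp
    have "T R w n n = inverse (w n) * (1 - ?r w)"
      unfolding Tnn[OF w] by (simp add: divide_inverse)
    then have "T R w n n powr (- a) = w n powr a * (1 - ?r w) powr (- a)"
      using D[OF w nN] by (simp add: powr_mult inverse_powr powr_minus)
    then show ?thesis
      unfolding eq powr_mult using F(2)[OF w] piv[OF w] by simp
  qed
  ultimately show ?case by blast
qed

section \<open>The inverse of the kernel on a grid\<close>

text \<open>
  This is the Sherman-Morrison formula for the kernel \<open>A k j + f j\<close>, in which the update is the product
  of the constant column \<open>1\<close> and the row \<open>f\<close>. The row sums of the inverse are those of \<open>Q\<close> divided
  by \<open>c\<close>.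
\<close>

lemma rank_one_update_inverse:
  fixes Q A :: "nat \<Rightarrow> nat \<Rightarrow> real" and f :: "nat \<Rightarrow> real"
  assumes QA: "\<And>i j. i < n \<Longrightarrow> j < n \<Longrightarrow> (\<Sum>k<n. Q i k * A k j) = (if i = j then 1 else 0)"
  defines "q \<equiv> \<lambda>i. \<Sum>k<n. Q i k"
    and "g \<equiv> \<lambda>j. \<Sum>k<n. f k * Q k j"
  defines "c \<equiv> 1 + (\<Sum>j<n. g j)"
  defines "P \<equiv> \<lambda>i j. Q i j - q i * g j / c"
  assumes c: "c \<noteq> 0" and i: "i < n"
  shows "j < n \<Longrightarrow> (\<Sum>k<n. P i k * (A k j + f j)) = (if i = j then 1 else 0)"
    and "(\<Sum>k<n. P i k) = q i / c"
proof -
  have sum_g: "(\<Sum>k<n. g k) = c - 1" by (simp add: c_def)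
  show row: "(\<Sum>k<n. P i k) = q i / c"
  proof -
    have "(\<Sum>k<n. P i k) = q i - q i * (\<Sum>k<n. g k) / c"
      by (simp add: P_def sum_subtractf q_def sum_distrib_left[symmetric] sum_divide_distrib[symmetric])
    also have "\<dots> = q i / c" unfolding sum_g using c by (simp add: field_simps)
    finally show ?thesis .
  qed
  assume j: "j < n"
  have gA: "(\<Sum>k<n. g k * A k j) = f j"
  proof -
    have "(\<Sum>k<n. g k * A k j) = (\<Sum>k<n. \<Sum>l<n. f l * (Q l k * A k j))"
      by (simp add: g_def sum_distrib_left sum_distrib_right mult_ac)
    also have "\<dots> = (\<Sum>l<n. f l * (\<Sum>k<n. Q l k * A k j))"
      by (subst sum.swap) (simp add: sum_distrib_left)
    also have "\<dots> = (\<Sum>l<n. f l * (if l = j then 1 else 0))" using QA j by simp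
    also have "\<dots> = (\<Sum>l<n. if l = j then f j else 0)" by (intro sum.cong) auto
    also have "\<dots> = f j" using j by simp
    finally show ?thesis .
  qed
  have "P i k * (A k j + f j) = Q i k * A k j - q i / c * (g k * A k j) + P i k * f j" for k
    by (simp add: P_def algebra_simps add_divide_distrib)
  then have "(\<Sum>k<n. P i k * (A k j + f j)) =
      (\<Sum>k<n. Q i k * A k j) - q i / c * (\<Sum>k<n. g k * A k j) + (\<Sum>k<n. P i k) * f j"
    by (simp only: sum_subtractf sum.distrib sum_distrib_left sum_distrib_right)
  also have "\<dots> = (if i = j then 1 else 0)" unfolding QA[OF i j] gA row by simp
  finally show "(\<Sum>k<n. P i k * (A k j + f j)) = (if i = j then 1 else 0)" .
qed

text \<open>
  The inverse of the kernel \<open>\<rho> ^ \<bar>i - j\<bar>\<close> on \<open>n\<close> points. It is tridiagonal because the kernel is that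
  of a Markov chain. The diagonal entries at the two ends differ from the others, and for \<open>n = 1\<close> the
  only point is both ends, so that the entry must be \<open>1\<close>.
\<close>

definition exp_kernel_inverse :: "nat \<Rightarrow> real \<Rightarrow> nat \<Rightarrow> nat \<Rightarrow> real" where
  "exp_kernel_inverse n \<rho> i j =
     ((if i = j then 1 + (if 0 < i \<and> Suc i < n then \<rho>\<^sup>2 else if n = 1 then - \<rho>\<^sup>2 else 0) else 0)
      - (if Suc i = j then \<rho> else 0) - (if i = Suc j then \<rho> else 0)) / (1 - \<rho>\<^sup>2)"

lemma sum_exp_kernel_inverse:
  fixes g :: "nat \<Rightarrow> real"
  assumes "i < n"
  shows "(\<Sum>k<n. exp_kernel_inverse n \<rho> i k * g k) =
    ((1 + (if 0 < i \<and> Suc i < n then \<rho>\<^sup>2 else if n = 1 then - \<rho>\<^sup>2 else 0)) * g i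
     - (if Suc i < n then \<rho> * g (Suc i) else 0) - (if 0 < i then \<rho> * g (i - 1) else 0)) / (1 - \<rho>\<^sup>2)"
proof -
  have "(\<Sum>k<n. exp_kernel_inverse n \<rho> i k * g k) =
     ((\<Sum>k<n. if k = i then (1 + (if 0 < i \<and> Suc i < n then \<rho>\<^sup>2 else if n = 1 then - \<rho>\<^sup>2 else 0)) * g i else 0)
     - (\<Sum>k<n. if k = Suc i then \<rho> * g (Suc i) else 0)
     - (\<Sum>k<n. if 0 < i \<and> k = i - 1 then \<rho> * g (i - 1) else 0)) / (1 - \<rho>\<^sup>2)"
    unfolding sum_subtractf[symmetric] sum_divide_distrib
    by (intro sum.cong refl) (auto simp: exp_kernel_inverse_def left_diff_distrib)
  also have "(\<Sum>k<n. if k = Suc i then \<rho> * g (Suc i) else 0) = (if Suc i < n then \<rho> * g (Suc i) else 0)"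
    by simp
  also have "(\<Sum>k<n. if 0 < i \<and> k = i - 1 then \<rho> * g (i - 1) else 0) = (if 0 < i then \<rho> * g (i - 1) else 0)"
    using assms by (cases "0 < i") auto
  finally show ?thesis using assms by simp
qed

lemma exp_kernel_inverse_sym: "exp_kernel_inverse n \<rho> i j = exp_kernel_inverse n \<rho> j i"
  by (auto simp: exp_kernel_inverse_def)

lemma exp_kernel_inverse_mult:
  assumes \<rho>: "0 < \<rho>" "\<rho> < 1" and ij: "i < n" "j < n"
  shows "(\<Sum>k<n. exp_kernel_inverse n \<rho> i k * \<rho> ^ nat \<bar>int k - int j\<bar>) = (if i = j then 1 else 0)"
proof -
  have r2: "\<rho>\<^sup>2 < 1" using \<rho> by (simp add: power_less_one_iff)
  consider "i = j" | "i < j" | "j < i" by linarith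
  then show ?thesis
  proof cases
    case 1
    have e: "nat \<bar>int (j - 1) - int j\<bar> = 1" if "0 < j" using that by linarith
    show ?thesis
      unfolding sum_exp_kernel_inverse[OF ij(1)] using 1 ij r2 e
      by (auto simp: power2_eq_square)
  next
    case 2
    define m where "m = j - Suc i"
    have m: "nat \<bar>int i - int j\<bar> = Suc m" "nat \<bar>int (Suc i) - int j\<bar> = m" using 2 by (auto simp: m_def)
    have m': "nat \<bar>int (i - 1) - int j\<bar> = Suc (Suc m)" if "0 < i" using 2 that by (auto simp: m_def)
    have "Suc i < n" "n \<noteq> 1" using 2 ij by auto
    then show ?thesis
      unfolding sum_exp_kernel_inverse[OF ij(1)] m using 2 m'
      by (auto simp: power2_eq_square algebra_simps)
  next
    case 3
    define m where "m = i - Suc j"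
    have m: "nat \<bar>int i - int j\<bar> = Suc m" "nat \<bar>int (Suc i) - int j\<bar> = Suc (Suc m)" using 3 by (auto simp: m_def)
    have m': "nat \<bar>int (i - 1) - int j\<bar> = m" if "0 < i" using 3 that by (auto simp: m_def)
    have "0 < i" "n \<noteq> 1" using 3 ij by auto
    then show ?thesis
      unfolding sum_exp_kernel_inverse[OF ij(1)] m using 3 m'
      by (auto simp: power2_eq_square algebra_simps)
  qed
qed

text \<open>
  The last three conditions on \<open>f\<close> express that \<open>f\<close> is excessive for the chain with potential
  \<open>\<rho> ^ \<bar>i - j\<bar>\<close>: they give the nonnegativity of the row \<open>f\<close> times the inverse kernel, at the left end, the right end and
  the interior. With the formula for the inverse of a rank-one update this makes the correction
  term \<open>q i * g j / c\<close> nonnegative, so it lowers all the entries of the tridiagonal inverse.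
\<close>

lemma exp_plus_rank_one_inverse:
  fixes f :: "nat \<Rightarrow> real"
  assumes \<rho>: "0 < \<rho>" "\<rho> < 1"
    and f0: "\<And>i. i < n \<Longrightarrow> 0 \<le> f i"
    and f_right: "\<And>i. Suc i < n \<Longrightarrow> \<rho> * f (Suc i) \<le> f i"
    and f_left: "\<And>i. Suc i < n \<Longrightarrow> \<rho> * f i \<le> f (Suc i)"
    and f_mid: "\<And>i. Suc (Suc i) < n \<Longrightarrow> \<rho> * (f i + f (Suc (Suc i))) \<le> (1 + \<rho>\<^sup>2) * f (Suc i)"
  shows "\<exists>P. (\<forall>i<n. \<forall>j<n. (\<Sum>k<n. P i k * (\<rho> ^ nat \<bar>int k - int j\<bar> + f j)) = (if i = j then 1 else 0)) \<and>
    (\<forall>i<n. \<forall>j<n. i \<noteq> j \<longrightarrow> P i j \<le> 0) \<and> (\<forall>i<n. P i i \<le> (1 + \<rho>\<^sup>2) / (1 - \<rho>\<^sup>2)) \<and>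
    (\<forall>i<n. 0 \<le> (\<Sum>k<n. P i k))"
proof -
  have r2: "0 < 1 - \<rho>\<^sup>2" using \<rho> by (simp add: power_less_one_iff)
  let ?Q = "exp_kernel_inverse n \<rho>"
  define q where "q i = (\<Sum>k<n. ?Q i k)" for i
  define g where "g j = (\<Sum>k<n. f k * ?Q k j)" for j
  define c where "c = 1 + (\<Sum>j<n. g j)"
  define P where "P i j = ?Q i j - q i * g j / c" for i j
  have q0: "0 \<le> q i" if i: "i < n" for i
  proof -
    have "0 \<le> (1 - \<rho>)\<^sup>2" "0 \<le> 1 - \<rho>" "0 \<le> 1 - \<rho>\<^sup>2" using \<rho> r2 by auto
    then show ?thesis
      using sum_exp_kernel_inverse[OF i, of \<rho> "\<lambda>_. 1"] r2 i
      by (auto simp: q_def power2_eq_square algebra_simps intro!: divide_nonneg_pos)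
  qed
  have g0: "0 \<le> g j" if j: "j < n" for j
  proof -
    have "g j = (\<Sum>k<n. ?Q j k * f k)"
      unfolding g_def by (intro sum.cong refl) (simp add: exp_kernel_inverse_sym mult.commute)
    also have "\<dots> = ((1 + (if 0 < j \<and> Suc j < n then \<rho>\<^sup>2 else if n = 1 then - \<rho>\<^sup>2 else 0)) * f j
     - (if Suc j < n then \<rho> * f (Suc j) else 0) - (if 0 < j then \<rho> * f (j - 1) else 0)) / (1 - \<rho>\<^sup>2)"
      by (rule sum_exp_kernel_inverse[OF j])
    also have "\<dots> \<ge> 0"
    proof (intro divide_nonneg_pos r2)
      consider "n = 1" | "j = 0" "n \<noteq> 1" | i where "j = Suc i" "n = Suc j" | i where "j = Suc i" "Suc j < n"
        using j by (cases j) (auto, metis not_less_eq less_antisym)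
      then show "0 \<le> (1 + (if 0 < j \<and> Suc j < n then \<rho>\<^sup>2 else if n = 1 then - \<rho>\<^sup>2 else 0)) * f j
        - (if Suc j < n then \<rho> * f (Suc j) else 0) - (if 0 < j then \<rho> * f (j - 1) else 0)"
      proof cases
        case 1
        then show ?thesis using j f0[of j] r2 by simp
      next
        case 2
        then have "Suc 0 < n" using j by simp
        then show ?thesis using 2 f_right[of 0] by simp
      next
        case (3 i)
        then show ?thesis using f_left[of i] by simp
      next
        case (4 i)
        then show ?thesis using f_mid[of i] by (simp add: algebra_simps)
      qed
    qed
    finally show ?thesis .
  qed
  have c1: "1 \<le> c" unfolding c_def using sum_nonneg[of "{..<n}" g] g0 by simp
  have frac: "0 \<le> q i * g j / c" if "i < n" "j < n" for i j
    using q0[OF that(1)] g0[OF that(2)] c1 by simp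
  show ?thesis
  proof (intro exI[of _ P] conjI allI impI)
    show "(\<Sum>k<n. P i k * (\<rho> ^ nat \<bar>int k - int j\<bar> + f j)) = (if i = j then 1 else 0)" if "i < n" "j < n" for i j
      using rank_one_update_inverse(1)[of n ?Q "\<lambda>k j. \<rho> ^ nat \<bar>int k - int j\<bar>" f i j]
        exp_kernel_inverse_mult[OF \<rho>] c1 that
      by (simp add: P_def q_def g_def c_def)
    show "P i j \<le> 0" if "i < n" "j < n" "i \<noteq> j" for i j
    proof -
      have "?Q i j \<le> 0"
        using that \<rho> r2 by (auto simp: exp_kernel_inverse_def intro!: divide_nonpos_pos)
      then show ?thesis using frac[OF that(1,2)] by (simp add: P_def)
    qed
    show "P i i \<le> (1 + \<rho>\<^sup>2) / (1 - \<rho>\<^sup>2)" if "i < n" for i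
    proof -
      have "?Q i i \<le> (1 + \<rho>\<^sup>2) / (1 - \<rho>\<^sup>2)"
        unfolding exp_kernel_inverse_def using r2 \<rho> by (intro divide_right_mono) (auto simp: power2_eq_square)
      then show ?thesis using frac[OF that that] by (simp add: P_def)
    qed
    show "0 \<le> (\<Sum>k<n. P i k)" if "i < n" for i
      using rank_one_update_inverse(2)[of n ?Q "\<lambda>k j. \<rho> ^ nat \<bar>int k - int j\<bar>" f i]
        exp_kernel_inverse_mult[OF \<rho>] c1 that q0[OF that]
      by (simp add: P_def q_def g_def c_def)
  qed
qed

section \<open>Uniqueness of mixtures of product laws\<close>

text \<open>
  The arguments are changed from monomials to continuous functions one at a time. In each step the
  functional vanishes on polynomials by linearity, and a continuous function is uniformly close to a
  polynomial by the Weierstrass theorem.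
\<close>

lemma multilinear_vanishes_on_continuous:
  fixes L :: "(nat \<Rightarrow> real \<Rightarrow> real) \<Rightarrow> real"
  assumes lin: "\<And>p i g h a. i < n \<Longrightarrow> (\<And>j. continuous_on UNIV (p j)) \<Longrightarrow> continuous_on UNIV g \<Longrightarrow>
        continuous_on UNIV h \<Longrightarrow> L (p(i := (\<lambda>v. g v + a * h v))) = L (p(i := g)) + a * L (p(i := h))"
    and bound: "\<And>p C. (\<And>j. continuous_on UNIV (p j)) \<Longrightarrow>
        (\<And>j v. j < n \<Longrightarrow> v \<in> {0..1} \<Longrightarrow> \<bar>p j v\<bar> \<le> C j) \<Longrightarrow> \<bar>L p\<bar> \<le> B * (\<Prod>j<n. C j)"
    and monomials: "\<And>k. L (\<lambda>i v. v ^ k i) = 0"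
    and p: "\<And>j. continuous_on UNIV (p j)" "\<And>j. n \<le> j \<Longrightarrow> p j = (\<lambda>_. 1)"
  shows "L p = 0"
proof -
  have "L p = 0" if "r \<le> n" "\<And>j. continuous_on UNIV (p j)" "\<And>j. r \<le> j \<Longrightarrow> \<exists>k. p j = (\<lambda>v. v ^ k)"
    for r p using that
  proof (induction r arbitrary: p)
    case 0
    then obtain k where "\<And>j. p j = (\<lambda>v. v ^ k j)" by (metis le0)
    then have "p = (\<lambda>j v. v ^ k j)" by blast
    then show ?case using monomials by simp
  next
    case (Suc r)
    have r: "r < n" using Suc.prems by simp
    have poly: "L (p(r := (\<lambda>v. \<Sum>i\<le>N. a i * v ^ i))) = 0" for a :: "nat \<Rightarrow> real" and N
    proof -
      have mono: "L (p(r := (\<lambda>v. v ^ N))) = 0" for N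
        using Suc.prems by (intro Suc.IH) (auto intro!: continuous_intros simp: Suc_le_eq)
      show ?thesis
      proof (induction N)
        case 0
        have "L (p(r := (\<lambda>v. v ^ 0 + (a 0 - 1) * v ^ 0))) =
            L (p(r := (\<lambda>v. v ^ 0))) + (a 0 - 1) * L (p(r := (\<lambda>v. v ^ 0)))"
          by (intro lin[OF r] Suc.prems continuous_intros)
        also have "\<dots> = 0" unfolding mono by simp
        also have "(\<lambda>v::real. v ^ 0 + (a 0 - 1) * v ^ 0) = (\<lambda>v. \<Sum>i\<le>0. a i * v ^ i)" by auto
        finally show ?case .
      next
        case (Suc N)
        have "L (p(r := (\<lambda>v. (\<Sum>i\<le>N. a i * v ^ i) + a (Suc N) * v ^ Suc N))) =
            L (p(r := (\<lambda>v. \<Sum>i\<le>N. a i * v ^ i))) + a (Suc N) * L (p(r := (\<lambda>v. v ^ Suc N)))"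
          by (intro lin[OF r] \<open>\<And>j. continuous_on UNIV (p j)\<close> continuous_intros)
        also have "\<dots> = 0" unfolding mono Suc.IH by simp
        finally show ?case by (simp only: sum.atMost_Suc)
      qed
    qed
    have "\<exists>C. \<forall>v\<in>{0..1}. \<bar>p j v\<bar> \<le> C" for j
    proof -
      have "compact ((\<lambda>v. \<bar>p j v\<bar>) ` {0..1})"
        using Suc.prems(2)[of j] by (intro compact_continuous_image continuous_intros)
          (auto intro: continuous_on_subset)
      then have "bounded ((\<lambda>v. \<bar>p j v\<bar>) ` {0..1})" by (rule compact_imp_bounded)
      then show ?thesis by (auto simp: bounded_iff)
    qed
    then obtain C where C: "\<And>j v. v \<in> {0..1} \<Longrightarrow> \<bar>p j v\<bar> \<le> C j" by metis
    define K where "K = B * (\<Prod>j\<in>{..<n} - {r}. C j)"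
    have le: "\<bar>L p\<bar> \<le> K * e" if e: "0 < e" for e
    proof -
      obtain q where q: "real_polynomial_function q" "\<And>v. v \<in> {0..1} \<Longrightarrow> \<bar>p r v - q v\<bar> < e"
        using Stone_Weierstrass_real_polynomial_function[of "{0..1::real}" "p r" e] e Suc.prems(2)[of r]
        by (metis compact_Icc continuous_on_subset subset_UNIV)
      then obtain a N where q_eq: "q = (\<lambda>v. \<Sum>i\<le>N. a i * v ^ i)"
        unfolding real_polynomial_function_iff_sum by blast
      have q_cont: "continuous_on UNIV q" unfolding q_eq by (intro continuous_intros)
      have "L p = L (p(r := (\<lambda>v. q v + 1 * (p r v - q v))))" by simp
      also have "\<dots> = L (p(r := q)) + 1 * L (p(r := (\<lambda>v. p r v - q v)))"
        by (intro lin r Suc.prems continuous_intros q_cont)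
      also have "L (p(r := q)) = 0" unfolding q_eq by (rule poly)
      finally have "L p = L (p(r := (\<lambda>v. p r v - q v)))" by (simp only: add_0 mult_1)
      also have "\<bar>\<dots>\<bar> \<le> B * (\<Prod>j<n. (C(r := e)) j)"
        using Suc.prems(2) C q(2) q_cont
        by (intro bound) (auto intro!: continuous_intros less_imp_le)
      also have "(\<Prod>j<n. (C(r := e)) j) = e * (\<Prod>j\<in>{..<n} - {r}. C j)"
        using r by (subst prod.remove[of _ r]) (auto intro!: prod.cong)
      finally show ?thesis by (simp add: K_def mult_ac)
    qed
    show ?case
    proof (rule ccontr)
      assume "L p \<noteq> 0"
      then have pos: "0 < \<bar>L p\<bar>" by simp
      have "\<bar>L p\<bar> \<le> K * (\<bar>L p\<bar> / (2 * (\<bar>K\<bar> + 1)))" by (intro le) (use pos in auto)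
      also have "\<dots> \<le> (\<bar>K\<bar> + 1) * (\<bar>L p\<bar> / (2 * (\<bar>K\<bar> + 1)))"
        by (intro mult_right_mono) auto
      also have "\<dots> = \<bar>L p\<bar> / 2" by (simp add: field_simps add_eq_0_iff)
      finally show False using pos by simp
    qed
  qed
  from this[of n p] p show ?thesis by (metis order_refl power_0)
qed

text \<open>
  The moments of variables in \<open>[0, 1]\<close> determine the law. In the application the variables are \<open>exp (- X i)\<close>, and
  their moments are values of a Laplace transform. The separate factors \<open>V i\<close> and \<open>Y\<close> keep all
  exponents at least \<open>1\<close>, because the Laplace transform of a permanental vector is given at strictly
  positive arguments only.
\<close>

lemma product_mixture_unique:
  fixes V :: "nat \<Rightarrow> 'a \<Rightarrow> real" and G :: "nat \<Rightarrow> nat \<Rightarrow> 'b measure" and Y :: "'b \<Rightarrow> real"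
  assumes M: "prob_space M"
    and V[measurable]: "\<And>i. i < n \<Longrightarrow> V i \<in> borel_measurable M" and V01: "\<And>i \<omega>. V i \<omega> \<in> {0..1}"
    and G: "\<And>m i. prob_space (G m i)"
    and Y[measurable]: "\<And>m i. Y \<in> borel_measurable (G m i)" and Y01: "\<And>y. Y y \<in> {0..1}"
    and \<pi>: "\<And>m. 0 \<le> \<pi> m" "summable \<pi>"
    and eq: "\<And>k. (\<integral>\<omega>. (\<Prod>i<n. V i \<omega> * V i \<omega> ^ k i) \<partial>M) =
        (\<Sum>m. \<pi> m * (\<Prod>i<n. \<integral>y. Y y * Y y ^ k i \<partial>G m i))"
    and p: "\<And>j. continuous_on UNIV (p j)" "\<And>j. n \<le> j \<Longrightarrow> p j = (\<lambda>_. 1)"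
  shows "(\<integral>\<omega>. (\<Prod>i<n. V i \<omega> * p i (V i \<omega>)) \<partial>M) = (\<Sum>m. \<pi> m * (\<Prod>i<n. \<integral>y. Y y * p i (Y y) \<partial>G m i))"
proof -
  interpret M: prob_space M by (rule M)
  define L1 where "L1 p = (\<integral>\<omega>. (\<Prod>i<n. V i \<omega> * p i (V i \<omega>)) \<partial>M)" for p
  define J where "J m i g = (\<integral>y. Y y * g (Y y) \<partial>G m i)" for m i g
  define L2 where "L2 p = (\<Sum>m. \<pi> m * (\<Prod>i<n. J m i (p i)))" for p
  have meas: "g \<in> borel_measurable borel" if "continuous_on UNIV g" for g :: "real \<Rightarrow> real"
    using that by (rule borel_measurable_continuous_onI)
  have ubound: "\<exists>C\<ge>0. \<forall>v\<in>{0..1}. \<bar>g v\<bar> \<le> C" if "continuous_on UNIV g" for g :: "real \<Rightarrow> real"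
  proof -
    have "compact (g ` {0..1})"
      using that by (intro compact_continuous_image) (auto intro: continuous_on_subset)
    then have "bounded (g ` {0..1})" by (rule compact_imp_bounded)
    then show ?thesis by (auto simp: bounded_pos) (meson less_imp_le atLeastAtMost_iff)
  qed
  have prod_bound: "\<bar>\<Prod>i<n. V i \<omega> * p i (V i \<omega>)\<bar> \<le> (\<Prod>i<n. C i)"
    if "\<And>j v. j < n \<Longrightarrow> v \<in> {0..1} \<Longrightarrow> \<bar>p j v\<bar> \<le> C j" for p C \<omega>
    unfolding abs_prod
  proof (intro prod_mono conjI)
    fix i assume "i \<in> {..<n}"
    then have "\<bar>V i \<omega>\<bar> * \<bar>p i (V i \<omega>)\<bar> \<le> 1 * C i"
      using V01[of i \<omega>] that[of i "V i \<omega>"] by (intro mult_mono) auto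
    then show "\<bar>V i \<omega> * p i (V i \<omega>)\<bar> \<le> C i" by (simp add: abs_mult)
  qed auto
  have M_int: "integrable M (\<lambda>\<omega>. \<Prod>i<n. V i \<omega> * p i (V i \<omega>))" if c: "\<And>j. continuous_on UNIV (p j)" for p
  proof -
    note [measurable] = meas[OF c]
    from ubound[OF c] obtain C where "\<And>j v. v \<in> {0..1} \<Longrightarrow> \<bar>p j v\<bar> \<le> C j" by metis
    then have "\<bar>\<Prod>i<n. V i \<omega> * p i (V i \<omega>)\<bar> \<le> (\<Prod>i<n. C i)" for \<omega> by (intro prod_bound)
    then show ?thesis
      by (intro M.integrable_const_bound[of _ "\<Prod>i<n. C i"]) (auto intro!: borel_measurable_prod)
  qed
  have J_int: "integrable (G m i) (\<lambda>y. Y y * g (Y y))" if c: "continuous_on UNIV g" for m i g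
  proof -
    interpret G: prob_space "G m i" by (rule G)
    note [measurable] = meas[OF c]
    from ubound[OF c] obtain C where C: "0 \<le> C" "\<And>v. v \<in> {0..1} \<Longrightarrow> \<bar>g v\<bar> \<le> C" by metis
    have "\<bar>Y y\<bar> * \<bar>g (Y y)\<bar> \<le> 1 * C" for y
      using Y01[of y] C(2)[of "Y y"] by (intro mult_mono) auto
    then show ?thesis by (intro G.integrable_const_bound[of _ C]) (auto simp: abs_mult)
  qed
  have J_bound: "\<bar>J m i g\<bar> \<le> C" if c: "continuous_on UNIV g" and C: "\<And>v. v \<in> {0..1} \<Longrightarrow> \<bar>g v\<bar> \<le> C" for m i g C
  proof -
    interpret G: prob_space "G m i" by (rule G)
    have "\<bar>Y y\<bar> * \<bar>g (Y y)\<bar> \<le> 1 * C" for y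
      using Y01[of y] C[of "Y y"] by (intro mult_mono) auto
    then have "\<bar>Y y * g (Y y)\<bar> \<le> C" for y by (simp add: abs_mult)
    then have "\<bar>J m i g\<bar> \<le> (\<integral>y. C \<partial>G m i)"
      unfolding J_def
      by (intro integral_abs_bound[THEN order_trans] integral_mono integrable_abs J_int c) auto
    then show ?thesis by (simp add: G.prob_space)
  qed
  have PJ_bound: "\<bar>\<Prod>i<n. J m i (p i)\<bar> \<le> (\<Prod>i<n. C i)"
    if "\<And>j. continuous_on UNIV (p j)" "\<And>j v. j < n \<Longrightarrow> v \<in> {0..1} \<Longrightarrow> \<bar>p j v\<bar> \<le> C j" for p C m
    unfolding abs_prod using that by (intro prod_mono conjI J_bound) auto
  have summ: "summable (\<lambda>m. \<pi> m * (\<Prod>i<n. J m i (p i)))"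
    and L2_bound: "\<bar>L2 p\<bar> \<le> suminf \<pi> * (\<Prod>i<n. C i)"
    if "\<And>j. continuous_on UNIV (p j)" "\<And>j v. j < n \<Longrightarrow> v \<in> {0..1} \<Longrightarrow> \<bar>p j v\<bar> \<le> C j" for p C
  proof -
    have b: "\<bar>\<pi> m * (\<Prod>i<n. J m i (p i))\<bar> \<le> \<pi> m * (\<Prod>i<n. C i)" for m
    proof -
      have "\<bar>\<Prod>i<n. J m i (p i)\<bar> \<le> (\<Prod>i<n. C i)" by (rule PJ_bound[OF that])
      with \<pi>(1)[of m] show ?thesis unfolding abs_mult by (simp add: mult_left_mono)
    qed
    have s: "summable (\<lambda>m. \<pi> m * (\<Prod>i<n. C i))" by (intro summable_mult2 \<pi>(2))
    have sa: "summable (\<lambda>m. \<bar>\<pi> m * (\<Prod>i<n. J m i (p i))\<bar>)"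
      by (rule summable_comparison_test[OF _ s]) (use b in auto)
    then show "summable (\<lambda>m. \<pi> m * (\<Prod>i<n. J m i (p i)))" by (rule summable_rabs_cancel)
    have "\<bar>L2 p\<bar> \<le> (\<Sum>m. \<bar>\<pi> m * (\<Prod>i<n. J m i (p i))\<bar>)" unfolding L2_def by (rule summable_rabs[OF sa])
    also have "\<dots> \<le> (\<Sum>m. \<pi> m * (\<Prod>i<n. C i))" by (intro suminf_le b sa s)
    also have "\<dots> = suminf \<pi> * (\<Prod>i<n. C i)" by (rule suminf_mult2[OF \<pi>(2), symmetric])
    finally show "\<bar>L2 p\<bar> \<le> suminf \<pi> * (\<Prod>i<n. C i)" .
  qed
  have split_prod: "(\<Prod>j<n. F j ((p(i := g)) j)) = F i g * (\<Prod>j\<in>{..<n} - {i}. F j (p j))"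
    if "i < n" for F :: "nat \<Rightarrow> (real \<Rightarrow> real) \<Rightarrow> real" and p i g
    using that by (subst prod.remove[of _ i]) (auto intro!: prod.cong)
  have lin1: "L1 (p(i := (\<lambda>v. g v + a * h v))) = L1 (p(i := g)) + a * L1 (p(i := h))"
    if i: "i < n" and c: "\<And>j. continuous_on UNIV (p j)" "continuous_on UNIV g" "continuous_on UNIV h"
    for p i g h a
  proof -
    have g: "integrable M (\<lambda>\<omega>. \<Prod>j<n. V j \<omega> * (p(i := g)) j (V j \<omega>))"
      and h: "integrable M (\<lambda>\<omega>. \<Prod>j<n. V j \<omega> * (p(i := h)) j (V j \<omega>))"
      using c by (intro M_int; simp)+
    have "(\<Prod>j<n. V j \<omega> * (p(i := (\<lambda>v. g v + a * h v))) j (V j \<omega>)) =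
       (\<Prod>j<n. V j \<omega> * (p(i := g)) j (V j \<omega>)) + a * (\<Prod>j<n. V j \<omega> * (p(i := h)) j (V j \<omega>))" for \<omega>
      unfolding split_prod[OF i, of "\<lambda>j q. V j \<omega> * q (V j \<omega>)"] by (simp add: algebra_simps)
    then show ?thesis unfolding L1_def using g h by simp
  qed
  have lin2: "L2 (p(i := (\<lambda>v. g v + a * h v))) = L2 (p(i := g)) + a * L2 (p(i := h))"
    if i: "i < n" and c: "\<And>j. continuous_on UNIV (p j)" "continuous_on UNIV g" "continuous_on UNIV h"
    for p i g h a
  proof -
    have summ': "summable (\<lambda>m. \<pi> m * (\<Prod>i<n. J m i (p i)))" if c: "\<And>j. continuous_on UNIV (p j)" for p
    proof -
      from ubound[OF c] obtain C where "\<And>j v. v \<in> {0..1} \<Longrightarrow> \<bar>p j v\<bar> \<le> C j" by metis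
      then show ?thesis by (intro summ c)
    qed
    have "J m i (\<lambda>v. g v + a * h v) = J m i g + a * J m i h" for m
    proof -
      have "(\<lambda>y. Y y * (g (Y y) + a * h (Y y))) = (\<lambda>y. Y y * g (Y y) + a * (Y y * h (Y y)))"
        by (auto simp: algebra_simps)
      then show ?thesis unfolding J_def using J_int[OF c(2)] J_int[OF c(3)] by simp
    qed
    then have e: "\<pi> m * (\<Prod>j<n. J m j ((p(i := (\<lambda>v. g v + a * h v))) j)) =
        \<pi> m * (\<Prod>j<n. J m j ((p(i := g)) j)) + a * (\<pi> m * (\<Prod>j<n. J m j ((p(i := h)) j)))" for m
      unfolding split_prod[OF i, of "J m"] by (simp add: algebra_simps)
    have "summable (\<lambda>m. \<pi> m * (\<Prod>j<n. J m j ((p(i := g)) j)))"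
      and "summable (\<lambda>m. \<pi> m * (\<Prod>j<n. J m j ((p(i := h)) j)))"
      using c by (intro summ'; simp)+
    then show ?thesis unfolding L2_def e by (simp add: suminf_add[symmetric] suminf_mult summable_mult)
  qed
  have "L1 p - L2 p = 0"
  proof (rule multilinear_vanishes_on_continuous[where n = n and L = "\<lambda>p. L1 p - L2 p" and B = "1 + suminf \<pi>"])
    show "L1 (p(i := (\<lambda>v. g v + a * h v))) - L2 (p(i := (\<lambda>v. g v + a * h v))) =
        L1 (p(i := g)) - L2 (p(i := g)) + a * (L1 (p(i := h)) - L2 (p(i := h)))"
      if "i < n" "\<And>j. continuous_on UNIV (p j)" "continuous_on UNIV g" "continuous_on UNIV h" for p i g h a
      unfolding lin1[OF that] lin2[OF that] by (simp add: algebra_simps)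
    show "\<bar>L1 p - L2 p\<bar> \<le> (1 + suminf \<pi>) * (\<Prod>j<n. C j)"
      if c: "\<And>j. continuous_on UNIV (p j)" "\<And>j v. j < n \<Longrightarrow> v \<in> {0..1} \<Longrightarrow> \<bar>p j v\<bar> \<le> C j" for p C
    proof -
      have "\<bar>L1 p\<bar> \<le> (\<integral>\<omega>. (\<Prod>j<n. C j) \<partial>M)"
        unfolding L1_def using prod_bound[OF c(2)]
        by (intro integral_abs_bound[THEN order_trans] integral_mono integrable_abs M_int c(1)) auto
      then have "\<bar>L1 p\<bar> \<le> (\<Prod>j<n. C j)" by (simp add: M.prob_space)
      moreover have "\<bar>L2 p\<bar> \<le> suminf \<pi> * (\<Prod>j<n. C j)" by (rule L2_bound[OF c])
      ultimately show ?thesis by (simp add: algebra_simps)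
    qed
    show "L1 (\<lambda>i v. v ^ k i) - L2 (\<lambda>i v. v ^ k i) = 0" for k
      using eq[of k] by (simp add: L1_def L2_def J_def)
  qed (use p in auto)
  then show ?thesis by (simp add: L1_def L2_def J_def)
qed

section \<open>Gamma distributions\<close>

definition gamma_density :: "real \<Rightarrow> real \<Rightarrow> real \<Rightarrow> real" where
  "gamma_density a d x = indicator {0..} x * (d powr a / Gamma a * x powr (a - 1) * exp (- d * x))"

definition gamma_dist :: "real \<Rightarrow> real \<Rightarrow> real measure" where
  "gamma_dist a d = density lborel (\<lambda>x. ennreal (gamma_density a d x))"

lemma gamma_density_measurable [measurable]: "gamma_density a d \<in> borel_measurable borel"
  unfolding gamma_density_def[abs_def] by measurable

lemma gamma_density_nonneg: "0 < a \<Longrightarrow> 0 \<le> gamma_density a d x"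
  by (auto simp: gamma_density_def indicator_def intro!: mult_nonneg_nonneg divide_nonneg_nonneg
      Gamma_real_nonneg)

lemma nn_integral_gamma_density:
  assumes a: "0 < a" and d: "0 < d"
  shows "(\<integral>\<^sup>+x. ennreal (gamma_density a d x) \<partial>lborel) = 1"
proof -
  have G: "0 < Gamma a" using a by (rule Gamma_real_pos)
  have "ennreal (Gamma a) = (\<integral>\<^sup>+t. ennreal (indicator {0..} t * t powr (a - 1) / exp t) \<partial>lborel)"
    using a by (rule Gamma_conv_nn_integral_real)
  also have "\<dots> = \<bar>d\<bar> * (\<integral>\<^sup>+x. ennreal (indicator {0..} (0 + d * x) * (0 + d * x) powr (a - 1) / exp (0 + d * x)) \<partial>lborel)"
    using d by (intro nn_integral_real_affine) auto
  also have "\<dots> = (\<integral>\<^sup>+x. ennreal (Gamma a) * ennreal (gamma_density a d x) \<partial>lborel)"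
    using d G gamma_density_nonneg[OF a, of d]
    by (subst nn_integral_cmult[symmetric])
      (auto intro!: nn_integral_cong simp: ennreal_mult[symmetric] gamma_density_def indicator_def powr_mult
        exp_minus field_simps zero_le_mult_iff powr_diff)
  also have "\<dots> = ennreal (Gamma a) * (\<integral>\<^sup>+x. ennreal (gamma_density a d x) \<partial>lborel)"
    by (rule nn_integral_cmult) simp
  finally show ?thesis
    using G by (metis ennreal_mult_cancel_left ennreal_neq_top ennreal_eq_0_iff mult.right_neutral not_less)
qed

lemma prob_space_gamma_dist: "0 < a \<Longrightarrow> 0 < d \<Longrightarrow> prob_space (gamma_dist a d)"
  using nn_integral_gamma_density[of a d]
  by (intro prob_spaceI) (simp add: gamma_dist_def emeasure_density)

lemma gamma_dist_laplace:
  assumes a: "0 < a" and d: "0 < d" and s: "0 \<le> s"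
  shows "(\<integral>x. exp (- s * \<bar>x\<bar>) \<partial>gamma_dist a d) = (d / (d + s)) powr a"
proof -
  have "gamma_density a d x * exp (- s * \<bar>x\<bar>) = (d / (d + s)) powr a * gamma_density a (d + s) x" for x
    using d s by (auto simp: gamma_density_def indicator_def powr_divide exp_add[symmetric] algebra_simps)
  then have "(\<integral>x. exp (- s * \<bar>x\<bar>) \<partial>gamma_dist a d) =
      (\<integral>x. (d / (d + s)) powr a * gamma_density a (d + s) x \<partial>lborel)"
    unfolding gamma_dist_def using gamma_density_nonneg[OF a, of d] by (subst integral_density) auto
  also have "\<dots> = (d / (d + s)) powr a * (\<integral>x. gamma_density a (d + s) x \<partial>lborel)" by simp
  also have "(\<integral>x. gamma_density a (d + s) x \<partial>lborel) = 1"
    using nn_integral_gamma_density[OF a, of "d + s"] d s gamma_density_nonneg[OF a, of "d + s"]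
    by (subst integral_eq_nn_integral) auto
  finally show ?thesis by simp
qed

text \<open>
  The density of shape \<open>a + 1\<close> is \<open>d * x / a\<close> times that of shape \<open>a\<close>. This factor crosses \<open>1\<close> at
  \<open>x = a / d\<close>, so \<open>(d * x / a - 1) * (g x - g (a / d))\<close> is nowhere positive. The constant
  \<open>g (a / d)\<close> has the same integral under both laws.
\<close>

lemma gamma_dist_Suc_antitone:
  assumes a: "0 < a" and d: "0 < d" and g: "antimono g" "\<And>x. \<bar>g x\<bar> \<le> (1::real)"
  shows "(\<integral>x. g x \<partial>gamma_dist (a + 1) d) \<le> (\<integral>x. g x \<partial>gamma_dist a d)"
proof -
  have [measurable]: "g \<in> borel_measurable borel"
  proof -
    have "(\<lambda>x. - g x) \<in> borel_measurable borel"
      using g(1) by (intro borel_measurable_mono) (auto simp: mono_def antimono_def)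
    from borel_measurable_uminus[OF this] show ?thesis by simp
  qed
  let ?p = "gamma_density a d" and ?q = "gamma_density (a + 1) d"
  have dens: "integrable lborel (gamma_density b d)" "(\<integral>x. gamma_density b d x \<partial>lborel) = 1" if "0 < b" for b
  proof -
    have nn: "0 \<le> gamma_density b d x" for x using gamma_density_nonneg[OF that] .
    show "integrable lborel (gamma_density b d)"
      using nn_integral_gamma_density[OF that d] nn by (intro integrableI_nonneg) auto
    show "(\<integral>x. gamma_density b d x \<partial>lborel) = 1"
      using nn_integral_gamma_density[OF that d] nn by (subst integral_eq_nn_integral) auto
  qed
  have gi: "integrable lborel (\<lambda>x. gamma_density b d x * g x)" if "0 < b" for b
    using g(2) gamma_density_nonneg[OF that, of d]
    by (intro Bochner_Integration.integrable_bound[OF dens(1)[OF that]])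
      (auto simp: abs_mult intro!: mult_left_le)
  have q: "?q x = (d * x / a) * ?p x" for x
  proof (cases "0 < x")
    case True
    have "Gamma (a + 1) = a * Gamma a" using a by (intro Gamma_plus1) (auto simp: nonpos_Ints_def)
    with True a d show ?thesis
      by (simp add: gamma_density_def powr_add powr_diff field_simps)
  qed (auto simp: gamma_density_def indicator_def)
  have "(\<integral>x. ?q x * g x \<partial>lborel) - (\<integral>x. ?p x * g x \<partial>lborel) =
      (\<integral>x. (?q x - ?p x) * (g x - g (a / d)) \<partial>lborel) + g (a / d) * ((\<integral>x. ?q x \<partial>lborel) - (\<integral>x. ?p x \<partial>lborel))"
    using gi[of a] gi[of "a + 1"] dens(1)[of a] dens(1)[of "a + 1"] a
    by (simp add: algebra_simps)
  also have "\<dots> = (\<integral>x. (?q x - ?p x) * (g x - g (a / d)) \<partial>lborel)"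
    using dens(2)[of a] dens(2)[of "a + 1"] a by simp
  also have "\<dots> \<le> 0"
  proof -
    have "(?q x - ?p x) * (g x - g (a / d)) \<le> 0" for x
    proof -
    have "(?q x - ?p x) * (g x - g (a / d)) = ?p x * ((d * x / a - 1) * (g x - g (a / d)))"
      unfolding q by (simp only: left_diff_distrib right_diff_distrib mult_1_left mult_ac)
    also have "\<dots> \<le> 0"
    proof (rule mult_nonneg_nonpos[OF gamma_density_nonneg[OF a]])
      show "(d * x / a - 1) * (g x - g (a / d)) \<le> 0"
      proof (cases "x \<le> a / d")
        case True
        with a d have "d * x / a - 1 \<le> 0" by (simp add: field_simps)
        moreover have "0 \<le> g x - g (a / d)" using g(1) True by (simp add: antimono_def)
        ultimately show ?thesis by (simp add: mult_nonpos_nonneg)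
      next
        case False
        with a d have "0 \<le> d * x / a - 1" by (simp add: field_simps)
        moreover have "g x - g (a / d) \<le> 0" using g(1) False by (simp add: antimono_def)
        ultimately show ?thesis by (simp add: mult_nonneg_nonpos)
      qed
    qed
    finally show ?thesis .
    qed
    then have "0 \<le> (\<integral>x. - ((?q x - ?p x) * (g x - g (a / d))) \<partial>lborel)"
      by (intro Bochner_Integration.integral_nonneg) simp
    then show ?thesis by simp
  qed
  finally have "(\<integral>x. ?q x * g x \<partial>lborel) \<le> (\<integral>x. ?p x * g x \<partial>lborel)" by simp
  then show ?thesis
    unfolding gamma_dist_def using gamma_density_nonneg[of a d] gamma_density_nonneg[of "a + 1" d] a
    by (subst (1 2) integral_density) auto
qed

lemma gamma_dist_add_nat_antitone:
  assumes a: "0 < a" and d: "0 < d" and g: "antimono g" "\<And>x. \<bar>g x\<bar> \<le> (1::real)"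
  shows "(\<integral>x. g x \<partial>gamma_dist (a + real k) d) \<le> (\<integral>x. g x \<partial>gamma_dist a d)"
proof (induction k)
  case (Suc k)
  have "(\<integral>x. g x \<partial>gamma_dist (a + real k + 1) d) \<le> (\<integral>x. g x \<partial>gamma_dist (a + real k) d)"
    using a by (intro gamma_dist_Suc_antitone d g) auto
  with Suc show ?case by (simp add: add_ac)
qed simp

lemma AE_gamma_dist_nonneg: "AE y in gamma_dist a d. 0 \<le> y"
  unfolding gamma_dist_def by (subst AE_density) (auto simp: gamma_density_def indicator_def)

lemma sets_gamma_dist [simp, measurable_cong]: "sets (gamma_dist a d) = sets borel"
  by (simp add: gamma_dist_def)

text \<open>
  It suffices to integrate over \<open>[x + 1, x + 2]\<close>, where the test function is at most \<open>exp (- 1)\<close> and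
  the density is bounded below because \<open>y powr (a - 1) \<ge> 1 / y\<close> for \<open>y \<ge> 1\<close>.
\<close>

lemma gamma_dist_test_function_bound:
  assumes a: "0 < a" and d: "0 < d" and x: "0 \<le> x"
  shows "(\<integral>y. min 1 (exp (x - y)) \<partial>gamma_dist a d) \<le>
    1 - (1 - exp (- 1)) * (d powr a / Gamma a) * exp (- 2 * d) * exp (- d * x) / (x + 2)"
proof -
  interpret G: prob_space "gamma_dist a d" using a d by (rule prob_space_gamma_dist)
  define K where "K = d powr a / Gamma a * exp (- d * (x + 2)) / (x + 2)"
  have "0 < Gamma a" using a by (rule Gamma_real_pos)
  have K0: "0 \<le> K" unfolding K_def using x \<open>0 < Gamma a\<close> by simp
  have dens: "K \<le> gamma_density a d y" if y: "x + 1 \<le> y" "y \<le> x + 2" for y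
  proof -
    have y0: "1 \<le> y" using y x by simp
    have "1 / (x + 2) \<le> 1 / y" using y y0 by (intro divide_left_mono) auto
    also have "1 / y = y powr (- 1)" using y0 by (simp add: powr_neg_one)
    also have "\<dots> \<le> y powr (a - 1)" using y0 a by (intro powr_mono) auto
    finally have "1 / (x + 2) * exp (- d * (x + 2)) \<le> y powr (a - 1) * exp (- d * y)"
      using y d by (intro mult_mono) auto
    then have "d powr a / Gamma a * (1 / (x + 2) * exp (- d * (x + 2))) \<le>
        d powr a / Gamma a * (y powr (a - 1) * exp (- d * y))"
      using \<open>0 < Gamma a\<close> by (intro mult_left_mono) auto
    then show ?thesis using y0 by (simp add: K_def gamma_density_def mult_ac)
  qed
  have int: "integrable (gamma_dist a d) (\<lambda>y. min 1 (exp (x - y)))"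
    by (rule G.integrable_const_bound[of _ 1]) auto
  have dint: "integrable lborel (\<lambda>y. gamma_density a d y * (1 - min 1 (exp (x - y))))"
  proof -
    have "integrable (gamma_dist a d) (\<lambda>y. 1 - min 1 (exp (x - y)))" using int by simp
    then show ?thesis unfolding gamma_dist_def using gamma_density_nonneg[OF a]
      by (subst (asm) integrable_density) auto
  qed
  have "K * (1 - exp (- 1)) = (\<integral>y. indicator {x + 1..x + 2} y * (K * (1 - exp (- 1))) \<partial>lborel)"
    by simp
  also have "\<dots> \<le> (\<integral>y. gamma_density a d y * (1 - min 1 (exp (x - y))) \<partial>lborel)"
  proof (intro integral_mono dint)
    fix y
    show "indicator {x + 1..x + 2} y * (K * (1 - exp (- 1))) \<le> gamma_density a d y * (1 - min 1 (exp (x - y)))"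
    proof (cases "y \<in> {x + 1..x + 2}")
      case True
      then have "K * (1 - exp (- 1)) \<le> gamma_density a d y * (1 - min 1 (exp (x - y)))"
        using dens[of y] K0 gamma_density_nonneg[OF a, of d y] by (intro mult_mono) (auto simp: min_def)
      then show ?thesis using True by simp
    next
      case False
      then show ?thesis using gamma_density_nonneg[OF a, of d y] by simp
    qed
  qed simp
  also have "\<dots> = (\<integral>y. 1 - min 1 (exp (x - y)) \<partial>gamma_dist a d)"
    unfolding gamma_dist_def using gamma_density_nonneg[OF a] by (subst integral_density) auto
  also have "\<dots> = 1 - (\<integral>y. min 1 (exp (x - y)) \<partial>gamma_dist a d)"
    using int by (simp add: G.prob_space)
  also have "K * (1 - exp (- 1)) =
      (1 - exp (- 1)) * (d powr a / Gamma a) * exp (- 2 * d) * exp (- d * x) / (x + 2)"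
    by (simp add: K_def exp_add[symmetric] distrib_left mult.commute)
  finally show ?thesis by simp
qed

section \<open>Permanental vectors as mixtures of independent gamma variables\<close>

text \<open>
  From \<open>P * U = 1\<close> one gets \<open>P * (1 + U * S) = P + S\<close>, so up to a constant factor the Laplace transform is a
  negative power of \<open>det (P + S)\<close>, a determinant that is expanded in \<open>w i = 1 / (d + s i)\<close>. The terms
  are written as multiples of Laplace transforms of products of gamma laws of rate \<open>d\<close>.
\<close>

lemma permanental_laplace_series:
  fixes P U :: "nat \<Rightarrow> nat \<Rightarrow> real"
  assumes X: "permanental_vector M \<alpha> n X (Matrix.mat n n (\<lambda>(i, j). U i j))" and \<alpha>: "0 < \<alpha>" and d: "0 < d"
    and PU: "\<And>i j. i < n \<Longrightarrow> j < n \<Longrightarrow> (\<Sum>k<n. P i k * U k j) = (if i = j then 1 else 0)"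
    and off: "\<And>i j. i < n \<Longrightarrow> j < n \<Longrightarrow> i \<noteq> j \<Longrightarrow> P i j \<le> 0"
    and diag: "\<And>i. i < n \<Longrightarrow> P i i \<le> d"
    and row: "\<And>i. i < n \<Longrightarrow> 0 \<le> (\<Sum>k<n. P i k)"
  shows "\<exists>(c :: nat \<Rightarrow> real) k. (\<forall>m. 0 \<le> c m) \<and> (\<forall>s. (\<forall>i<n. 0 < s i) \<longrightarrow>
      (\<lambda>m. c m * (\<Prod>i<n. (d / (d + s i)) powr (\<alpha> + real (k m i)))) sums
        (\<integral>\<omega>. exp (- (\<Sum>i<n. s i * X i \<omega>)) \<partial>M))"
proof -
  define D where "D = {w :: nat \<Rightarrow> real. \<forall>i<n. 0 < w i \<and> w i < 1 / d}"
  define R where "R i j = (\<lambda>_::nat \<Rightarrow> real. (if i = j then d else 0) - P i j)" for i j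
  define T where "T w i j = (if i = j then 1 / w i else 0) - R i j w" for w i j
  have D: "0 < w i" if "w \<in> D" "i < n" for w i using that by (simp add: D_def)
  have Rs: "nonneg_series n D (R i j)" if "i < n" "j < n" for i j
    unfolding R_def using that off[of i j] diag[of i] D
    by (intro nonneg_series_const) (auto intro: less_imp_le)
  have Tpos: "0 < (\<Sum>j<n. T w i j)" if w: "w \<in> D" and i: "i < n" for w i
  proof -
    have "T w i j = P i j + (if i = j then 1 / w i - d else 0)" for j by (simp add: T_def R_def)
    then have "(\<Sum>j<n. T w i j) = (\<Sum>j<n. P i j) + (1 / w i - d)"
      using i by (simp add: sum.distrib)
    moreover have "d < 1 / w i" using w i d D[OF w i] by (auto simp: D_def field_simps)
    ultimately show ?thesis using row[OF i] by simp
  qed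
  obtain F where F: "nonneg_series n D F" and detT: "\<And>w. w \<in> D \<Longrightarrow>
     0 < Determinant.det (Matrix.mat n n (\<lambda>(i, j). T w i j)) \<and>
     Determinant.det (Matrix.mat n n (\<lambda>(i, j). T w i j)) powr (- \<alpha>) = (\<Prod>i<n. w i powr \<alpha>) * F w"
    using det_neg_powr_series[of D n \<alpha> n R] D \<alpha> Rs Tpos unfolding T_def by blast
  obtain c k where c: "\<And>m. 0 \<le> (c m :: real)"
    and F_eq: "\<And>w. w \<in> D \<Longrightarrow> 0 \<le> F w \<and> ennreal (F w) = (\<Sum>m. ennreal (c m * (\<Prod>i<n. w i ^ k m i)))"
    using F unfolding nonneg_series_def by blast
  define C where "C = Determinant.det (Matrix.mat n n (\<lambda>(i, j). P i j)) powr \<alpha>"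
  define \<pi> where "\<pi> m = C * c m * (\<Prod>i<n. (1 / d) powr (\<alpha> + real (k m i)))" for m
  show ?thesis
  proof (intro exI[of _ \<pi>] exI[of _ k] conjI allI impI)
    show "0 \<le> \<pi> m" for m unfolding \<pi>_def C_def using c by (intro mult_nonneg_nonneg prod_nonneg) auto
    fix s :: "nat \<Rightarrow> real" assume "\<forall>i<n. 0 < s i"
    then have s: "0 < s i" if "i < n" for i using that by simp
    define w where "w i = 1 / (d + s i)" for i
    have w: "w \<in> D" using s d by (auto simp: D_def w_def field_simps add_pos_pos)
    let ?P = "Matrix.mat n n (\<lambda>(i, j). P i j)" and ?U = "Matrix.mat n n (\<lambda>(i, j). U i j)"
    let ?E = "1\<^sub>m n + ?U * mat_diag n s"
    have "?P * ?E = Matrix.mat n n (\<lambda>(i, j). T w i j)"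
    proof (rule eq_matI)
      fix i j assume "i < dim_row (Matrix.mat n n (\<lambda>(i, j). T w i j))"
        "j < dim_col (Matrix.mat n n (\<lambda>(i, j). T w i j))"
      then have ij: "i < n" "j < n" by auto
      have "?E = Matrix.mat n n (\<lambda>(i, j). (if i = j then 1 else 0) + U i j * s j)"
        by (subst mat_diag_mult_right[of _ n]) (auto intro!: eq_matI simp: mat_diag_def)
      then have "(?P * ?E) $$ (i, j) = (\<Sum>l<n. P i l * ((if l = j then 1 else 0) + U l j * s j))"
        using ij by (simp add: scalar_prod_def atLeast0LessThan)
      also have "\<dots> = P i j + (\<Sum>l<n. P i l * U l j) * s j"
      proof -
        have "P i l * ((if l = j then 1 else 0) + U l j * s j) =
            (if l = j then P i l else 0) + P i l * U l j * s j" for l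
          by (simp add: algebra_simps)
        then show ?thesis using ij by (simp add: sum.distrib sum_distrib_right)
      qed
      also have "\<dots> = T w i j" using ij PU[OF ij] by (auto simp: T_def R_def w_def)
      finally show "(?P * ?E) $$ (i, j) = Matrix.mat n n (\<lambda>(i, j). T w i j) $$ (i, j)" using ij by simp
    qed (auto simp: mat_diag_def)
    then have det: "Determinant.det ?P * Determinant.det ?E = Determinant.det (Matrix.mat n n (\<lambda>(i, j). T w i j))"
      by (subst det_mult[of _ n, symmetric]) (auto simp: mat_diag_def)
    with detT[OF w] have P0: "Determinant.det ?P \<noteq> 0" by auto
    have E_powr: "Determinant.det ?P powr (- \<alpha>) * Determinant.det ?E powr (- \<alpha>) = (\<Prod>i<n. w i powr \<alpha>) * F w"
      using detT[OF w] unfolding det[symmetric] powr_mult by simp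
    have "C * Determinant.det ?P powr (- \<alpha>) = 1" using P0 by (simp add: C_def powr_minus)
    then have "Determinant.det ?E powr (- \<alpha>) = C * ((\<Prod>i<n. w i powr \<alpha>) * F w)"
      unfolding E_powr[symmetric] by (simp only: mult.assoc[symmetric] mult_1)
    moreover have "(\<integral>\<omega>. exp (- (\<Sum>i<n. s i * X i \<omega>)) \<partial>M) = Determinant.det ?E powr (- \<alpha>)"
      using X s unfolding permanental_vector_def by blast
    moreover have "(\<lambda>m. c m * (\<Prod>i<n. w i ^ k m i)) sums F w"
      using F_eq[OF w] c D[OF w]
      by (intro sums_of_ennreal_suminf) (auto intro!: mult_nonneg_nonneg prod_nonneg intro: less_imp_le)
    from sums_mult[OF this, of "C * (\<Prod>i<n. w i powr \<alpha>)"]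
    have "(\<lambda>m. C * (\<Prod>i<n. w i powr \<alpha>) * (c m * (\<Prod>i<n. w i ^ k m i))) sums (C * ((\<Prod>i<n. w i powr \<alpha>) * F w))"
      by (simp add: mult_ac)
    moreover have "C * (\<Prod>i<n. w i powr \<alpha>) * (c m * (\<Prod>i<n. w i ^ k m i)) =
        \<pi> m * (\<Prod>i<n. (d / (d + s i)) powr (\<alpha> + real (k m i)))" for m
    proof -
      have "w i powr \<alpha> * w i ^ k m i = (1 / d) powr (\<alpha> + real (k m i)) * (d / (d + s i)) powr (\<alpha> + real (k m i))"
        if "i < n" for i
      proof -
        have "0 < w i" using D[OF w that] .
        then have "w i powr \<alpha> * w i ^ k m i = w i powr (\<alpha> + real (k m i))" by (simp add: powr_add powr_realpow)
        also have "\<dots> = ((1 / d) * (d / (d + s i))) powr (\<alpha> + real (k m i))" using d by (simp add: w_def)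
        finally show ?thesis by (simp only: powr_mult)
      qed
      then have "(\<Prod>i<n. w i powr \<alpha>) * (\<Prod>i<n. w i ^ k m i) =
         (\<Prod>i<n. (1 / d) powr (\<alpha> + real (k m i))) * (\<Prod>i<n. (d / (d + s i)) powr (\<alpha> + real (k m i)))"
        unfolding prod.distrib[symmetric] by (intro prod.cong) auto
      then show ?thesis unfolding \<pi>_def by (metis (no_types, lifting) mult.assoc mult.left_commute)
    qed
    ultimately show "(\<lambda>m. \<pi> m * (\<Prod>i<n. (d / (d + s i)) powr (\<alpha> + real (k m i)))) sums
        (\<integral>\<omega>. exp (- (\<Sum>i<n. s i * X i \<omega>)) \<partial>M)"
      by simp
  qed
qed

text \<open>
  The vector is a mixture of products of gamma laws with shapes \<open>\<alpha> + k m i\<close>. The indicator of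
  \<open>X i \<omega> \<le> x i\<close> is dominated by the function \<open>min 1 (exp (x i - y))\<close>, which is continuous in \<open>exp (- y)\<close>
  and decreasing in \<open>y\<close>. Continuity allows the passage from Laplace transforms to this test function,
  and monotonicity allows the replacement of all the shapes by \<open>\<alpha>\<close>.
\<close>

lemma permanental_joint_small_values:
  fixes P U :: "nat \<Rightarrow> nat \<Rightarrow> real"
  assumes M: "prob_space M"
    and X: "permanental_vector M \<alpha> n X (Matrix.mat n n (\<lambda>(i, j). U i j))" and \<alpha>: "0 < \<alpha>" and d: "0 < d"
    and PU: "\<And>i j. i < n \<Longrightarrow> j < n \<Longrightarrow> (\<Sum>k<n. P i k * U k j) = (if i = j then 1 else 0)"
    and off: "\<And>i j. i < n \<Longrightarrow> j < n \<Longrightarrow> i \<noteq> j \<Longrightarrow> P i j \<le> 0"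
    and diag: "\<And>i. i < n \<Longrightarrow> P i i \<le> d"
    and row: "\<And>i. i < n \<Longrightarrow> 0 \<le> (\<Sum>k<n. P i k)"
  shows "measure M {\<omega> \<in> space M. \<forall>i<n. X i \<omega> \<le> x i} \<le>
    (\<Prod>i<n. \<integral>y. min 1 (exp (x i - y)) \<partial>gamma_dist \<alpha> d)"
proof -
  interpret M: prob_space M by (rule M)
  obtain \<pi> :: "nat \<Rightarrow> real" and k where \<pi>0: "\<And>m. 0 \<le> \<pi> m" and laplace:
    "\<And>s. (\<And>i. i < n \<Longrightarrow> 0 < s i) \<Longrightarrow>
      (\<lambda>m. \<pi> m * (\<Prod>i<n. (d / (d + s i)) powr (\<alpha> + real (k m i)))) sums
        (\<integral>\<omega>. exp (- (\<Sum>i<n. s i * X i \<omega>)) \<partial>M)"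
  proof -
    have "\<exists>(c :: nat \<Rightarrow> real) k. (\<forall>m. 0 \<le> c m) \<and> (\<forall>s. (\<forall>i<n. 0 < s i) \<longrightarrow>
      (\<lambda>m. c m * (\<Prod>i<n. (d / (d + s i)) powr (\<alpha> + real (k m i)))) sums
        (\<integral>\<omega>. exp (- (\<Sum>i<n. s i * X i \<omega>)) \<partial>M))"
      by (rule permanental_laplace_series[OF X \<alpha> d]) (fact PU off diag row)+
    then show ?thesis using that by blast
  qed
  have Xm[measurable]: "X i \<in> borel_measurable M" and Xnn: "AE \<omega> in M. 0 \<le> X i \<omega>" if "i < n" for i
    using X that unfolding permanental_vector_def by auto
  have Xall: "AE \<omega> in M. \<forall>i<n. 0 \<le> X i \<omega>"
  proof -
    have "AE \<omega> in M. \<forall>i\<in>{..<n}. 0 \<le> X i \<omega>" by (rule AE_finite_allI) (use Xnn in auto)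
    then show ?thesis by eventually_elim auto
  qed
  \<comment> \<open>Let all arguments of the Laplace transform tend to 0 in a partial sum, where the limit is elementary.\<close>
  have partial: "(\<Sum>m<N. \<pi> m) \<le> 1" for N
  proof (rule tendsto_upperbound)
    show "((\<lambda>t. \<Sum>m<N. \<pi> m * (\<Prod>i<n. (d / (d + t)) powr (\<alpha> + real (k m i)))) \<longlongrightarrow> (\<Sum>m<N. \<pi> m)) (at_right 0)"
    proof -
      have "((\<lambda>t. \<Sum>m<N. \<pi> m * (\<Prod>i<n. (d / (d + t)) powr (\<alpha> + real (k m i)))) \<longlongrightarrow>
         (\<Sum>m<N. \<pi> m * (\<Prod>i<n. (d / (d + 0)) powr (\<alpha> + real (k m i))))) (at_right 0)"
        using d by (intro tendsto_intros) auto
      then show ?thesis using d by simp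
    qed
    show "\<forall>\<^sub>F t in at_right 0. (\<Sum>m<N. \<pi> m * (\<Prod>i<n. (d / (d + t)) powr (\<alpha> + real (k m i)))) \<le> 1"
    proof (rule eventually_at_right_less[THEN eventually_mono])
      fix t :: real assume t: "0 < t"
      have "(\<Sum>m<N. \<pi> m * (\<Prod>i<n. (d / (d + t)) powr (\<alpha> + real (k m i)))) \<le>
          (\<integral>\<omega>. exp (- (\<Sum>i<n. t * X i \<omega>)) \<partial>M)"
        using laplace[of "\<lambda>_. t"] t \<pi>0
          sum_le_suminf[of "\<lambda>m. \<pi> m * (\<Prod>i<n. (d / (d + t)) powr (\<alpha> + real (k m i)))" "{..<N}"]
        by (auto simp: sums_iff prod_nonneg)
      also have "\<dots> \<le> (\<integral>\<omega>. 1 \<partial>M)"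
      proof (rule integral_mono_AE')
        show "AE \<omega> in M. exp (- (\<Sum>i<n. t * X i \<omega>)) \<le> 1"
          using Xall by eventually_elim (use t in \<open>auto intro!: sum_nonneg\<close>)
      qed auto
      finally show "(\<Sum>m<N. \<pi> m * (\<Prod>i<n. (d / (d + t)) powr (\<alpha> + real (k m i)))) \<le> 1"
        by (simp add: M.prob_space)
    qed
  qed simp
  have \<pi>_summable: "summable \<pi>"
    using \<pi>0 partial by (rule summableI_nonneg_bounded)
  have \<pi>_le: "suminf \<pi> \<le> 1"
    using partial by (intro suminf_le_const \<pi>_summable)
  define V where "V i \<omega> = exp (- \<bar>X i \<omega>\<bar>)" for i \<omega>
  define Y where "Y y = exp (- \<bar>y\<bar>)" for y :: real
  \<comment> \<open>With \<open>v = exp (- y)\<close> the function \<open>v * p i v\<close> is \<open>min 1 (exp (x i - y))\<close>.\<close>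
  define p where "p i v = (if i < n then 1 / max v (exp (- x i)) else 1)" for i and v :: real
  define G where "G m i = gamma_dist (\<alpha> + real (k m i)) d" for m i
  define b where "b i = (\<integral>y. min 1 (exp (x i - y)) \<partial>gamma_dist \<alpha> d)" for i
  have b0: "0 \<le> b i" for i unfolding b_def by (intro Bochner_Integration.integral_nonneg) auto
  have Ym[measurable]: "Y \<in> borel_measurable borel" unfolding Y_def[abs_def] by measurable
  have main: "(\<integral>\<omega>. (\<Prod>i<n. V i \<omega> * p i (V i \<omega>)) \<partial>M) = (\<Sum>m. \<pi> m * (\<Prod>i<n. \<integral>y. Y y * p i (Y y) \<partial>G m i))"
  proof (rule product_mixture_unique[OF M])
    show "prob_space (G m i)" for m i unfolding G_def using \<alpha> d by (intro prob_space_gamma_dist) auto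
    show "Y \<in> borel_measurable (G m i)" for m i unfolding G_def by simp
    show "continuous_on UNIV (p j)" for j
    proof (cases "j < n")
      case True
      then have "p j = (\<lambda>v. 1 / max v (exp (- x j)))" by (auto simp: p_def)
      moreover have "max v (exp (- x j)) \<noteq> 0" for v by (smt (verit) exp_gt_zero)
      ultimately show ?thesis by (auto intro!: continuous_intros)
    next
      case False
      then have "p j = (\<lambda>v. 1)" by (auto simp: p_def)
      then show ?thesis by simp
    qed
    show "(\<integral>\<omega>. (\<Prod>i<n. V i \<omega> * V i \<omega> ^ e i) \<partial>M) = (\<Sum>m. \<pi> m * (\<Prod>i<n. \<integral>y. Y y * Y y ^ e i \<partial>G m i))" for e
    proof -
      have pw: "exp (- \<bar>z\<bar>) * exp (- \<bar>z\<bar>) ^ e i = exp (- real (Suc (e i)) * \<bar>z\<bar>)" for z :: real and i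
        by (simp add: exp_of_nat_mult[symmetric] exp_add[symmetric] algebra_simps)
      have "(\<integral>\<omega>. (\<Prod>i<n. V i \<omega> * V i \<omega> ^ e i) \<partial>M) = (\<integral>\<omega>. exp (- (\<Sum>i<n. real (Suc (e i)) * X i \<omega>)) \<partial>M)"
      proof (rule integral_cong_AE)
        show "AE \<omega> in M. (\<Prod>i<n. V i \<omega> * V i \<omega> ^ e i) = exp (- (\<Sum>i<n. real (Suc (e i)) * X i \<omega>))"
          using Xall
        proof eventually_elim
          case (elim \<omega>)
          have "(\<Prod>i<n. V i \<omega> * V i \<omega> ^ e i) = (\<Prod>i<n. exp (- real (Suc (e i)) * X i \<omega>))"
            unfolding V_def pw using elim by (intro prod.cong) auto
          also have "\<dots> = exp (\<Sum>i<n. - real (Suc (e i)) * X i \<omega>)" by (rule exp_sum[OF finite_lessThan, symmetric])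
          finally show ?case by (simp only: sum_negf mult_minus_left)
        qed
      qed (auto simp: V_def[abs_def] intro!: borel_measurable_prod borel_measurable_sum)
      also have "\<dots> = (\<Sum>m. \<pi> m * (\<Prod>i<n. (d / (d + real (Suc (e i)))) powr (\<alpha> + real (k m i))))"
        using laplace[of "\<lambda>i. real (Suc (e i))"] by (simp add: sums_iff)
      also have "(\<lambda>m. \<pi> m * (\<Prod>i<n. (d / (d + real (Suc (e i)))) powr (\<alpha> + real (k m i)))) =
          (\<lambda>m. \<pi> m * (\<Prod>i<n. \<integral>y. Y y * Y y ^ e i \<partial>G m i))"
      proof -
        have "(d / (d + real (Suc (e i)))) powr (\<alpha> + real (k m i)) = (\<integral>y. Y y * Y y ^ e i \<partial>G m i)" for m i
          unfolding Y_def pw G_def using \<alpha> d by (subst gamma_dist_laplace) auto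
        then show ?thesis by simp
      qed
      finally show ?thesis .
    qed
  qed (auto simp: V_def Y_def p_def \<pi>0 \<pi>_summable)
  have factor: "exp (- \<bar>z\<bar>) * p i (exp (- \<bar>z\<bar>)) = min 1 (exp (x i - z))" if "0 \<le> z" "i < n" for z i
    using that by (auto simp: p_def max_def min_def exp_minus exp_diff field_simps)
  have comp: "(\<integral>y. Y y * p i (Y y) \<partial>G m i) \<le> b i" "0 \<le> (\<integral>y. Y y * p i (Y y) \<partial>G m i)" if i: "i < n" for m i
  proof -
    have pm: "p i \<in> borel_measurable borel" unfolding p_def[abs_def] by measurable
    have "(\<integral>y. Y y * p i (Y y) \<partial>G m i) = (\<integral>y. min 1 (exp (x i - y)) \<partial>G m i)"
    proof (rule integral_cong_AE)
      show "AE y in G m i. Y y * p i (Y y) = min 1 (exp (x i - y))"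
        unfolding G_def using AE_gamma_dist_nonneg
        by eventually_elim (use factor[OF _ i] in \<open>simp add: Y_def\<close>)
    qed (use pm in \<open>auto simp: G_def\<close>)
    also have "\<dots> \<le> b i"
      unfolding G_def b_def using \<alpha> d by (intro gamma_dist_add_nat_antitone)
      (auto simp: antimono_def intro: min.coboundedI2)
    finally show "(\<integral>y. Y y * p i (Y y) \<partial>G m i) \<le> b i" .
    show "0 \<le> (\<integral>y. Y y * p i (Y y) \<partial>G m i)"
      by (intro Bochner_Integration.integral_nonneg)
        (auto simp: Y_def p_def zero_le_divide_iff le_max_iff_disj)
  qed
  have "measure M {\<omega> \<in> space M. \<forall>i<n. X i \<omega> \<le> x i} =
      (\<integral>\<omega>. indicator {\<omega> \<in> space M. \<forall>i<n. X i \<omega> \<le> x i} \<omega> \<partial>M)"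
    by simp
  also have "\<dots> \<le> (\<integral>\<omega>. (\<Prod>i<n. V i \<omega> * p i (V i \<omega>)) \<partial>M)"
  proof (rule integral_mono_AE)
    have pm: "p i \<in> borel_measurable borel" for i unfolding p_def[abs_def] by measurable
    show "integrable M (\<lambda>\<omega>. \<Prod>i<n. V i \<omega> * p i (V i \<omega>))"
    proof (rule M.integrable_const_bound[of _ 1])
      show "AE \<omega> in M. norm (\<Prod>i<n. V i \<omega> * p i (V i \<omega>)) \<le> 1"
        using Xall
      proof eventually_elim
        case (elim \<omega>)
        have "(\<Prod>i<n. \<bar>V i \<omega> * p i (V i \<omega>)\<bar>) \<le> 1"
          using factor elim by (intro prod_le_1) (auto simp: V_def)
        then show ?case by (simp add: abs_prod)
      qed
    qed (use pm in \<open>auto simp: V_def[abs_def] intro!: borel_measurable_prod\<close>)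
    show "AE \<omega> in M. indicator {\<omega> \<in> space M. \<forall>i<n. X i \<omega> \<le> x i} \<omega> \<le> (\<Prod>i<n. V i \<omega> * p i (V i \<omega>))"
      using Xall
    proof eventually_elim
      case (elim \<omega>)
      have "(\<Prod>i<n. V i \<omega> * p i (V i \<omega>)) = (\<Prod>i<n. min 1 (exp (x i - X i \<omega>)))"
        unfolding V_def using elim factor by (intro prod.cong) auto
      then show ?case by (auto simp: indicator_def intro!: prod_nonneg)
    qed
    have "{\<omega> \<in> space M. \<forall>i\<in>{..<n}. X i \<omega> \<le> x i} \<in> sets M"
      by (rule sets.sets_Collect_finite_All) auto
    moreover have "{\<omega> \<in> space M. \<forall>i\<in>{..<n}. X i \<omega> \<le> x i} = {\<omega> \<in> space M. \<forall>i<n. X i \<omega> \<le> x i}"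
      by auto
    ultimately show "integrable M (indicat_real {\<omega> \<in> space M. \<forall>i<n. X i \<omega> \<le> x i})"
      by (intro integrable_real_indicator) (auto simp: M.emeasure_eq_measure)
  qed
  also have "\<dots> \<le> (\<Sum>m. \<pi> m * (\<Prod>i<n. b i))"
    unfolding main
  proof (rule suminf_le)
    have le: "\<pi> m * (\<Prod>i<n. \<integral>y. Y y * p i (Y y) \<partial>G m i) \<le> \<pi> m * (\<Prod>i<n. b i)" for m
      using comp by (intro mult_left_mono prod_mono \<pi>0) auto
    then show "\<pi> m * (\<Prod>i<n. \<integral>y. Y y * p i (Y y) \<partial>G m i) \<le> \<pi> m * (\<Prod>i<n. b i)" for m .
    show s: "summable (\<lambda>m. \<pi> m * (\<Prod>i<n. b i))" by (intro summable_mult2 \<pi>_summable)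
    show "summable (\<lambda>m. \<pi> m * (\<Prod>i<n. \<integral>y. Y y * p i (Y y) \<partial>G m i))"
      using le comp(2) \<pi>0 by (intro summable_comparison_test[OF _ s])
        (auto simp: abs_mult abs_prod)
  qed
  also have "\<dots> = suminf \<pi> * (\<Prod>i<n. b i)" by (rule suminf_mult2[OF \<pi>_summable, symmetric])
  also have "\<dots> \<le> 1 * (\<Prod>i<n. b i)" by (intro mult_right_mono \<pi>_le prod_nonneg b0)
  finally show ?thesis by (simp add: b_def)
qed

section \<open>Excessive functions of killed Brownian motion\<close>

lemma C2_derivatives:
  assumes "C2 f"
  shows "(f has_real_derivative deriv f x) (at x)"
    and "(deriv f has_real_derivative deriv (deriv f) x) (at x)"
    and "continuous_on UNIV (deriv (deriv f))"
    and "continuous_on UNIV f"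
proof -
  from assms have f: "f differentiable_on UNIV" and f': "deriv f differentiable_on UNIV"
    by (auto simp: C2_def)
  show "(f has_real_derivative deriv f x) (at x)"
    using f by (auto simp: differentiable_on_def intro!: DERIV_deriv_iff_real_differentiable[THEN iffD2])
  show "(deriv f has_real_derivative deriv (deriv f) x) (at x)"
    using f' by (auto simp: differentiable_on_def intro!: DERIV_deriv_iff_real_differentiable[THEN iffD2])
  show "continuous_on UNIV (deriv (deriv f))" using assms by (simp add: C2_def)
  show "continuous_on UNIV f" using f by (rule differentiable_imp_continuous_on)
qed

text \<open>
  Near \<open>0\<close> this is Taylor's theorem, and away from \<open>0\<close> a large multiple of \<open>h ^ 4\<close> pushes the polynomial
  below \<open>0 \<le> f\<close>. A fourth power is used because its expectation under a normal law of variance \<open>t\<close> is of order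
  \<open>t\<^sup>2\<close>, and so is negligible against the second order term.
\<close>

lemma quartic_minorant:
  fixes f :: "real \<Rightarrow> real"
  assumes f: "C2 f" and nonneg: "\<And>y. 0 \<le> f y" and m: "m < deriv (deriv f) x"
  obtains K where "0 \<le> K" "\<And>h. f x + deriv f x * h + m / 2 * h ^ 2 - K * h ^ 4 \<le> f (x + h)"
proof -
  note der = C2_derivatives[OF f]
  have "isCont (deriv (deriv f)) x"
    using der(3) by (simp add: continuous_on_eq_continuous_at)
  then have "\<forall>\<^sub>F y in at x. m < deriv (deriv f) y"
    using m by (intro order_tendstoD(1)) (auto simp: isCont_def)
  then obtain r where r: "0 < r" "\<And>y. y \<noteq> x \<Longrightarrow> \<bar>y - x\<bar> < r \<Longrightarrow> m < deriv (deriv f) y"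
    by (auto simp: eventually_at dist_real_def)
  have near: "f x + deriv f x * h + m / 2 * h ^ 2 \<le> f (x + h)" if h: "\<bar>h\<bar> < r" for h
  proof (cases "h = 0")
    case False
    define d where "d k = (if k = 0 then f else if k = 1 then deriv f else deriv (deriv f))" for k :: nat
    have "\<exists>t. (if x + h < x then x + h < t \<and> t < x else x < t \<and> t < x + h) \<and>
        f (x + h) = (\<Sum>k<2. d k x / fact k * (x + h - x) ^ k) + d 2 t / fact 2 * (x + h - x) ^ 2"
      using False der(1,2)
      by (intro Taylor[of 2 d f "x - \<bar>h\<bar>" "x + \<bar>h\<bar>" x "x + h"]) (auto simp: d_def less_2_cases_iff)
    then obtain t where t: "if x + h < x then x + h < t \<and> t < x else x < t \<and> t < x + h"
      and eq: "f (x + h) = (\<Sum>k<2. d k x / fact k * (x + h - x) ^ k) + d 2 t / fact 2 * (x + h - x) ^ 2" by blast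
    have "t \<noteq> x" "\<bar>t - x\<bar> < r" using t h by (auto split: if_splits)
    then have "m < deriv (deriv f) t" by (rule r(2))
    moreover have "f (x + h) = f x + deriv f x * h + deriv (deriv f) t / 2 * h ^ 2"
      using eq by (simp add: d_def numeral_2_eq_2)
    ultimately show ?thesis by (simp add: mult_right_mono)
  qed simp
  define K where "K = (f x + \<bar>deriv f x\<bar> * r + \<bar>m\<bar> / 2 * r ^ 2) / r ^ 4"
  have K: "0 \<le> K" unfolding K_def using nonneg[of x] r(1) by auto
  show ?thesis
  proof (rule that[OF K])
    fix h
    show "f x + deriv f x * h + m / 2 * h ^ 2 - K * h ^ 4 \<le> f (x + h)"
    proof (cases "\<bar>h\<bar> < r")
      case True
      have "0 \<le> K * h ^ 4" using K by simp
      then show ?thesis using near[OF True] by linarith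
    next
      case False
      define u where "u = \<bar>h\<bar> / r"
      have u: "1 \<le> u" "\<bar>h\<bar> = u * r" using False r(1) by (auto simp: u_def)
      have pw: "1 \<le> u ^ 4" "u \<le> u ^ 4" "u ^ 2 \<le> u ^ 4"
        using u(1) power_increasing[of 1 4 u] power_increasing[of 2 4 u] one_le_power[of u 4] by auto
      have "deriv f x * h \<le> \<bar>deriv f x\<bar> * r * u"
        using abs_ge_self[of "deriv f x * h"] u(2) by (simp add: abs_mult mult_ac)
      also have "\<dots> \<le> \<bar>deriv f x\<bar> * r * u ^ 4" using pw r(1) by (intro mult_left_mono) auto
      finally have 1: "deriv f x * h \<le> \<bar>deriv f x\<bar> * r * u ^ 4" .
      have h2: "h ^ 2 = u ^ 2 * r ^ 2" using u(2) by (metis power2_abs power_mult_distrib)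
      have "m / 2 * h ^ 2 \<le> \<bar>m\<bar> / 2 * h ^ 2" by (intro mult_right_mono) auto
      also have "\<dots> = \<bar>m\<bar> / 2 * r ^ 2 * u ^ 2" unfolding h2 by simp
      also have "\<dots> \<le> \<bar>m\<bar> / 2 * r ^ 2 * u ^ 4" using pw by (intro mult_left_mono) auto
      finally have 2: "m / 2 * h ^ 2 \<le> \<bar>m\<bar> / 2 * r ^ 2 * u ^ 4" .
      have 3: "f x \<le> f x * u ^ 4" using pw(1) nonneg[of x] by (simp add: mult_le_cancel_left1)
      have "h ^ 4 = (h ^ 2) ^ 2" by simp
      also have "\<dots> = u ^ 4 * r ^ 4" unfolding h2 by (simp add: power_mult_distrib)
      finally have "K * h ^ 4 = (f x + \<bar>deriv f x\<bar> * r + \<bar>m\<bar> / 2 * r ^ 2) * u ^ 4"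
        using r(1) by (simp add: K_def)
      with 1 2 3 have "f x + deriv f x * h + m / 2 * h ^ 2 - K * h ^ 4 \<le> 0"
        by (simp add: distrib_right)
      then show ?thesis using nonneg[of "x + h"] by linarith
    qed
  qed
qed

text \<open>
  The killing time is independent of the whole path, hence of the value at time \<open>t\<close>, and it exceeds \<open>t\<close>
  with probability \<open>exp (- \<kappa> * t)\<close>.
\<close>

lemma killed_brownian_expectation:
  assumes kbm: "killed_brownian_motion \<kappa> P B" and \<kappa>: "0 < \<kappa>" and t: "0 < t"
    and f[measurable]: "f \<in> borel_measurable borel" and f0: "\<And>y. 0 \<le> f y"
  obtains W where "distributed (P x) lborel (\<lambda>\<omega>. W \<omega> - x) (normal_density 0 (sqrt t))"
    "(\<integral>\<^sup>+\<omega>. (case B t \<omega> of None \<Rightarrow> 0 | Some y \<Rightarrow> ennreal (f y)) \<partial>P x) =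
      (\<integral>\<^sup>+\<omega>. ennreal (f (W \<omega>)) \<partial>P x) * ennreal (exp (- \<kappa> * t))"
    "W \<in> borel_measurable (P x)" "prob_space (P x)"
proof -
  obtain W \<zeta> where WZ: "\<forall>x. brownian_motion_from x (P x) W \<and>
             distributed (P x) lborel \<zeta> (exponential_density \<kappa>) \<and>
             prob_space.indep_set (P x)
               {(\<lambda>\<omega>. \<lambda>t\<in>{0..}. W t \<omega>) -` A \<inter> space (P x) | A.
                  A \<in> sets (\<Pi>\<^sub>M t\<in>{0::real..}. (borel :: real measure))}
               {\<zeta> -` A \<inter> space (P x) | A. A \<in> sets borel}"
    and B: "B = (\<lambda>t \<omega>. if t < \<zeta> \<omega> then Some (W t \<omega>) else None)"
    using kbm unfolding killed_brownian_motion_def by blast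
  have bm: "brownian_motion_from x (P x) W"
    and \<zeta>: "distributed (P x) lborel \<zeta> (exponential_density \<kappa>)"
    and indep: "prob_space.indep_set (P x)
               {(\<lambda>\<omega>. \<lambda>t\<in>{0..}. W t \<omega>) -` A \<inter> space (P x) | A.
                  A \<in> sets (\<Pi>\<^sub>M t\<in>{0::real..}. (borel :: real measure))}
               {\<zeta> -` A \<inter> space (P x) | A. A \<in> sets borel}"
    using WZ[rule_format, of x] by simp_all
  interpret prob_space "P x" using bm by (simp add: brownian_motion_from_def)
  have W[measurable]: "W s \<in> borel_measurable (P x)" if "0 \<le> s" for s
    using bm that by (simp add: brownian_motion_from_def)
  have Wt[measurable]: "W t \<in> borel_measurable (P x)" using W t by simp
  have \<zeta>m[measurable]: "\<zeta> \<in> borel_measurable (P x)"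
    using \<zeta> by (simp add: distributed_def measurable_lborel2)
  have ind: "indep_var borel (W t) borel \<zeta>"
    unfolding indep_var_eq
  proof (intro conjI Wt \<zeta>m)
    show "indep_set (sigma_sets (space (P x)) {W t -` A \<inter> space (P x) |A. A \<in> sets borel})
        (sigma_sets (space (P x)) {\<zeta> -` A \<inter> space (P x) |A. A \<in> sets borel})"
    proof (rule indep_set_sigma_sets)
      have sub: "{W t -` A \<inter> space (P x) |A. A \<in> sets borel} \<subseteq>
         {(\<lambda>\<omega>. \<lambda>t\<in>{0..}. W t \<omega>) -` A \<inter> space (P x) | A. A \<in> sets (\<Pi>\<^sub>M t\<in>{0::real..}. (borel :: real measure))}"
      proof safe
        fix A :: "real set" assume A: "A \<in> sets borel"
        let ?C = "(\<lambda>p. p t) -` A \<inter> space (\<Pi>\<^sub>M t\<in>{0::real..}. (borel :: real measure))"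
        have "?C \<in> sets (\<Pi>\<^sub>M t\<in>{0::real..}. (borel :: real measure))"
          using t A by (intro measurable_sets[OF measurable_component_singleton]) auto
        moreover have "W t -` A \<inter> space (P x) = (\<lambda>\<omega>. \<lambda>t\<in>{0..}. W t \<omega>) -` ?C \<inter> space (P x)"
          using t by (auto simp: space_PiM)
        ultimately show "\<exists>Aa. W t -` A \<inter> space (P x) = (\<lambda>\<omega>. \<lambda>t\<in>{0..}. W t \<omega>) -` Aa \<inter> space (P x) \<and>
            Aa \<in> sets (\<Pi>\<^sub>M t\<in>{0::real..}. (borel :: real measure))" by blast
      qed
      show "indep_set {W t -` A \<inter> space (P x) |A. A \<in> sets borel}
         {\<zeta> -` A \<inter> space (P x) |A. A \<in> sets borel}"
        using indep unfolding indep_set_def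
        by (rule indep_sets_mono_sets) (simp add: sub split: bool.split)
      show "Int_stable {W t -` A \<inter> space (P x) |A. A \<in> sets borel}"
        by (auto simp: Int_stable_def) (metis (no_types, lifting) Int_assoc Int_left_absorb Int_left_commute inf.idem sets.Int vimage_Int)
      show "Int_stable {\<zeta> -` A \<inter> space (P x) |A. A \<in> sets borel}"
        by (auto simp: Int_stable_def) (metis (no_types, lifting) Int_assoc Int_left_absorb Int_left_commute inf.idem sets.Int vimage_Int)
    qed
  qed
  let ?Y = "case_bool (\<lambda>\<omega>. ennreal (f (W t \<omega>))) (\<lambda>\<omega>. indicator {t<..} (\<zeta> \<omega>))"
  have "indep_var borel ((\<lambda>y. ennreal (f y)) \<circ> W t) borel ((\<lambda>z. indicator {t<..} z :: ennreal) \<circ> \<zeta>)"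
    by (rule indep_var_compose[OF ind]) auto
  then have iv: "indep_vars (\<lambda>_. borel) ?Y UNIV"
    unfolding indep_var_def by (rule indep_vars_cong[THEN iffD1, rotated -1]) (auto split: bool.split simp: comp_def)
  have "(\<integral>\<^sup>+\<omega>. (case B t \<omega> of None \<Rightarrow> 0 | Some y \<Rightarrow> ennreal (f y)) \<partial>P x) =
      (\<integral>\<^sup>+\<omega>. (\<Prod>i\<in>UNIV. ?Y i \<omega>) \<partial>P x)"
    by (intro nn_integral_cong) (auto simp: B UNIV_bool indicator_def)
  also have "\<dots> = (\<Prod>i\<in>UNIV. \<integral>\<^sup>+\<omega>. ?Y i \<omega> \<partial>P x)"
    using iv by (intro indep_vars_nn_integral) (auto split: bool.split)
  also have "\<dots> = (\<integral>\<^sup>+\<omega>. ennreal (f (W t \<omega>)) \<partial>P x) * (\<integral>\<^sup>+\<omega>. indicator {t<..} (\<zeta> \<omega>) \<partial>P x)"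
    by (simp add: UNIV_bool mult.commute)
  also have "(\<integral>\<^sup>+\<omega>. indicator {t<..} (\<zeta> \<omega>) \<partial>P x) = ennreal (exp (- \<kappa> * t))"
  proof -
    have "(\<integral>\<^sup>+\<omega>. indicator {t<..} (\<zeta> \<omega>) \<partial>P x) = (\<integral>\<^sup>+\<omega>. indicator {\<omega> \<in> space (P x). t < \<zeta> \<omega>} \<omega> \<partial>P x)"
      by (intro nn_integral_cong) (auto simp: indicator_def)
    also have "\<dots> = emeasure (P x) {\<omega> \<in> space (P x). t < \<zeta> \<omega>}"
      by (intro nn_integral_indicator) measurable
    also have "\<dots> = ennreal (exp (- \<kappa> * t))"
      using exponential_distributedD_gt[OF \<zeta>, of t] t \<kappa> by (simp add: emeasure_eq_measure mult.commute)
    finally show ?thesis .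
  qed
  finally have E: "(\<integral>\<^sup>+\<omega>. (case B t \<omega> of None \<Rightarrow> 0 | Some y \<Rightarrow> ennreal (f y)) \<partial>P x) =
      (\<integral>\<^sup>+\<omega>. ennreal (f (W t \<omega>)) \<partial>P x) * ennreal (exp (- \<kappa> * t))" .
  have W0: "AE \<omega> in P x. W 0 \<omega> = x" using bm by (simp add: brownian_motion_from_def)
  have "distributed (P x) lborel (\<lambda>\<omega>. W t \<omega> - W 0 \<omega>) (normal_density 0 (sqrt (t - 0)))"
    using bm t unfolding brownian_motion_from_def by blast
  moreover have "distr (P x) lborel (\<lambda>\<omega>. W t \<omega> - W 0 \<omega>) = distr (P x) lborel (\<lambda>\<omega>. W t \<omega> - x)"
    using W0 W by (intro distr_cong_AE) (auto elim!: AE_mp)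
  ultimately have "distributed (P x) lborel (\<lambda>\<omega>. W t \<omega> - x) (normal_density 0 (sqrt t))"
    by (simp add: distributed_def)
  from that[OF this E Wt] show ?thesis using prob_space_axioms by simp
qed

text \<open>
  Excessiveness gives \<open>exp (- lam\<^sup>2 * t / 2) * E (f W) \<le> f x\<close>, where \<open>W\<close> is normal with mean \<open>x\<close> and
  variance \<open>t\<close>. Inserting the polynomial minorant and comparing the terms of first order in \<open>t\<close>
  bounds every \<open>m < f'' x\<close> by \<open>lam\<^sup>2 * f x\<close>.
\<close>

lemma excessive_second_derivative:
  assumes f: "C2 f" and kbm: "killed_brownian_motion (lam\<^sup>2 / 2) P B" and exc: "excessive UNIV P B f"
    and lam: "0 < lam"
  shows "0 \<le> f x" and "deriv (deriv f) x \<le> lam\<^sup>2 * f x"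
proof -
  show f0: "0 \<le> f x" for x using exc by (simp add: excessive_def)
  have [measurable]: "f \<in> borel_measurable borel"
    using C2_derivatives(4)[OF f] by (rule borel_measurable_continuous_onI)
  define \<kappa> where "\<kappa> = lam\<^sup>2 / 2"
  have \<kappa>: "0 < \<kappa>" using lam by (simp add: \<kappa>_def)
  have le: "(\<integral>\<^sup>+\<omega>. (case B t \<omega> of None \<Rightarrow> 0 | Some y \<Rightarrow> ennreal (f y)) \<partial>P x) \<le> ennreal (f x)" (is "?E t \<le> _")
    if t: "0 < t" for t
  proof -
    have anti: "antimono_on {0<..} ?E" and lim: "(?E \<longlongrightarrow> ennreal (f x)) (at_right 0)"
      using exc by (auto simp: excessive_def Let_def)
    show "?E t \<le> ennreal (f x)"
    proof (rule tendsto_lowerbound[OF lim])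
      show "\<forall>\<^sub>F s in at_right 0. ?E t \<le> ?E s"
        using eventually_at_right_real[OF t]
      proof eventually_elim
        case (elim s)
        then show ?case using monotone_onD[OF anti, of s t] t by simp
      qed
    qed simp
  qed
  show "deriv (deriv f) x \<le> lam\<^sup>2 * f x"
  proof (rule ccontr)
    assume "\<not> ?thesis"
    then obtain m where m: "lam\<^sup>2 * f x < m" "m < deriv (deriv f) x" using dense by (metis not_le)
    obtain K where K: "0 \<le> K" "\<And>h. f x + deriv f x * h + m / 2 * h ^ 2 - K * h ^ 4 \<le> f (x + h)"
      using quartic_minorant[OF f f0 m(2)] by blast
    have ineq: "f x + m / 2 * t - 3 * K * t ^ 2 \<le> f x * exp (\<kappa> * t)" if t: "0 < t" for t
    proof -
      obtain W where W: "distributed (P x) lborel (\<lambda>\<omega>. W \<omega> - x) (normal_density 0 (sqrt t))"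
        "?E t = (\<integral>\<^sup>+\<omega>. ennreal (f (W \<omega>)) \<partial>P x) * ennreal (exp (- \<kappa> * t))"
        and Wm[measurable]: "W \<in> borel_measurable (P x)" and prob: "prob_space (P x)"
        using killed_brownian_expectation[OF kbm[folded \<kappa>_def] \<kappa> t \<open>f \<in> borel_measurable borel\<close> f0] by metis
      interpret prob_space "P x" by (rule prob)
      let ?Z = "\<lambda>\<omega>. W \<omega> - x"
      have moment: "integrable (P x) (\<lambda>\<omega>. ?Z \<omega> ^ k)" "(\<integral>\<omega>. ?Z \<omega> ^ k \<partial>P x) = c"
        if "has_bochner_integral lborel (\<lambda>y. normal_density 0 (sqrt t) y * y ^ k) c" for k c
        using that distributed_integrable[OF W(1), of "\<lambda>y. y ^ k"] distributed_integral[OF W(1), of "\<lambda>y. y ^ k"]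
        by (auto simp: has_bochner_integral_iff)
      have st: "0 < sqrt t" using t by simp
      have Z1: "has_bochner_integral lborel (\<lambda>y. normal_density 0 (sqrt t) y * y ^ 1) 0"
        using normal_moment_odd[OF st, of 0 0] by simp
      have Z2: "has_bochner_integral lborel (\<lambda>y. normal_density 0 (sqrt t) y * y ^ 2) t"
        using normal_moment_even[OF st, of 0 1] t by simp
      have Z4: "has_bochner_integral lborel (\<lambda>y. normal_density 0 (sqrt t) y * y ^ 4) (3 * t ^ 2)"
      proof -
        have "fact (2 * 2) / ((2 / (sqrt t)\<^sup>2) ^ 2 * fact 2) = 3 * t ^ 2"
          using t by (simp add: fact_numeral power2_eq_square field_simps)
        then show ?thesis using normal_moment_even[OF st, of 0 2] by simp
      qed
      have Wfin: "(\<integral>\<^sup>+\<omega>. ennreal (f (W \<omega>)) \<partial>P x) \<le> ennreal (f x * exp (\<kappa> * t))"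
      proof -
        have "(\<integral>\<^sup>+\<omega>. ennreal (f (W \<omega>)) \<partial>P x) =
            (\<integral>\<^sup>+\<omega>. ennreal (f (W \<omega>)) \<partial>P x) * ennreal (exp (- \<kappa> * t)) * ennreal (exp (\<kappa> * t))"
          by (simp add: mult.assoc ennreal_mult[symmetric] exp_add[symmetric])
        also have "\<dots> \<le> ennreal (f x) * ennreal (exp (\<kappa> * t))"
          using le[OF t] unfolding W(2) by (intro mult_right_mono) auto
        finally show ?thesis using f0 by (simp add: ennreal_mult)
      qed
      have Wint: "integrable (P x) (\<lambda>\<omega>. f (W \<omega>))"
        using f0 Wfin by (intro integrableI_nonneg) (auto intro: le_less_trans)
      have "f x + m / 2 * t - 3 * K * t ^ 2 =
          (\<integral>\<omega>. f x + deriv f x * ?Z \<omega> ^ 1 + m / 2 * ?Z \<omega> ^ 2 - K * ?Z \<omega> ^ 4 \<partial>P x)"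
        using moment[OF Z1] moment[OF Z2] moment[OF Z4] by (simp add: prob_space)
      also have "\<dots> \<le> (\<integral>\<omega>. f (W \<omega>) \<partial>P x)"
      proof (rule integral_mono[OF _ Wint])
        show "integrable (P x) (\<lambda>\<omega>. f x + deriv f x * ?Z \<omega> ^ 1 + m / 2 * ?Z \<omega> ^ 2 - K * ?Z \<omega> ^ 4)"
          using moment(1)[OF Z1] moment(1)[OF Z2] moment(1)[OF Z4] by simp
        show "f x + deriv f x * ?Z \<omega> ^ 1 + m / 2 * ?Z \<omega> ^ 2 - K * ?Z \<omega> ^ 4 \<le> f (W \<omega>)" for \<omega>
          using K(2)[of "?Z \<omega>"] by simp
      qed
      also have "\<dots> \<le> f x * exp (\<kappa> * t)"
      proof -
        have "ennreal (\<integral>\<omega>. f (W \<omega>) \<partial>P x) \<le> ennreal (f x * exp (\<kappa> * t))"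
          using Wfin nn_integral_eq_integral[OF Wint] f0 by simp
        then show ?thesis using f0 by (subst (asm) ennreal_le_iff) auto
      qed
      finally show ?thesis .
    qed
    have "m / 2 \<le> \<kappa> * f x"
    proof (rule tendsto_le)
      show "((\<lambda>t. m / 2 - 3 * K * t) \<longlongrightarrow> m / 2) (at_right 0)" by (auto intro!: tendsto_eq_intros)
      show "((\<lambda>t. \<kappa> * f x + \<kappa>\<^sup>2 * t * f x) \<longlongrightarrow> \<kappa> * f x) (at_right 0)" by (auto intro!: tendsto_eq_intros)
      have "0 < 1 / \<kappa>" using \<kappa> by simp
      then show "\<forall>\<^sub>F t in at_right 0. m / 2 - 3 * K * t \<le> \<kappa> * f x + \<kappa>\<^sup>2 * t * f x"
        unfolding eventually_at_right_field
      proof (intro exI[of _ "1 / \<kappa>"] conjI allI impI)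
        fix t :: real assume t: "0 < t" "t < 1 / \<kappa>"
        have "\<kappa> * t \<le> 1" using t \<kappa> by (simp add: field_simps)
        then have "exp (\<kappa> * t) \<le> 1 + \<kappa> * t + (\<kappa> * t)\<^sup>2" using \<kappa> t by (intro exp_bound) auto
        then have "f x * exp (\<kappa> * t) \<le> f x * (1 + \<kappa> * t + (\<kappa> * t)\<^sup>2)" using f0 by (intro mult_left_mono)
        with ineq[OF t(1)] have "t * (m / 2 - 3 * K * t) \<le> t * (\<kappa> * f x + \<kappa>\<^sup>2 * t * f x)"
          by (simp add: algebra_simps power2_eq_square)
        then show "m / 2 - 3 * K * t \<le> \<kappa> * f x + \<kappa>\<^sup>2 * t * f x" using t(1) by simp
      qed
    qed simp
    with m(1) show False by (simp add: \<kappa>_def)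
  qed
qed

text \<open>
  The bound says that \<open>exp (- lam * x) * f x\<close> is nonincreasing, that is \<open>f' \<le> lam * f\<close>. The function
  \<open>exp (lam * u) * (f' u - lam * f u)\<close> is nonincreasing by the differential inequality. If it were positive at some
  point, it would be bounded below by a positive constant to the left of it, and \<open>exp (- lam * u) * f u\<close>
  would become negative as \<open>u\<close> tends to \<open>- \<infinity>\<close>.
\<close>

lemma harnack_of_second_derivative:
  fixes f f' f'' :: "real \<Rightarrow> real"
  assumes lam: "0 < lam"
    and f': "\<And>x. (f has_real_derivative f' x) (at x)" and f'': "\<And>x. (f' has_real_derivative f'' x) (at x)"
    and f0: "\<And>x. 0 \<le> f x" and le: "\<And>x. f'' x \<le> lam\<^sup>2 * f x"
  shows "x \<le> y \<Longrightarrow> f y \<le> exp (lam * (y - x)) * f x"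
proof -
  have deriv_le: "f' x \<le> lam * f x" for x
  proof (rule ccontr)
    assume "\<not> ?thesis"
    then have c: "0 < f' x - lam * f x" (is "0 < ?c") by simp
    have anti: "exp (lam * v) * (f' v - lam * f v) \<le> exp (lam * u) * (f' u - lam * f u)" if "u \<le> v" for u v
    proof (rule DERIV_nonpos_imp_nonincreasing[OF that])
      fix z
      show "\<exists>D. ((\<lambda>z. exp (lam * z) * (f' z - lam * f z)) has_real_derivative D) (at z) \<and> D \<le> 0"
      proof (intro exI conjI)
        show "((\<lambda>z. exp (lam * z) * (f' z - lam * f z)) has_real_derivative exp (lam * z) * (f'' z - lam\<^sup>2 * f z)) (at z)"
          by (auto intro!: derivative_eq_intros f' f'' simp: algebra_simps power2_eq_square)
        show "exp (lam * z) * (f'' z - lam\<^sup>2 * f z) \<le> 0" using le[of z] by (simp add: mult_nonneg_nonpos)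
      qed
    qed
    \<comment> \<open>\<open>exp (- lam * u) * f u\<close> minus an antiderivative of the lower bound for its derivative\<close>
    define E where "E u = exp (- lam * u) * f u - ?c * exp (lam * x) / (- 2 * lam) * exp (- 2 * lam * u)" for u
    have Emono: "E u \<le> E x" if "u \<le> x" for u
    proof (rule DERIV_nonneg_imp_nondecreasing[OF that])
      fix z assume z: "u \<le> z" "z \<le> x"
      show "\<exists>D. (E has_real_derivative D) (at z) \<and> 0 \<le> D"
      proof (intro exI conjI)
        show "(E has_real_derivative exp (- lam * z) * (f' z - lam * f z) - ?c * exp (lam * x) * exp (- 2 * lam * z)) (at z)"
          unfolding E_def[abs_def] using lam by (auto intro!: derivative_eq_intros f' simp: field_simps)
        have "- 2 * lam * z + lam * z = (- 2 + 1) * (lam * z)" by (simp only: distrib_right mult.assoc mult_1)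
        then have "- lam * z = - 2 * lam * z + lam * z" by simp
        then have "exp (- lam * z) * (f' z - lam * f z) = exp (- 2 * lam * z) * (exp (lam * z) * (f' z - lam * f z))"
          by (simp only: exp_add mult.assoc)
        moreover have "exp (- 2 * lam * z) * (exp (lam * x) * ?c) \<le> exp (- 2 * lam * z) * (exp (lam * z) * (f' z - lam * f z))"
          using anti[OF z(2)] by (intro mult_left_mono) auto
        ultimately show "0 \<le> exp (- lam * z) * (f' z - lam * f z) - ?c * exp (lam * x) * exp (- 2 * lam * z)"
          by (simp only: diff_ge_0_iff_ge mult_ac)
      qed
    qed
    have "?c * exp (lam * x) / (2 * lam) * exp (- 2 * lam * u) \<le> E u" for u
      unfolding E_def using f0[of u] lam by (simp add: field_simps)
    then have bound: "?c * exp (lam * x) / (2 * lam) * exp (- 2 * lam * u) \<le> E x" if "u \<le> x" for u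
      using Emono[OF that] by (meson order_trans)
    have "filterlim (\<lambda>u. ?c * exp (lam * x) / (2 * lam) * exp (- 2 * lam * u)) at_top at_bot"
    proof -
      have "0 < ?c * exp (lam * x) / (2 * lam)" using c lam by simp
      moreover have "filterlim (\<lambda>u. 2 * lam * (- u)) at_top at_bot"
        using lam by (intro filterlim_tendsto_pos_mult_at_top[OF tendsto_const] filterlim_uminus_at_top_at_bot) auto
      then have "filterlim (\<lambda>u. - 2 * lam * u) at_top at_bot" by simp
      then have "filterlim (\<lambda>u. exp (- 2 * lam * u)) at_top at_bot" by (rule filterlim_compose[OF exp_at_top])
      ultimately show ?thesis by (intro filterlim_tendsto_pos_mult_at_top[OF tendsto_const])
    qed
    then have "\<forall>\<^sub>F u in at_bot. E x < ?c * exp (lam * x) / (2 * lam) * exp (- 2 * lam * u)"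
      unfolding filterlim_at_top_dense by blast
    then have "\<forall>\<^sub>F u in at_bot. E x < ?c * exp (lam * x) / (2 * lam) * exp (- 2 * lam * u) \<and> u \<le> x"
      using eventually_le_at_bot[of x] by (rule eventually_conj)
    then obtain u where "E x < ?c * exp (lam * x) / (2 * lam) * exp (- 2 * lam * u)" "u \<le> x"
      using eventually_happens[of _ "at_bot :: real filter"] by auto
    with bound[of u] show False by simp
  qed
  assume xy: "x \<le> y"
  have "exp (- lam * y) * f y \<le> exp (- lam * x) * f x"
  proof (rule DERIV_nonpos_imp_nonincreasing[OF xy])
    fix z
    show "\<exists>D. ((\<lambda>z. exp (- lam * z) * f z) has_real_derivative D) (at z) \<and> D \<le> 0"
    proof (intro exI conjI)
      show "((\<lambda>z. exp (- lam * z) * f z) has_real_derivative exp (- lam * z) * (f' z - lam * f z)) (at z)"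
        by (auto intro!: derivative_eq_intros f' simp: algebra_simps)
      show "exp (- lam * z) * (f' z - lam * f z) \<le> 0" using deriv_le[of z] by (simp add: mult_nonneg_nonpos)
    qed
  qed
  then have "exp (lam * y) * (exp (- lam * y) * f y) \<le> exp (lam * y) * (exp (- lam * x) * f x)"
    by (intro mult_left_mono) auto
  then show "f y \<le> exp (lam * (y - x)) * f x"
    by (simp add: mult.assoc[symmetric] exp_add[symmetric] right_diff_distrib)
qed

lemma harnack_two_sided:
  fixes f f' f'' :: "real \<Rightarrow> real"
  assumes lam: "0 < lam"
    and f': "\<And>x. (f has_real_derivative f' x) (at x)" and f'': "\<And>x. (f' has_real_derivative f'' x) (at x)"
    and f0: "\<And>x. 0 \<le> f x" and le: "\<And>x. f'' x \<le> lam\<^sup>2 * f x"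
  shows "f y \<le> exp (lam * \<bar>y - x\<bar>) * f x"
proof (cases "x \<le> y")
  case True
  then show ?thesis using harnack_of_second_derivative[OF lam f' f'' f0 le True] by simp
next
  case False
  have "f (- (- y)) \<le> exp (lam * (- y - (- x))) * f (- (- x))"
  proof (rule harnack_of_second_derivative[where f = "\<lambda>z. f (- z)" and f' = "\<lambda>z. - f' (- z)" and f'' = "\<lambda>z. f'' (- z)"])
    show "((\<lambda>z. f (- z)) has_real_derivative - f' (- z)) (at z)" for z
    proof -
      have "((\<lambda>z. f (- z)) has_real_derivative f' (- z) * (- 1)) (at z)"
        by (rule DERIV_chain2[OF f']) (auto intro!: derivative_eq_intros)
      then show ?thesis by simp
    qed
    show "((\<lambda>z. - f' (- z)) has_real_derivative f'' (- z)) (at z)" for z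
    proof -
      have "((\<lambda>z. f' (- z)) has_real_derivative f'' (- z) * (- 1)) (at z)"
        by (rule DERIV_chain2[OF f'']) (auto intro!: derivative_eq_intros)
      from DERIV_minus[OF this] show ?thesis by simp
    qed
  qed (use lam f0 le False in auto)
  then show ?thesis using False by simp
qed

text \<open>
  The sum \<open>p t = f (x - t) + f (x + t)\<close> satisfies \<open>p'' \<le> lam\<^sup>2 * p\<close> and has derivative \<open>0\<close> at \<open>0\<close>, so it grows no
  faster than the solution \<open>cosh (lam * t)\<close> of the equation.
\<close>

lemma three_point_of_second_derivative:
  fixes f f' f'' :: "real \<Rightarrow> real"
  assumes lam: "0 < lam" and h: "0 \<le> h"
    and f': "\<And>x. (f has_real_derivative f' x) (at x)" and f'': "\<And>x. (f' has_real_derivative f'' x) (at x)"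
    and le: "\<And>x. f'' x \<le> lam\<^sup>2 * f x"
  shows "f (x - h) + f (x + h) \<le> 2 * cosh (lam * h) * f x"
proof -
  define p where "p t = f (x - t) + f (x + t)" for t
  define p' where "p' t = f' (x + t) - f' (x - t)" for t
  define p'' where "p'' t = f'' (x + t) + f'' (x - t)" for t
  have p': "(p has_real_derivative p' t) (at t)" for t
    unfolding p_def[abs_def] p'_def
    by (auto intro!: derivative_eq_intros DERIV_chain2[OF f'])
  have p'': "(p' has_real_derivative p'' t) (at t)" for t
    unfolding p'_def[abs_def] p''_def
    by (auto intro!: derivative_eq_intros DERIV_chain2[OF f''])
  have p_le: "p'' t \<le> lam\<^sup>2 * p t" for t
    using le[of "x + t"] le[of "x - t"] by (simp add: p''_def p_def distrib_left)
  have w: "p' t * cosh (lam * t) - lam * p t * sinh (lam * t) \<le> 0" if t: "0 \<le> t" for t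
  proof -
    have "p' t * cosh (lam * t) - lam * p t * sinh (lam * t) \<le> p' 0 * cosh (lam * 0) - lam * p 0 * sinh (lam * 0)"
    proof (rule DERIV_nonpos_imp_nonincreasing[OF t])
      fix z
      show "\<exists>D. ((\<lambda>t. p' t * cosh (lam * t) - lam * p t * sinh (lam * t)) has_real_derivative D) (at z) \<and> D \<le> 0"
      proof (intro exI conjI)
        show "((\<lambda>t. p' t * cosh (lam * t) - lam * p t * sinh (lam * t)) has_real_derivative
            (p'' z - lam\<^sup>2 * p z) * cosh (lam * z)) (at z)"
          by (auto intro!: derivative_eq_intros p' p'' simp: algebra_simps power2_eq_square)
        show "(p'' z - lam\<^sup>2 * p z) * cosh (lam * z) \<le> 0" using p_le[of z] by (simp add: mult_nonpos_nonneg)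
      qed
    qed
    then show ?thesis by (simp add: p'_def)
  qed
  have "p h / cosh (lam * h) \<le> p 0 / cosh (lam * 0)"
  proof (rule DERIV_nonpos_imp_nonincreasing[OF h])
    fix z :: real assume z: "0 \<le> z"
    show "\<exists>D. ((\<lambda>t. p t / cosh (lam * t)) has_real_derivative D) (at z) \<and> D \<le> 0"
    proof (intro exI conjI)
      show "((\<lambda>t. p t / cosh (lam * t)) has_real_derivative
          (p' z * cosh (lam * z) - lam * p z * sinh (lam * z)) / (cosh (lam * z))\<^sup>2) (at z)"
        by (auto intro!: derivative_eq_intros p' simp: power2_eq_square algebra_simps)
      show "(p' z * cosh (lam * z) - lam * p z * sinh (lam * z)) / (cosh (lam * z))\<^sup>2 \<le> 0"
        using w[OF z] by (intro divide_nonpos_nonneg) auto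
    qed
  qed
  then show ?thesis by (simp add: p_def field_simps)
qed

section \<open>Exponential tails\<close>

text \<open>
  The values on one side of \<open>0\<close> suffice: the sum tends to \<open>c 0\<close> there, and after division by \<open>x\<close> the
  same applies to the shifted coefficients.
\<close>

lemma powser_coeffs_zero:
  fixes c :: "nat \<Rightarrow> real"
  assumes "0 < r" and "\<And>x. \<bar>x\<bar> < r \<Longrightarrow> summable (\<lambda>n. c n * x ^ n)"
    and "\<And>x. 0 < x \<Longrightarrow> x < r \<Longrightarrow> (\<Sum>n. c n * x ^ n) = 0"
  shows "c n = 0"
  using assms(2,3)
proof (induction n arbitrary: c)
  have zero: "c 0 = 0"
    if s: "\<And>x. \<bar>x\<bar> < r \<Longrightarrow> summable (\<lambda>n. c n * x ^ n)"
      and z: "\<And>x. 0 < x \<Longrightarrow> x < r \<Longrightarrow> (\<Sum>n. c n * x ^ n) = 0" for c :: "nat \<Rightarrow> real"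
  proof -
    have "((\<lambda>x. \<Sum>n. c n * x ^ n) \<longlongrightarrow> c 0) (at 0)"
      using s \<open>0 < r\<close> by (intro powser_limit_0[of r]) (auto simp: summable_sums)
    then have "((\<lambda>x. \<Sum>n. c n * x ^ n) \<longlongrightarrow> c 0) (at_right 0)"
      by (rule tendsto_within_subset) simp
    moreover have "((\<lambda>x. \<Sum>n. c n * x ^ n) \<longlongrightarrow> 0) (at_right 0)"
    proof (rule tendsto_eventually)
      show "\<forall>\<^sub>F x in at_right 0. (\<Sum>n. c n * x ^ n) = 0"
        using eventually_at_right_real[OF \<open>0 < r\<close>] by eventually_elim (simp add: z)
    qed
    ultimately show ?thesis by (intro tendsto_unique[of "at_right (0::real)"]) auto
  qed
  case 0
  then show ?case by (rule zero)
  case (Suc n c)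
  have c0: "c 0 = 0" using Suc.prems by (rule zero)
  show ?case
  proof (rule Suc.IH)
    show s: "summable (\<lambda>n. c (Suc n) * x ^ n)" if "\<bar>x\<bar> < r" for x
      using Suc.prems(1)[OF that] by (simp add: summable_powser_split_head)
    show "(\<Sum>n. c (Suc n) * x ^ n) = 0" if "0 < x" "x < r" for x
      using powser_split_head(1)[of c x] Suc.prems(1)[of x] Suc.prems(2)[of x] that c0 by simp
  qed
qed

text \<open>
  Expand around \<open>a = 1\<close>: the integral of \<open>W * exp ((h - 1) * Y)\<close> is a power series in \<open>h\<close> with nonnegative
  coefficients. For \<open>0 \<le> h < 1\<close> it agrees with the binomial series of \<open>(A + B - B * h) powr (- \<alpha>)\<close>, so
  the coefficients agree. By monotone convergence the identity extends to \<open>h = 1 + \<theta>\<close>, as long as this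
  lies in the disc of convergence of the binomial series.
\<close>

lemma exponential_moment_of_laplace:
  fixes Y W :: "'a \<Rightarrow> real"
  assumes M: "prob_space M"
    and Y[measurable]: "Y \<in> borel_measurable M" and Y0: "AE \<omega> in M. 0 \<le> Y \<omega>"
    and W[measurable]: "W \<in> borel_measurable M" and W0: "AE \<omega> in M. 0 \<le> W \<omega> \<and> W \<omega> \<le> 1"
    and laplace: "\<And>a. 0 < a \<Longrightarrow> (\<integral>\<omega>. W \<omega> * exp (- a * Y \<omega>) \<partial>M) = (A + B * a) powr (- \<alpha>)"
    and A: "0 < A" and B: "0 < B" and \<alpha>: "0 < \<alpha>" and \<theta>: "0 \<le> \<theta>" "\<theta> * B < A"
  shows "(\<integral>\<^sup>+\<omega>. ennreal (W \<omega> * exp (\<theta> * Y \<omega>)) \<partial>M) = ennreal ((A - B * \<theta>) powr (- \<alpha>))"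
proof -
  interpret prob_space M by (rule M)
  define m where "m k = (\<integral>\<^sup>+\<omega>. ennreal (W \<omega> * exp (- Y \<omega>) * Y \<omega> ^ k / fact k) \<partial>M)" for k
  define z where "z = B / (A + B)"
  define b where "b k = (A + B) powr (- \<alpha>) * (pochhammer \<alpha> k / fact k * z ^ k)" for k
  have z: "0 \<le> z" "z \<le> 1" using A B by (auto simp: z_def)
  have b0: "0 \<le> b k" for k
    unfolding b_def using z \<alpha> by (intro mult_nonneg_nonneg divide_nonneg_nonneg pochhammer_nonneg) auto
  have expand: "(\<integral>\<^sup>+\<omega>. ennreal (W \<omega> * exp ((h - 1) * Y \<omega>)) \<partial>M) = (\<Sum>k. m k * ennreal (h ^ k))"
    if h: "0 \<le> h" for h
  proof -
    have "(\<integral>\<^sup>+\<omega>. ennreal (W \<omega> * exp ((h - 1) * Y \<omega>)) \<partial>M) =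
        (\<integral>\<^sup>+\<omega>. (\<Sum>k. ennreal (W \<omega> * exp (- Y \<omega>) * Y \<omega> ^ k / fact k) * ennreal (h ^ k)) \<partial>M)"
    proof (rule nn_integral_cong_AE)
      show "AE \<omega> in M. ennreal (W \<omega> * exp ((h - 1) * Y \<omega>)) =
          (\<Sum>k. ennreal (W \<omega> * exp (- Y \<omega>) * Y \<omega> ^ k / fact k) * ennreal (h ^ k))"
        using Y0 W0
      proof eventually_elim
        case (elim \<omega>)
        have "(\<lambda>k. W \<omega> * exp (- Y \<omega>) * ((h * Y \<omega>) ^ k /\<^sub>R fact k)) sums (W \<omega> * exp (- Y \<omega>) * exp (h * Y \<omega>))"
          by (intro sums_mult exp_converges)
        moreover have "W \<omega> * exp (- Y \<omega>) * exp (h * Y \<omega>) = W \<omega> * exp ((h - 1) * Y \<omega>)"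
          by (simp add: mult.assoc exp_add[symmetric] left_diff_distrib)
        moreover have "W \<omega> * exp (- Y \<omega>) * ((h * Y \<omega>) ^ k /\<^sub>R fact k) =
            W \<omega> * exp (- Y \<omega>) * Y \<omega> ^ k / fact k * h ^ k" for k
          by (simp add: power_mult_distrib divide_inverse mult_ac)
        ultimately have "(\<lambda>k. W \<omega> * exp (- Y \<omega>) * Y \<omega> ^ k / fact k * h ^ k) sums (W \<omega> * exp ((h - 1) * Y \<omega>))"
          by simp
        then have "ennreal (W \<omega> * exp ((h - 1) * Y \<omega>)) =
            (\<Sum>k. ennreal (W \<omega> * exp (- Y \<omega>) * Y \<omega> ^ k / fact k * h ^ k))"
          using elim h by (intro suminf_ennreal_eq[symmetric]) auto
        also have "\<dots> = (\<Sum>k. ennreal (W \<omega> * exp (- Y \<omega>) * Y \<omega> ^ k / fact k) * ennreal (h ^ k))"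
          using elim h by (intro suminf_cong ennreal_mult) auto
        finally show ?case .
      qed
    qed
    also have "\<dots> = (\<Sum>k. \<integral>\<^sup>+\<omega>. ennreal (W \<omega> * exp (- Y \<omega>) * Y \<omega> ^ k / fact k) * ennreal (h ^ k) \<partial>M)"
      by (intro nn_integral_suminf) simp
    also have "\<dots> = (\<Sum>k. m k * ennreal (h ^ k))"
      unfolding m_def by (intro suminf_cong nn_integral_multc) simp
    finally show ?thesis .
  qed
  have series: "(\<lambda>k. b k * h ^ k) sums (A + B - B * h) powr (- \<alpha>)" if h: "0 \<le> h" "B * h < A + B" for h
  proof -
    have "0 \<le> z * h" "z * h < 1" using h A B by (auto simp: z_def field_simps)
    from sums_mult[OF neg_binomial_series[OF this, of \<alpha>], of "(A + B) powr (- \<alpha>)"]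
    have "(\<lambda>k. b k * h ^ k) sums ((A + B) powr (- \<alpha>) * (1 - z * h) powr (- \<alpha>))"
      by (simp add: b_def power_mult_distrib mult_ac)
    also have "(A + B) powr (- \<alpha>) * (1 - z * h) powr (- \<alpha>) = (A + B - B * h) powr (- \<alpha>)"
    proof -
      have "(A + B) * (1 - z * h) = A + B - B * h" using A B by (simp add: z_def right_diff_distrib)
      then show ?thesis by (simp add: powr_mult[symmetric])
    qed
    finally show ?thesis .
  qed
  have low: "(\<Sum>k. m k * ennreal (h ^ k)) = ennreal ((A + B - B * h) powr (- \<alpha>))" if h: "0 \<le> h" "h < 1" for h
  proof -
    have bd: "AE \<omega> in M. 0 \<le> W \<omega> * exp (- (1 - h) * Y \<omega>) \<and> W \<omega> * exp (- (1 - h) * Y \<omega>) \<le> 1"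
      using Y0 W0
    proof eventually_elim
      case (elim \<omega>)
      have "W \<omega> * exp (- (1 - h) * Y \<omega>) \<le> 1 * 1"
        using elim h by (intro mult_mono) (auto simp: mult_nonpos_nonneg)
      then show ?case using elim by simp
    qed
    have "integrable M (\<lambda>\<omega>. W \<omega> * exp (- (1 - h) * Y \<omega>))"
      using bd by (intro integrable_const_bound[of _ 1]) (auto elim: AE_mp)
    then have "(\<integral>\<^sup>+\<omega>. ennreal (W \<omega> * exp (- (1 - h) * Y \<omega>)) \<partial>M) = ennreal (\<integral>\<omega>. W \<omega> * exp (- (1 - h) * Y \<omega>) \<partial>M)"
      using bd by (intro nn_integral_eq_integral) (auto elim: AE_mp)
    also have "\<dots> = ennreal ((A + B - B * h) powr (- \<alpha>))"
      using laplace[of "1 - h"] h by (simp add: algebra_simps)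
    finally show ?thesis using expand[OF h(1)] by simp
  qed
  \<comment> \<open>The series converges at \<open>h = 1 / 2\<close>, so its coefficients are finite.\<close>
  have m_fin: "m k \<noteq> \<top>" for k
  proof
    assume "m k = \<top>"
    then have "m k * ennreal ((1/2) ^ k) = \<top>" by (simp add: ennreal_top_mult)
    moreover have "m k * ennreal ((1/2) ^ k) \<le> (\<Sum>k. m k * ennreal ((1/2) ^ k))"
      using sum_le_suminf[of "\<lambda>k. m k * ennreal ((1/2) ^ k)" "{k}"] by simp
    ultimately show False using low[of "1/2"] by (simp add: top_unique)
  qed
  define r where "r k = enn2real (m k)" for k
  have r: "m k = ennreal (r k)" "0 \<le> r k" for k using m_fin[of k] by (auto simp: r_def less_top)
  have r_sums: "(\<lambda>k. r k * h ^ k) sums (A + B - B * h) powr (- \<alpha>)" if h: "0 \<le> h" "h < 1" for h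
  proof (rule sums_of_ennreal_suminf)
    show "(\<Sum>k. ennreal (r k * h ^ k)) = ennreal ((A + B - B * h) powr (- \<alpha>))"
      using low[OF h] h r by (simp add: ennreal_mult)
  qed (use r h in auto)
  have B1: "B * h < A + B" if "h < 1" for h
  proof -
    have "B * h < B * 1" using that B by (rule mult_strict_left_mono)
    then show ?thesis using A by linarith
  qed
  have "(\<lambda>k. r k - b k) k = 0" for k
  proof (rule powser_coeffs_zero[of 1 "\<lambda>k. r k - b k"])
    show "summable (\<lambda>k. (r k - b k) * x ^ k)" if x: "\<bar>x\<bar> < 1" for x
    proof -
      have "summable (\<lambda>k. r k * \<bar>x\<bar> ^ k)" by (rule sums_summable[OF r_sums]) (use x in auto)
      moreover have "\<bar>r k * x ^ k\<bar> = r k * \<bar>x\<bar> ^ k" for k using r(2)[of k] by (simp add: abs_mult power_abs)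
      ultimately have 1: "summable (\<lambda>k. \<bar>r k * x ^ k\<bar>)" by (simp only:)
      have "summable (\<lambda>k. b k * \<bar>x\<bar> ^ k)" by (rule sums_summable[OF series]) (use B1[OF x] in auto)
      moreover have "\<bar>b k * x ^ k\<bar> = b k * \<bar>x\<bar> ^ k" for k using b0[of k] by (simp add: abs_mult power_abs)
      ultimately have 2: "summable (\<lambda>k. \<bar>b k * x ^ k\<bar>)" by (simp only:)
      have "summable (\<lambda>k. r k * x ^ k - b k * x ^ k)"
        by (rule summable_diff[OF summable_rabs_cancel[OF 1] summable_rabs_cancel[OF 2]])
      then show ?thesis by (simp add: left_diff_distrib)
    qed
    show "(\<Sum>k. (r k - b k) * x ^ k) = 0" if "0 < x" "x < 1" for x
    proof -
      have "(\<lambda>k. r k * x ^ k) sums (A + B - B * x) powr (- \<alpha>)" using that by (intro r_sums) auto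
      moreover have "(\<lambda>k. b k * x ^ k) sums (A + B - B * x) powr (- \<alpha>)" using that B1 by (intro series) auto
      ultimately have "(\<lambda>k. r k * x ^ k - b k * x ^ k) sums 0" using sums_diff by fastforce
      then show ?thesis by (simp add: sums_iff left_diff_distrib)
    qed
  qed simp
  then have "r = b" by (simp add: fun_eq_iff)
  then have "(\<integral>\<^sup>+\<omega>. ennreal (W \<omega> * exp (\<theta> * Y \<omega>)) \<partial>M) = (\<Sum>k. ennreal (b k * (1 + \<theta>) ^ k))"
    using expand[of "1 + \<theta>"] r(2) \<theta>(1) unfolding r(1) by (simp add: ennreal_mult)
  also have "\<dots> = ennreal ((A + B - B * (1 + \<theta>)) powr (- \<alpha>))"
    using series[of "1 + \<theta>"] \<theta> b0 by (intro suminf_ennreal_eq) (auto simp: algebra_simps)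
  finally show ?thesis by (simp add: algebra_simps)
qed

lemma (in prob_space) exponential_markov:
  assumes [measurable]: "Z \<in> borel_measurable M" and "0 \<le> C"
    and le: "(\<integral>\<^sup>+\<omega>. ennreal (exp (\<theta> * Z \<omega>)) \<partial>M) \<le> ennreal C" and \<theta>: "0 \<le> \<theta>"
  shows "prob {\<omega> \<in> space M. y \<le> Z \<omega>} \<le> C * exp (- \<theta> * y)"
proof -
  have "emeasure M {\<omega> \<in> space M. y \<le> Z \<omega>} = (\<integral>\<^sup>+\<omega>. indicator {\<omega> \<in> space M. y \<le> Z \<omega>} \<omega> \<partial>M)"
    by simp
  also have "\<dots> \<le> (\<integral>\<^sup>+\<omega>. ennreal (exp (\<theta> * Z \<omega>)) * ennreal (exp (- \<theta> * y)) \<partial>M)"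
    using \<theta> by (intro nn_integral_mono)
      (auto simp: indicator_def ennreal_mult[symmetric] exp_add[symmetric] mult_left_mono simp flip: ennreal_1)
  also have "\<dots> = (\<integral>\<^sup>+\<omega>. ennreal (exp (\<theta> * Z \<omega>)) \<partial>M) * ennreal (exp (- \<theta> * y))"
    by (rule nn_integral_multc) simp
  also have "\<dots> \<le> ennreal C * ennreal (exp (- \<theta> * y))" by (intro mult_right_mono le) simp
  finally show ?thesis using \<open>0 \<le> C\<close> by (simp add: emeasure_eq_measure ennreal_mult[symmetric])
qed

lemma permanental_vector_laplace:
  assumes "permanental_vector M \<alpha> n X U" and "\<And>i. i < n \<Longrightarrow> 0 < s i"
  shows "(\<integral>\<omega>. exp (- (\<Sum>i<n. s i * X i \<omega>)) \<partial>M) =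
      Determinant.det (1\<^sub>m n + U * mat_diag n s) powr (- \<alpha>)"
  using assms unfolding permanental_vector_def by blast

lemma permanental_scalar_tail:
  assumes M: "prob_space M" and X: "permanental_vector M \<alpha> 1 X (Matrix.mat 1 1 (\<lambda>(i, j). U i j))"
    and \<alpha>: "0 < \<alpha>" and U: "0 < U 0 0" and \<theta>: "0 \<le> \<theta>" "\<theta> * U 0 0 < 1"
  shows "measure M {\<omega> \<in> space M. y \<le> X 0 \<omega>} \<le> (1 - U 0 0 * \<theta>) powr (- \<alpha>) * exp (- \<theta> * y)"
proof -
  interpret prob_space M by (rule M)
  have X0[measurable]: "X 0 \<in> borel_measurable M" "AE \<omega> in M. 0 \<le> X 0 \<omega>"
  proof -
    have "\<forall>i<1. X i \<in> borel_measurable M \<and> (AE \<omega> in M. 0 \<le> X i \<omega>)"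
      using X unfolding permanental_vector_def by blast
    from this[rule_format, of 0] show "X 0 \<in> borel_measurable M" "AE \<omega> in M. 0 \<le> X 0 \<omega>" by simp_all
  qed
  have "(\<integral>\<omega>. 1 * exp (- a * X 0 \<omega>) \<partial>M) = (1 + U 0 0 * a) powr (- \<alpha>)" if "0 < a" for a
  proof -
    have "(\<integral>\<omega>. exp (- (\<Sum>i<1. (\<lambda>_. a) i * X i \<omega>)) \<partial>M) =
        Determinant.det (1\<^sub>m 1 + Matrix.mat 1 1 (\<lambda>(i, j). U i j) * mat_diag 1 (\<lambda>_. a)) powr (- \<alpha>)"
      using that by (intro permanental_vector_laplace[OF X])
    also have "Determinant.det (1\<^sub>m 1 + Matrix.mat 1 1 (\<lambda>(i, j). U i j) * mat_diag 1 (\<lambda>_. a)) = 1 + U 0 0 * a"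
      by (subst det_single) (auto simp: mat_diag_def scalar_prod_def)
    finally show ?thesis by simp
  qed
  from exponential_moment_of_laplace[OF M X0 _ _ this _ U \<alpha> \<theta>]
  have "(\<integral>\<^sup>+\<omega>. ennreal (exp (\<theta> * X 0 \<omega>)) \<partial>M) = ennreal ((1 - U 0 0 * \<theta>) powr (- \<alpha>))" by simp
  then show ?thesis using \<theta> by (intro exponential_markov) auto
qed

text \<open>
  The Laplace transform of the pair is a negative power of a polynomial that is affine in each variable. So for fixed argument
  \<open>\<theta>\<close> at \<open>X 0\<close> it has the form \<open>(A + B * a) powr (- \<alpha>)\<close>, and it may be continued to \<open>a = - \<theta>\<close>. This gives
  \<open>1 - (U 1 1 - U 0 0) * \<theta> - D * \<theta>\<^sup>2\<close> as the base.
\<close>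

lemma permanental_increment_tail:
  assumes M: "prob_space M" and X: "permanental_vector M \<alpha> 2 X (Matrix.mat 2 2 (\<lambda>(i, j). U i j))"
    and \<alpha>: "0 < \<alpha>" and U: "0 < U 0 0" "0 < U 1 1" and D: "D = U 0 0 * U 1 1 - U 0 1 * U 1 0" "0 \<le> D"
    and \<theta>: "0 < \<theta>" "1 / 2 \<le> 1 - (U 1 1 - U 0 0) * \<theta> - D * \<theta>\<^sup>2"
  shows "measure M {\<omega> \<in> space M. y \<le> X 1 \<omega> - X 0 \<omega>} \<le> 2 powr \<alpha> * exp (- \<theta> * y)"
proof -
  interpret prob_space M by (rule M)
  have X0[measurable]: "X 0 \<in> borel_measurable M" "X 1 \<in> borel_measurable M"
    and nn: "AE \<omega> in M. 0 \<le> X 0 \<omega>" "AE \<omega> in M. 0 \<le> X 1 \<omega>"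
  proof -
    have "\<forall>i<2. X i \<in> borel_measurable M \<and> (AE \<omega> in M. 0 \<le> X i \<omega>)"
      using X unfolding permanental_vector_def by blast
    from this[rule_format, of 0] this[rule_format, of 1]
    show "X 0 \<in> borel_measurable M" "X 1 \<in> borel_measurable M"
      "AE \<omega> in M. 0 \<le> X 0 \<omega>" "AE \<omega> in M. 0 \<le> X 1 \<omega>" by simp_all
  qed
  define A B where "A = 1 + U 0 0 * \<theta>" and "B = U 1 1 + D * \<theta>"
  have A: "0 < A" unfolding A_def using U(1) \<theta>(1) by (intro add_pos_nonneg mult_nonneg_nonneg) auto
  have B: "0 < B" unfolding B_def using U(2) D(2) \<theta>(1) by (intro add_pos_nonneg mult_nonneg_nonneg) auto
  have AB: "A - B * \<theta> = 1 - (U 1 1 - U 0 0) * \<theta> - D * \<theta>\<^sup>2"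
    by (simp add: A_def B_def algebra_simps power2_eq_square)
  have laplace: "(\<integral>\<omega>. exp (- \<theta> * X 0 \<omega>) * exp (- a * X 1 \<omega>) \<partial>M) = (A + B * a) powr (- \<alpha>)" if a: "0 < a" for a
  proof -
    define s where "s i = (if i = 0 then \<theta> else a)" for i :: nat
    have s: "0 < s i" for i using a \<theta>(1) by (simp add: s_def)
    define T where "T i j = (if i = j then 1 else 0) + U i j * s j" for i j
    have "(\<integral>\<omega>. exp (- (\<Sum>i<2. s i * X i \<omega>)) \<partial>M) =
        Determinant.det (1\<^sub>m 2 + Matrix.mat 2 2 (\<lambda>(i, j). U i j) * mat_diag 2 s) powr (- \<alpha>)"
      using s by (intro permanental_vector_laplace[OF X])
    also have "1\<^sub>m 2 + Matrix.mat 2 2 (\<lambda>(i, j). U i j) * mat_diag 2 s =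
        Matrix.mat (Suc 1) (Suc 1) (\<lambda>(i, j). T i j)"
      by (subst mat_diag_mult_right[of _ 2]) (auto intro!: eq_matI simp: mat_diag_def T_def numeral_2_eq_2)
    also have "Determinant.det \<dots> = A + B * a"
    proof -
      have T11: "T 1 1 \<noteq> 0" using U a by (simp add: T_def s_def add_pos_pos less_imp_neq[symmetric])
      have "Determinant.det (Matrix.mat (Suc 1) (Suc 1) (\<lambda>(i, j). T i j)) = T 1 1 * T 0 0 - T 0 1 * T 1 0"
        using T11 by (subst det_schur_last[of T 1]) (auto simp: det_single field_simps)
      also have "\<dots> = A + B * a" by (simp add: T_def s_def A_def B_def D algebra_simps)
      finally show ?thesis .
    qed
    finally show ?thesis by (simp add: s_def numeral_2_eq_2 exp_add[symmetric])
  qed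
  have "(\<integral>\<^sup>+\<omega>. ennreal (exp (- \<theta> * X 0 \<omega>) * exp (\<theta> * X 1 \<omega>)) \<partial>M) = ennreal ((A - B * \<theta>) powr (- \<alpha>))"
  proof (rule exponential_moment_of_laplace[OF M X0(2) nn(2) _ _ laplace A B \<alpha>])
    show "AE \<omega> in M. 0 \<le> exp (- \<theta> * X 0 \<omega>) \<and> exp (- \<theta> * X 0 \<omega>) \<le> 1"
      using nn(1) by eventually_elim (use \<theta>(1) in auto)
    have "1 / 2 \<le> A - B * \<theta>" using \<theta>(2) unfolding AB .
    then show "\<theta> * B < A" by (simp add: mult.commute)
  qed (use \<theta>(1) in auto)
  also have "\<dots> \<le> ennreal (2 powr \<alpha>)"
  proof (rule ennreal_leI)
    have half: "1 / 2 \<le> A - B * \<theta>" using \<theta>(2) unfolding AB .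
    have "(A - B * \<theta>) powr (- \<alpha>) \<le> (1 / 2) powr (- \<alpha>)"
      using \<alpha> by (intro powr_mono2'[OF _ _ half]) simp_all
    also have "(1 / 2) powr (- \<alpha>) = 2 powr \<alpha>"
      using powr_powr[of 2 "- 1" "- \<alpha>"] by (simp add: powr_neg_one)
    finally show "(A - B * \<theta>) powr (- \<alpha>) \<le> 2 powr \<alpha>" .
  qed
  finally have "(\<integral>\<^sup>+\<omega>. ennreal (exp (\<theta> * (X 1 \<omega> - X 0 \<omega>))) \<partial>M) \<le> ennreal (2 powr \<alpha>)"
    by (simp add: exp_add[symmetric] right_diff_distrib)
  moreover have "(\<lambda>\<omega>. X 1 \<omega> - X 0 \<omega>) \<in> borel_measurable M" by (intro borel_measurable_diff X0)
  ultimately show ?thesis using \<theta>(1) exponential_markov[of "\<lambda>\<omega>. X 1 \<omega> - X 0 \<omega>" "2 powr \<alpha>" \<theta> y] by simp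
qed

section \<open>Chaining and the upper bound\<close>

text \<open>
  Approximate \<open>s\<close> from the left by dyadic points. Each refinement either keeps the point or moves it
  from an even index to the next odd index of the finer grid, so only those increments enter, and only
  upper bounds for them are needed.
\<close>

lemma dyadic_chaining:
  fixes x :: "real \<Rightarrow> real"
  assumes cont: "continuous_on {a..a + \<delta>} x" and \<delta>: "0 < \<delta>"
    and y: "\<And>k. 0 \<le> y k" "summable y"
    and incr: "\<And>k j. j < 2 ^ k \<Longrightarrow>
        x (a + real (2 * j + 1) * (\<delta> / 2 ^ Suc k)) - x (a + real (2 * j) * (\<delta> / 2 ^ Suc k)) \<le> y k"
    and s: "a \<le> s" "s < a + \<delta>"
  shows "x s \<le> x a + suminf y"
proof -
  define u where "u = (s - a) / \<delta>"
  have u: "0 \<le> u" "u < 1" and s_eq: "s = a + u * \<delta>" using s \<delta> by (auto simp: u_def field_simps)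
  define J where "J k = nat \<lfloor>2 ^ k * u\<rfloor>" for k
  define p where "p k = a + real (J k) * (\<delta> / 2 ^ k)" for k
  have J: "real (J k) \<le> 2 ^ k * u" "2 ^ k * u < real (J k) + 1" for k
  proof -
    have "0 \<le> \<lfloor>2 ^ k * u\<rfloor>" using u(1) by simp
    then have "real (J k) = of_int \<lfloor>2 ^ k * u\<rfloor>" by (simp add: J_def)
    then show "real (J k) \<le> 2 ^ k * u" "2 ^ k * u < real (J k) + 1" by linarith+
  qed
  have J_lt: "J k < 2 ^ k" for k
  proof -
    have "real (J k) \<le> 2 ^ k * u" by (rule J)
    also have "\<dots> < 2 ^ k * 1" using u(2) by (intro mult_strict_left_mono) auto
    finally have "real (J k) < real (2 ^ k)" by simp
    then show ?thesis by (simp only: of_nat_less_iff)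
  qed
  have J_Suc: "J (Suc k) = 2 * J k \<or> J (Suc k) = 2 * J k + 1" for k
  proof -
    have "real (J (Suc k)) \<le> 2 * (2 ^ k * u)" "2 * (2 ^ k * u) < real (J (Suc k)) + 1"
      using J[of "Suc k"] by (simp_all add: mult.assoc)
    with J[of k] have "2 * real (J k) < real (J (Suc k)) + 1" "real (J (Suc k)) < 2 * real (J k) + 2"
      by linarith+
    then have "2 * J k < J (Suc k) + 1" "J (Suc k) < 2 * J k + 2" by linarith+
    then show ?thesis by linarith
  qed
  have step: "x (p (Suc k)) \<le> x (p k) + y k" for k
    using J_Suc[of k]
  proof
    assume "J (Suc k) = 2 * J k"
    then have "p (Suc k) = p k" by (simp add: p_def)
    then show ?thesis using y(1)[of k] by simp
  next
    assume J': "J (Suc k) = 2 * J k + 1"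
    have "p k = a + real (2 * J k) * (\<delta> / 2 ^ Suc k)" by (simp add: p_def)
    moreover have "p (Suc k) = a + real (2 * J k + 1) * (\<delta> / 2 ^ Suc k)" unfolding p_def J' ..
    ultimately show ?thesis using incr[OF J_lt[of k]] by simp
  qed
  have "x (p k) \<le> x a + (\<Sum>i<k. y i)" for k
  proof (induction k)
    case 0
    have "J 0 = 0" using J_lt[of 0] by simp
    then show ?case by (simp add: p_def)
  next
    case (Suc k)
    then show ?case using step[of k] by simp
  qed
  moreover have "(\<Sum>i<k. y i) \<le> suminf y" for k by (rule sum_le_suminf[OF y(2)]) (auto simp: y(1))
  ultimately have bound: "x (p k) \<le> x a + suminf y" for k by (metis add_left_mono order_trans)
  have p_le: "p k \<le> s" "s \<le> p k + \<delta> / 2 ^ k" for k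
  proof -
    have "real (J k) * (\<delta> / 2 ^ k) \<le> (2 ^ k * u) * (\<delta> / 2 ^ k)"
      using J(1)[of k] \<delta> by (intro mult_right_mono) auto
    then show "p k \<le> s" by (simp add: p_def s_eq)
    have "(2 ^ k * u) * (\<delta> / 2 ^ k) \<le> (real (J k) + 1) * (\<delta> / 2 ^ k)"
      using J(2)[of k] \<delta> by (intro mult_right_mono) auto
    then show "s \<le> p k + \<delta> / 2 ^ k" by (simp add: p_def s_eq distrib_right add_divide_distrib)
  qed
  have "p \<longlonglongrightarrow> s"
  proof (rule real_tendsto_sandwich)
    show "\<forall>\<^sub>F k in sequentially. s - \<delta> / 2 ^ k \<le> p k" "\<forall>\<^sub>F k in sequentially. p k \<le> s"
      using p_le by (auto simp: algebra_simps)
    have "(\<lambda>k. s - \<delta> * (1 / 2) ^ k) \<longlonglongrightarrow> s - \<delta> * 0" by (intro tendsto_intros) auto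
    then show "(\<lambda>k. s - \<delta> / 2 ^ k) \<longlonglongrightarrow> s" by (simp add: power_one_over)
  qed simp
  moreover have "p k \<in> {a..a + \<delta>}" for k
    using p_le(1)[of k] s \<delta> by (auto simp: p_def)
  moreover have "s \<in> {a..a + \<delta>}" using s by simp
  ultimately have "(\<lambda>k. x (p k)) \<longlonglongrightarrow> x s"
    using cont by (auto simp: continuous_on_sequentially comp_def)
  then show ?thesis by (rule LIMSEQ_le_const2) (use bound in auto)
qed

lemma summable_linear_times_geometric:
  fixes r :: real
  assumes "\<bar>r\<bar> < 1"
  shows "summable (\<lambda>k. real (k + 2) * r ^ Suc k)"
proof -
  have "summable (\<lambda>k. real (Suc k) * r ^ k)"
    using geometric_deriv_sums[of r] assms by (simp add: sums_iff)
  moreover have "summable (\<lambda>k. r ^ k)" using assms by (intro summable_geometric) simp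
  ultimately have "summable (\<lambda>k. r * (real (Suc k) * r ^ k + r ^ k))"
    by (intro summable_mult summable_add)
  moreover have "r * (real (Suc k) * r ^ k + r ^ k) = real (k + 2) * r ^ Suc k" for k
    by (simp add: algebra_simps)
  ultimately show ?thesis by (simp only:)
qed

text \<open>
  The inequality \<open>harnack\<close> controls \<open>f\<close> between nearby points, and \<open>three_point\<close> is the excessiveness of \<open>f\<close>
  for the process observed on an equally spaced grid.
\<close>

locale excessive_permanental = prob_space M for M :: "'a measure" +
  fixes lam \<alpha> :: real and f :: "real \<Rightarrow> real" and X :: "real \<Rightarrow> 'a \<Rightarrow> real"
  assumes lam: "0 < lam" and \<alpha>: "0 < \<alpha>"
    and f_nonneg: "\<And>x. 0 \<le> f x"
    and harnack: "\<And>x y. f y \<le> exp (lam * \<bar>y - x\<bar>) * f x"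
    and three_point: "\<And>x h. 0 \<le> h \<Longrightarrow> f (x - h) + f (x + h) \<le> 2 * cosh (lam * h) * f x"
    and process: "permanental_process M \<alpha> {0..} X (\<lambda>s t. exp (- lam * \<bar>s - t\<bar>) + f t)"
begin

lemma process_vector:
  assumes "\<And>i. i < n \<Longrightarrow> 0 \<le> t i"
  shows "permanental_vector M \<alpha> n (\<lambda>i. X (t i))
      (Matrix.mat n n (\<lambda>(i, j). exp (- lam * \<bar>t i - t j\<bar>) + f (t j)))"
  using process assms by (auto simp: permanental_process_def)

lemma X_measurable: "0 \<le> t \<Longrightarrow> X t \<in> borel_measurable M"
  using process_vector[of 1 "\<lambda>_. t"] by (auto simp: permanental_vector_def)

lemma marginal_tail:
  assumes t: "0 \<le> t" and \<eta>: "0 < \<eta>" "\<eta> \<le> 1"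
  shows "prob {\<omega> \<in> space M. (1 + f t) * y \<le> X t \<omega>} \<le> \<eta> powr (- \<alpha>) * exp (- (1 - \<eta>) * y)"
proof -
  define \<theta> where "\<theta> = (1 - \<eta>) / (1 + f t)"
  have F: "0 < 1 + f t" using f_nonneg[of t] by simp
  define U where "U i j = 1 + f t" for i j :: nat
  have vec: "permanental_vector M \<alpha> 1 (\<lambda>_. X t) (Matrix.mat 1 1 (\<lambda>(i, j). U i j))"
    using process_vector[of 1 "\<lambda>_. t"] t by (simp add: U_def)
  have "0 < U 0 0" "0 \<le> \<theta>" "\<theta> * U 0 0 < 1" using F \<eta> by (simp_all add: U_def \<theta>_def)
  from permanental_scalar_tail[OF prob_space_axioms vec \<alpha> this, of "(1 + f t) * y"]
  have "prob {\<omega> \<in> space M. (1 + f t) * y \<le> X t \<omega>} \<le>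
      (1 - (1 + f t) * \<theta>) powr (- \<alpha>) * exp (- \<theta> * ((1 + f t) * y))"
    unfolding U_def .
  also have "1 - (1 + f t) * \<theta> = \<eta>" using F by (simp add: \<theta>_def)
  also have "- \<theta> * ((1 + f t) * y) = - (\<theta> * (1 + f t)) * y" by simp
  also have "\<theta> * (1 + f t) = 1 - \<eta>" using F by (simp add: \<theta>_def)
  finally show ?thesis .
qed

text \<open>
  With \<open>\<theta> = incr_rate / ((1 + f a) * sqrt h)\<close> the terms \<open>(U 1 1 - U 0 0) * \<theta>\<close> and \<open>D * \<theta>\<^sup>2\<close> of
  \<open>permanental_increment_tail\<close> are both at most \<open>1 / 4\<close>.
\<close>

definition incr_rate :: real where "incr_rate = 1 / (4 * (1 + lam) * exp (2 * lam))"

lemma incr_rate_pos: "0 < incr_rate"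
  using lam by (simp add: incr_rate_def)

lemma increment_tail:
  assumes a: "0 \<le> a" "a \<le> s" and h: "0 < h" "s + h \<le> a + 1"
  shows "prob {\<omega> \<in> space M. (1 + f a) * sqrt h * y \<le> X (s + h) \<omega> - X s \<omega>} \<le>
    2 powr \<alpha> * exp (- incr_rate * y)"
proof -
  define F where "F = 1 + f a"
  define \<theta> where "\<theta> = incr_rate / (F * sqrt h)"
  define \<rho> where "\<rho> = exp (- lam * h)"
  define \<tau> where "\<tau> i = (if i = 0 then s else s + h)" for i :: nat
  define U where "U i j = exp (- lam * \<bar>\<tau> i - \<tau> j\<bar>) + f (\<tau> j)" for i j
  define D where "D = (1 - \<rho>) * (1 + \<rho> + f s + f (s + h))"
  have F: "1 \<le> F" using f_nonneg[of a] by (simp add: F_def)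
  have h1: "h \<le> 1" using a h by simp
  have \<theta>: "0 < \<theta>" using F h(1) incr_rate_pos by (simp add: \<theta>_def)
  have U: "U 0 0 = 1 + f s" "U 1 1 = 1 + f (s + h)" "U 0 1 = \<rho> + f (s + h)" "U 1 0 = \<rho> + f s"
    using h by (simp_all add: U_def \<tau>_def \<rho>_def)
  have \<rho>: "0 < \<rho>" "\<rho> \<le> 1" "1 - \<rho> \<le> lam * h"
    using lam h exp_ge_add_one_self[of "- lam * h"] by (auto simp: \<rho>_def)
  have fr: "f r \<le> exp lam * F" if "a \<le> r" "r \<le> a + 1" for r
  proof -
    have "f r \<le> exp (lam * \<bar>r - a\<bar>) * f a" by (rule harnack)
    also have "\<dots> \<le> exp lam * F"
      using that lam f_nonneg[of a] by (intro mult_mono) (auto simp: F_def mult_left_le)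
    finally show ?thesis .
  qed
  have fs: "f s \<le> exp lam * F" "f (s + h) \<le> exp lam * F" using fr a h by auto
  have e1: "1 \<le> exp lam" using lam by simp
  have e2: "exp lam \<le> exp (2 * lam)" "exp (2 * lam) = exp lam * exp lam"
    using lam by (auto simp: exp_add[symmetric])
  have lam_rate: "lam * exp (2 * lam) * incr_rate \<le> 1 / 4" "incr_rate \<le> 1 / 4"
  proof -
    have "lam * exp (2 * lam) * incr_rate = lam / (1 + lam) / 4" by (simp add: incr_rate_def)
    also have "\<dots> \<le> 1 / 4" using lam by simp
    finally show "lam * exp (2 * lam) * incr_rate \<le> 1 / 4" .
    have "1 * 1 \<le> (1 + lam) * exp (2 * lam)" using lam by (intro mult_mono) auto
    moreover have "incr_rate = 1 / 4 / ((1 + lam) * exp (2 * lam))" by (simp add: incr_rate_def)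
    ultimately show "incr_rate \<le> 1 / 4" by (simp add: divide_le_eq del: divide_divide_eq_left)
  qed
  have drift: "(f (s + h) - f s) * \<theta> \<le> 1 / 4"
  proof -
    have "f (s + h) - f s \<le> (exp (lam * h) - 1) * f s"
      using harnack[of "s + h" s] h by (simp add: left_diff_distrib)
    also have "\<dots> \<le> (lam * h * exp (lam * h)) * f s"
    proof (intro mult_right_mono f_nonneg)
      have "exp (lam * h) * (1 - lam * h) \<le> exp (lam * h) * exp (- (lam * h))"
        using exp_ge_add_one_self[of "- (lam * h)"] by (intro mult_left_mono) auto
      then show "exp (lam * h) - 1 \<le> lam * h * exp (lam * h)" by (simp add: exp_minus algebra_simps)
    qed
    also have "\<dots> \<le> (lam * h * exp lam) * (exp lam * F)"
      using lam h h1 fs(1) f_nonneg by (intro mult_mono) (auto simp: mult_left_le)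
    finally have "(f (s + h) - f s) * \<theta> \<le> ((lam * h * exp lam) * (exp lam * F)) * \<theta>"
      using \<theta> by (intro mult_right_mono) auto
    also have "\<dots> = (lam * exp (2 * lam) * incr_rate) * (h / sqrt h)"
      using F by (simp add: \<theta>_def e2)
    also have "h / sqrt h = sqrt h" using h(1) by (simp add: real_div_sqrt)
    also have "lam * exp (2 * lam) * incr_rate * sqrt h \<le> 1 / 4 * 1"
      using lam_rate h h1 by (intro mult_mono) auto
    finally show ?thesis by simp
  qed
  have diffusion: "D * \<theta>\<^sup>2 \<le> 1 / 4"
  proof -
    have "D \<le> (lam * h) * (2 * F + 2 * exp lam * F)"
      unfolding D_def using \<rho> fs F f_nonneg[of s] f_nonneg[of "s + h"] lam h by (intro mult_mono) auto
    also have "2 * F + 2 * exp lam * F \<le> 4 * exp lam * F"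
      using e1 F by (simp add: mult_le_cancel_right1)
    also have "4 * exp lam * F \<le> 4 * exp (2 * lam) * F\<^sup>2"
      using e2(1) F by (intro mult_mono) (auto simp: power2_eq_square)
    finally have "D \<le> (lam * h) * (4 * exp (2 * lam) * F\<^sup>2)" using lam h by (simp add: mult_left_mono)
    then have "D * \<theta>\<^sup>2 \<le> (lam * h) * (4 * exp (2 * lam) * F\<^sup>2) * \<theta>\<^sup>2" by (rule mult_right_mono) simp
    also have "\<dots> = 4 * (lam * exp (2 * lam) * incr_rate) * incr_rate"
      using F h(1) by (simp add: \<theta>_def power_divide power_mult_distrib power2_eq_square[of incr_rate])
    also have "\<dots> \<le> 4 * (1 / 4) * (1 / 4)"
      using lam_rate lam incr_rate_pos by (intro mult_mono) auto
    finally show ?thesis by simp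
  qed
  have vec: "permanental_vector M \<alpha> 2 (\<lambda>i. X (\<tau> i)) (Matrix.mat 2 2 (\<lambda>(i, j). U i j))"
    unfolding U_def using a h by (intro process_vector) (auto simp: \<tau>_def)
  have "prob {\<omega> \<in> space M. F * sqrt h * y \<le> X (\<tau> 1) \<omega> - X (\<tau> 0) \<omega>} \<le> 2 powr \<alpha> * exp (- \<theta> * (F * sqrt h * y))"
  proof (rule permanental_increment_tail[OF prob_space_axioms vec \<alpha>, of D])
    show "0 < U 0 0" "0 < U 1 1" unfolding U using f_nonneg[of s] f_nonneg[of "s + h"] by auto
    show "D = U 0 0 * U 1 1 - U 0 1 * U 1 0" unfolding U D_def by (simp add: algebra_simps)
    show "0 \<le> D" unfolding D_def using \<rho> f_nonneg[of s] f_nonneg[of "s + h"] by (intro mult_nonneg_nonneg) auto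
    have eq: "U 1 1 - U 0 0 = f (s + h) - f s" unfolding U by simp
    show "1 / 2 \<le> 1 - (U 1 1 - U 0 0) * \<theta> - D * \<theta>\<^sup>2" unfolding eq using drift diffusion by linarith
  qed (rule \<theta>)
  also have "- \<theta> * (F * sqrt h * y) = - incr_rate * y" using F h(1) by (simp add: \<theta>_def)
  finally show ?thesis by (simp add: \<tau>_def F_def)
qed

text \<open>
  The thresholds exceed the natural scale of the increments by the factor \<open>L * (k + 2)\<close>. So the
  \<open>2 ^ k\<close> events of level \<open>k\<close> have total probability of order \<open>(2 * exp (- L)) ^ k * exp (- 2 * L)\<close>, while the
  thresholds of all levels sum to a multiple of \<open>(1 + f a) * L * sqrt \<delta>\<close>.
\<close>

definition increment_excess :: "real \<Rightarrow> real \<Rightarrow> real \<Rightarrow> nat \<Rightarrow> nat \<Rightarrow> 'a set" where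
  "increment_excess a \<delta> L k j = {\<omega> \<in> space M.
     (1 + f a) * sqrt (\<delta> / 2 ^ Suc k) * (L * real (k + 2) / incr_rate) \<le>
     X (a + real (2 * j) * (\<delta> / 2 ^ Suc k) + \<delta> / 2 ^ Suc k) \<omega> - X (a + real (2 * j) * (\<delta> / 2 ^ Suc k)) \<omega>}"

definition dyadic_excess :: "real \<Rightarrow> real \<Rightarrow> real \<Rightarrow> 'a set" where
  "dyadic_excess a \<delta> L = (\<Union>k. \<Union>j<2 ^ k. increment_excess a \<delta> L k j)"

lemma increment_excess_measurable:
  assumes "0 \<le> a" "0 \<le> \<delta>"
  shows "increment_excess a \<delta> L k j \<in> sets M"
proof -
  have "X (a + real (2 * j) * (\<delta> / 2 ^ Suc k) + \<delta> / 2 ^ Suc k) \<in> borel_measurable M"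
    "X (a + real (2 * j) * (\<delta> / 2 ^ Suc k)) \<in> borel_measurable M"
    using assms by (intro X_measurable add_nonneg_nonneg mult_nonneg_nonneg divide_nonneg_nonneg; simp)+
  then show ?thesis unfolding increment_excess_def by (auto intro!: borel_measurable_diff)
qed

lemma dyadic_excess_measurable:
  assumes "0 \<le> a" "0 \<le> \<delta>"
  shows "dyadic_excess a \<delta> L \<in> sets M"
  unfolding dyadic_excess_def
proof (rule sets.countable_UN, safe)
  show "(\<Union>j<2 ^ k. increment_excess a \<delta> L k j) \<in> sets M" for k
    using increment_excess_measurable[OF assms] by (rule sets.finite_UN[OF finite_lessThan])
qed

lemma prob_dyadic_excess:
  assumes a: "0 \<le> a" and \<delta>: "0 < \<delta>" "\<delta> \<le> 1" and L: "2 \<le> L"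
  shows "prob (dyadic_excess a \<delta> L) \<le> 3 * 2 powr \<alpha> * exp (- 2 * L)"
proof -
  let ?E = "increment_excess a \<delta> L"
  have Em: "?E k j \<in> sets M" for k j using a \<delta> by (intro increment_excess_measurable) auto
  have E: "prob (?E k j) \<le> 2 powr \<alpha> * exp (- L * real (k + 2))" if j: "j < 2 ^ k" for k j
  proof -
    have "real (2 * j) * (\<delta> / 2 ^ Suc k) + \<delta> / 2 ^ Suc k = (real (2 * j) + 1) * (\<delta> / 2 ^ Suc k)"
      by (simp only: distrib_right mult_1)
    also have "\<dots> \<le> 2 ^ Suc k * (\<delta> / 2 ^ Suc k)"
    proof (intro mult_right_mono)
      have "2 * j + 1 \<le> 2 ^ Suc k" using j by simp
      then have "real (2 * j + 1) \<le> real (2 ^ Suc k)" by (simp only: of_nat_le_iff)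
      then show "real (2 * j) + 1 \<le> 2 ^ Suc k" by simp
    qed (use \<delta> in auto)
    also have "\<dots> \<le> 1" using \<delta> by simp
    finally have "prob (?E k j) \<le> 2 powr \<alpha> * exp (- incr_rate * (L * real (k + 2) / incr_rate))"
      unfolding increment_excess_def using a \<delta> by (intro increment_tail) auto
    then show ?thesis using incr_rate_pos by simp
  qed
  have level: "prob (\<Union>j<2 ^ k. ?E k j) \<le> 2 powr \<alpha> * exp (- 2 * L) * (2 / 3) ^ k" for k
  proof -
    have "prob (\<Union>j<2 ^ k. ?E k j) \<le> (\<Sum>j<2 ^ k. prob (?E k j))"
      using Em by (intro finite_measure_subadditive_finite) auto
    also have "\<dots> \<le> (\<Sum>j<(2::nat) ^ k. 2 powr \<alpha> * exp (- L * real (k + 2)))" by (intro sum_mono E) auto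
    also have "\<dots> = 2 powr \<alpha> * exp (- 2 * L) * (2 * exp (- L)) ^ k"
    proof -
      have "exp (- L * real (k + 2)) = exp (- 2 * L) * exp (- L) ^ k"
        by (simp add: exp_of_nat_mult[symmetric] exp_add[symmetric] algebra_simps)
      then show ?thesis by (simp add: power_mult_distrib)
    qed
    also have "\<dots> \<le> 2 powr \<alpha> * exp (- 2 * L) * (2 / 3) ^ k"
    proof (intro mult_left_mono power_mono)
      have "3 \<le> exp L" using exp_ge_add_one_self[of L] L by linarith
      then show "2 * exp (- L) \<le> 2 / 3" by (simp add: exp_minus field_simps)
    qed auto
    finally show ?thesis .
  qed
  have s: "(\<lambda>k. 2 powr \<alpha> * exp (- 2 * L) * (2 / 3) ^ k) sums (2 powr \<alpha> * exp (- 2 * L) * (1 / (1 - 2 / 3)))"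
    by (intro sums_mult geometric_sums) simp
  have Um: "range (\<lambda>k. \<Union>j<2 ^ k. ?E k j) \<subseteq> sets M" using Em by auto
  have "summable (\<lambda>k. prob (\<Union>j<2 ^ k. ?E k j))"
    by (rule summable_comparison_test[OF _ sums_summable[OF s]]) (use level in auto)
  then have "prob (\<Union>k. \<Union>j<2 ^ k. ?E k j) \<le> (\<Sum>k. prob (\<Union>j<2 ^ k. ?E k j))"
    by (rule finite_measure_subadditive_countably[OF Um])
  also have "\<dots> \<le> (\<Sum>k. 2 powr \<alpha> * exp (- 2 * L) * (2 / 3) ^ k)"
    by (intro suminf_le level \<open>summable (\<lambda>k. prob (\<Union>j<2 ^ k. ?E k j))\<close> sums_summable[OF s])
  also have "\<dots> = 3 * 2 powr \<alpha> * exp (- 2 * L)" using s by (simp add: sums_iff)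
  finally show ?thesis by (simp only: dyadic_excess_def)
qed

end

context excessive_permanental
begin

text \<open>
  The mesh \<open>\<delta>\<close> is so small that the chaining error and the variation of \<open>f\<close> within one cell each cost
  a factor depending only on \<open>e\<close>. With \<open>L = ln n\<close> the exceptional events of the \<open>n\<close>-th cell have
  probability of order \<open>n powr (- (1 + e / 2))\<close>, which is summable. In the factor \<open>1 + 2 * e\<close> one \<open>e\<close>
  comes from the marginal tail and one from the chaining error. One factor \<open>1 + e\<close> accounts for the
  variation of \<open>f\<close>, another for the difference between \<open>ln n\<close> and \<open>ln t\<close>.
\<close>

lemma eventually_upper_bound:
  assumes cont: "AE \<omega> in M. continuous_on {0..} (\<lambda>t. X t \<omega>)" and e: "0 < e" "e < 1"
  shows "AE \<omega> in M. \<forall>\<^sub>F t in at_top. X t \<omega> \<le> (1 + 2 * e) * (1 + e)\<^sup>2 * ((1 + f t) * ln t)"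
proof -
  define r where "r = sqrt (1 / 2)"
  have r: "0 \<le> r" "r < 1" "\<bar>r\<bar> < 1" by (auto simp: r_def real_less_lsqrt)
  define S where "S = (\<Sum>k. real (k + 2) * r ^ Suc k)"
  have S: "(\<lambda>k. real (k + 2) * r ^ Suc k) sums S"
    unfolding S_def using summable_linear_times_geometric[OF r(3)] by (rule summable_sums)
  obtain \<delta> where \<delta>: "0 < \<delta>" "\<delta> \<le> 1" "exp (lam * \<delta>) \<le> 1 + e" "sqrt \<delta> * S / incr_rate \<le> e"
  proof -
    have "((\<lambda>\<delta>. exp (lam * \<delta>)) \<longlongrightarrow> exp (lam * 0)) (at_right 0)" by (intro tendsto_intros)
    then have 1: "\<forall>\<^sub>F \<delta> in at_right 0. exp (lam * \<delta>) < 1 + e"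
      using e by (intro order_tendstoD(2)) auto
    have "((\<lambda>\<delta>. sqrt \<delta> * S / incr_rate) \<longlongrightarrow> sqrt 0 * S / incr_rate) (at_right 0)"
      using incr_rate_pos by (intro tendsto_intros) auto
    then have 2: "\<forall>\<^sub>F \<delta> in at_right 0. sqrt \<delta> * S / incr_rate < e"
      using e by (intro order_tendstoD(2)) auto
    have 3: "\<forall>\<^sub>F \<delta> in at_right 0. \<delta> \<in> {0<..<1::real}" by (rule eventually_at_right_real) simp
    have "\<forall>\<^sub>F \<delta> in at_right 0. 0 < \<delta> \<and> \<delta> \<le> 1 \<and> exp (lam * \<delta>) \<le> 1 + e \<and> sqrt \<delta> * S / incr_rate \<le> e"
      using 1 2 3 by eventually_elim auto
    from eventually_happens[OF this] show ?thesis using that by auto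
  qed
  define a where "a n = real n * \<delta>" for n
  define A where "A n = {\<omega> \<in> space M. (1 + f (a n)) * ((1 + e) * ln (real n)) \<le> X (a n) \<omega>}" for n
  define E where "E n = A n \<union> dyadic_excess (a n) \<delta> (ln (real n))" for n
  have a0: "0 \<le> a n" for n using \<delta> by (simp add: a_def)
  have Am: "A n \<in> sets M" for n
    unfolding A_def using X_measurable[OF a0[of n]] by simp
  have Em: "E n \<in> sets M" for n
    unfolding E_def using Am \<delta> a0 by (intro sets.Un dyadic_excess_measurable) auto
  \<comment> \<open>The exponential moment of order \<open>1 - \<eta>\<close> loses little enough that \<open>(1 - \<eta>) * (1 + e)\<close> still exceeds 1.\<close>
  define \<eta> where "\<eta> = e / (2 * (1 + e))"
  have \<eta>: "0 < \<eta>" "\<eta> \<le> 1" "(1 - \<eta>) * (1 + e) = 1 + e / 2"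
    using e by (auto simp: \<eta>_def field_simps)
  have exp_ln: "exp (c * ln (real n)) = real n powr c" if "0 < n" for n c
    using that by (simp add: powr_def)
  have PE: "prob (E n) \<le> \<eta> powr (- \<alpha>) * real n powr (- (1 + e / 2)) + 3 * 2 powr \<alpha> * real n powr (- 2)"
    if n: "exp 2 \<le> real n" for n
  proof -
    have n0: "0 < n" using n by (cases n) auto
    have L: "2 \<le> ln (real n)" using n n0 ln_ge_iff[of "real n" 2] by simp
    have "prob (E n) \<le> prob (A n) + prob (dyadic_excess (a n) \<delta> (ln (real n)))"
      unfolding E_def using Am \<delta> a0 by (intro measure_Un_le dyadic_excess_measurable) auto
    also have "prob (A n) \<le> \<eta> powr (- \<alpha>) * exp (- (1 - \<eta>) * ((1 + e) * ln (real n)))"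
      unfolding A_def using a0 \<eta>(1,2) by (rule marginal_tail)
    also have "- (1 - \<eta>) * ((1 + e) * ln (real n)) = - ((1 - \<eta>) * (1 + e)) * ln (real n)"
      by (simp only: mult_minus_left mult.assoc)
    also have "\<dots> = - (1 + e / 2) * ln (real n)" unfolding \<eta>(3) ..
    also have "exp \<dots> = real n powr (- (1 + e / 2))" using exp_ln[OF n0] .
    also have "prob (dyadic_excess (a n) \<delta> (ln (real n))) \<le> 3 * 2 powr \<alpha> * exp (- 2 * ln (real n))"
      using a0 \<delta>(1,2) L by (rule prob_dyadic_excess)
    also have "exp (- 2 * ln (real n)) = real n powr (- 2)" using exp_ln[OF n0] .
    finally show ?thesis by simp
  qed
  have "summable (\<lambda>n. prob (E n))"
  proof (rule summable_comparison_test_ev)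
    show "summable (\<lambda>n. \<eta> powr (- \<alpha>) * real n powr (- (1 + e / 2)) + 3 * 2 powr \<alpha> * real n powr (- 2))"
      using e by (intro summable_add summable_mult) (auto simp: summable_real_powr_iff)
    have "\<forall>\<^sub>F n in sequentially. exp 2 \<le> real n"
      using filterlim_real_sequentially unfolding filterlim_at_top by blast
    then show "\<forall>\<^sub>F n in sequentially. norm (prob (E n)) \<le>
        \<eta> powr (- \<alpha>) * real n powr (- (1 + e / 2)) + 3 * 2 powr \<alpha> * real n powr (- 2)"
      by eventually_elim (use PE in simp)
  qed
  then have "AE \<omega> in M. \<forall>\<^sub>F n in sequentially. \<omega> \<in> space M - E n"
    using Em by (intro borel_cantelli_AE1) (auto simp: emeasure_eq_measure)
  then show ?thesis using cont
  proof eventually_elim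
    case (elim \<omega>)
    have fl: "filterlim (\<lambda>t. nat \<lfloor>t / \<delta>\<rfloor>) sequentially at_top"
    proof -
      have "filterlim (\<lambda>t. t * (1 / \<delta>)) at_top at_top"
        using \<delta> by (intro filterlim_at_top_mult_tendsto_pos[OF tendsto_const] filterlim_ident) auto
      then have "filterlim (\<lambda>t. t / \<delta>) at_top at_top" by simp
      then show ?thesis
        by (intro filterlim_compose[OF filterlim_nat_sequentially] filterlim_compose[OF filterlim_floor_sequentially])
    qed
    have 1: "\<forall>\<^sub>F t in at_top. \<omega> \<in> space M - E (nat \<lfloor>t / \<delta>\<rfloor>)"
      using elim(1) fl by (rule eventually_compose_filterlim)
    have "\<forall>\<^sub>F n in sequentially. (2::nat) \<le> n" by (rule eventually_ge_at_top)
    then have 2: "\<forall>\<^sub>F t in at_top. 2 \<le> nat \<lfloor>t / \<delta>\<rfloor>" using fl by (rule eventually_compose_filterlim)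
    have 3: "\<forall>\<^sub>F t in at_top. exp (- ln \<delta> / e) \<le> t" by (rule eventually_ge_at_top)
    show ?case
      using 1 2 3 eventually_gt_at_top[of 0]
    proof eventually_elim
      case (elim t)
      define n where "n = nat \<lfloor>t / \<delta>\<rfloor>"
      have n2: "2 \<le> n" using elim by (simp add: n_def)
      have fl_t: "0 \<le> \<lfloor>t / \<delta>\<rfloor>" using elim \<delta> by simp
      then have rn: "real n = of_int \<lfloor>t / \<delta>\<rfloor>" by (simp add: n_def)
      have "real n \<le> t / \<delta>" "t / \<delta> < real n + 1" unfolding rn by linarith+
      then have t: "a n \<le> t" "t < a n + \<delta>" "real n \<le> t / \<delta>"
        using \<delta> by (auto simp: a_def field_simps)
      define F where "F = 1 + f (a n)"
      define L where "L = ln (real n)"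
      have F: "1 \<le> F" using f_nonneg[of "a n"] by (simp add: F_def)
      have L: "0 \<le> L" using n2 by (simp add: L_def)
      have \<omega>: "\<omega> \<in> space M" "\<omega> \<notin> A n" "\<omega> \<notin> dyadic_excess (a n) \<delta> L"
        using elim by (auto simp: n_def E_def L_def)
      define y where "y k = F * sqrt (\<delta> / 2 ^ Suc k) * (L * real (k + 2) / incr_rate)" for k
      have "sqrt (\<delta> / 2 ^ Suc k) = sqrt \<delta> * r ^ Suc k" for k
        unfolding r_def real_sqrt_power[symmetric] real_sqrt_mult[symmetric] by (simp add: power_one_over)
      then have y_eq: "y k = F * L * sqrt \<delta> / incr_rate * (real (k + 2) * r ^ Suc k)" for k
        by (simp add: y_def)
      have y_sums: "y sums (F * L * sqrt \<delta> / incr_rate * S)"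
        unfolding y_eq[abs_def] by (rule sums_mult[OF S])
      have "X t \<omega> \<le> X (a n) \<omega> + suminf y"
      proof (rule dyadic_chaining[OF _ \<delta>(1) _ _ _ t(1,2)])
        show "continuous_on {a n..a n + \<delta>} (\<lambda>t. X t \<omega>)"
          using \<open>continuous_on {0..} (\<lambda>t. X t \<omega>)\<close> by (rule continuous_on_subset) (use a0 in auto)
        show "0 \<le> y k" for k unfolding y_def using F L incr_rate_pos \<delta> by simp
        show "summable y" using y_sums by (simp add: sums_iff)
        show "X (a n + real (2 * j + 1) * (\<delta> / 2 ^ Suc k)) \<omega> - X (a n + real (2 * j) * (\<delta> / 2 ^ Suc k)) \<omega> \<le> y k"
          if "j < 2 ^ k" for k j
        proof -
          have eq: "a n + real (2 * j + 1) * (\<delta> / 2 ^ Suc k) = a n + real (2 * j) * (\<delta> / 2 ^ Suc k) + \<delta> / 2 ^ Suc k"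
            by (simp only: of_nat_add of_nat_1 distrib_right mult_1 add.assoc)
          have "\<not> y k \<le> X (a n + real (2 * j) * (\<delta> / 2 ^ Suc k) + \<delta> / 2 ^ Suc k) \<omega> -
              X (a n + real (2 * j) * (\<delta> / 2 ^ Suc k)) \<omega>"
            using \<omega>(1,3) that unfolding dyadic_excess_def increment_excess_def y_def F_def by blast
          then show ?thesis unfolding eq by linarith
        qed
      qed
      also have "X (a n) \<omega> \<le> F * ((1 + e) * L)" using \<omega>(1,2) by (auto simp: A_def F_def L_def)
      also have "suminf y = F * L * (sqrt \<delta> * S / incr_rate)" using y_sums by (simp add: sums_iff)
      also have "\<dots> \<le> F * L * e" using F L \<delta>(4) by (intro mult_left_mono) auto
      finally have X_le: "X t \<omega> \<le> (1 + 2 * e) * (F * L)" by (simp add: algebra_simps)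
      have F_le: "F \<le> (1 + e) * (1 + f t)"
      proof -
        have "f (a n) \<le> exp (lam * \<bar>a n - t\<bar>) * f t" by (rule harnack)
        also have "\<dots> \<le> (1 + e) * f t"
        proof (intro mult_right_mono f_nonneg order_trans[OF _ \<delta>(3)])
          show "exp (lam * \<bar>a n - t\<bar>) \<le> exp (lam * \<delta>)" using lam t by simp
        qed
        finally show ?thesis using e by (simp add: F_def distrib_left)
      qed
      have L_le: "L \<le> (1 + e) * ln t"
      proof -
        have "L \<le> ln (t / \<delta>)" unfolding L_def using t(3) n2 by (subst ln_le_cancel_iff) auto
        also have "\<dots> = ln t - ln \<delta>" using elim \<delta> by (simp add: ln_div)
        also have "- ln \<delta> / e \<le> ln t" using elim ln_ge_iff[of t "- ln \<delta> / e"] by simp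
        then have "- ln \<delta> \<le> e * ln t" using e by (simp add: field_simps)
        then have "ln t - ln \<delta> \<le> (1 + e) * ln t" by (simp add: algebra_simps)
        finally show ?thesis .
      qed
      have "F * L \<le> ((1 + e) * (1 + f t)) * ((1 + e) * ln t)"
        using F_le L_le F L f_nonneg[of t] e by (intro mult_mono) auto
      then have "(1 + 2 * e) * (F * L) \<le> (1 + 2 * e) * (((1 + e) * (1 + f t)) * ((1 + e) * ln t))"
        using e by (intro mult_left_mono) auto
      also have "\<dots> = (1 + 2 * e) * (1 + e)\<^sup>2 * ((1 + f t) * ln t)" by (simp add: power2_eq_square mult_ac)
      finally show ?case using X_le by simp
    qed
  qed
qed

lemma AE_limsup_upper:
  assumes cont: "AE \<omega> in M. continuous_on {0..} (\<lambda>t. X t \<omega>)"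
  shows "AE \<omega> in M. Limsup at_top (\<lambda>t. ereal (X t \<omega> / ((1 + f t) * ln t))) \<le> 1"
proof -
  define e where "e n = 1 / (real n + 2)" for n :: nat
  have "AE \<omega> in M. \<forall>n. \<forall>\<^sub>F t in at_top. X t \<omega> \<le> (1 + 2 * e n) * (1 + e n)\<^sup>2 * ((1 + f t) * ln t)"
    by (intro AE_all_countable[THEN iffD2] allI eventually_upper_bound cont) (auto simp: e_def)
  then show ?thesis
  proof eventually_elim
    case (elim \<omega>)
    have "Limsup at_top (\<lambda>t. ereal (X t \<omega> / ((1 + f t) * ln t))) \<le> ereal ((1 + 2 * e n) * (1 + e n)\<^sup>2)" for n
    proof (rule Limsup_bounded)
      show "\<forall>\<^sub>F t in at_top. ereal (X t \<omega> / ((1 + f t) * ln t)) \<le> ereal ((1 + 2 * e n) * (1 + e n)\<^sup>2)"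
        using elim[rule_format, of n] eventually_gt_at_top[of 1]
      proof eventually_elim
        case (elim t)
        have "0 < (1 + f t) * ln t" using elim(2) f_nonneg[of t] by simp
        then show ?case using elim(1) by (simp add: divide_le_eq)
      qed
    qed
    note le = this
    have lim: "(\<lambda>n. ereal ((1 + 2 * e n) * (1 + e n)\<^sup>2)) \<longlonglongrightarrow> ereal 1"
      unfolding lim_ereal e_def by real_asymp
    show ?case unfolding one_ereal_def by (rule LIMSEQ_le_const[OF lim]) (use le in blast)
  qed
qed

end

section \<open>The lower bound\<close>

context excessive_permanental
begin

lemma grid_small_values:
  assumes h: "0 < h" and m: "0 < m"
  defines "\<rho> \<equiv> exp (- lam * h)"
  defines "d \<equiv> (1 + \<rho>\<^sup>2) / (1 - \<rho>\<^sup>2)"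
  shows "prob {\<omega> \<in> space M. \<forall>i<n. X (real (m + i) * h) \<omega> \<le> x i} \<le>
    (\<Prod>i<n. \<integral>y. min 1 (exp (x i - y)) \<partial>gamma_dist \<alpha> d)"
proof -
  have \<rho>: "0 < \<rho>" "\<rho> < 1" using lam h by (auto simp: \<rho>_def)
  have "0 < 1 - \<rho>\<^sup>2" using \<rho> by (simp add: power_less_one_iff)
  then have d: "0 < d" by (simp add: d_def add_pos_nonneg)
  define t where "t i = real (m + i) * h" for i
  define g where "g i = f (t i)" for i
  have t: "0 \<le> t i" for i using h by (simp add: t_def)
  have tS: "t (Suc i) = t i + h" for i by (simp add: t_def distrib_right)
  have \<rho>_exp: "\<rho> * exp (lam * h) = 1" by (simp add: \<rho>_def exp_add[symmetric])
  have g0: "0 \<le> g i" for i using f_nonneg by (simp add: g_def)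
  have right: "\<rho> * g (Suc i) \<le> g i" for i
  proof -
    have "g (Suc i) \<le> exp (lam * h) * g i" using harnack[of "t i + h" "t i"] h by (simp add: g_def tS)
    then have "\<rho> * g (Suc i) \<le> \<rho> * (exp (lam * h) * g i)" using \<rho> by (intro mult_left_mono) auto
    then show ?thesis by (simp add: mult.assoc[symmetric] \<rho>_exp)
  qed
  have left: "\<rho> * g i \<le> g (Suc i)" for i
  proof -
    have "g i \<le> exp (lam * h) * g (Suc i)" using harnack[of "t i" "t i + h"] h by (simp add: g_def tS)
    then have "\<rho> * g i \<le> \<rho> * (exp (lam * h) * g (Suc i))" using \<rho> by (intro mult_left_mono) auto
    then show ?thesis by (simp add: mult.assoc[symmetric] \<rho>_exp)
  qed
  have mid: "\<rho> * (g i + g (Suc (Suc i))) \<le> (1 + \<rho>\<^sup>2) * g (Suc i)" for i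
  proof -
    have "g i + g (Suc (Suc i)) \<le> 2 * cosh (lam * h) * g (Suc i)"
      using three_point[of h "t i + h"] h by (simp add: g_def tS add.assoc)
    then have "\<rho> * (g i + g (Suc (Suc i))) \<le> \<rho> * (2 * cosh (lam * h) * g (Suc i))"
      using \<rho> by (intro mult_left_mono) auto
    also have "\<rho> * (2 * cosh (lam * h) * g (Suc i)) = (\<rho> * exp (lam * h) + \<rho> * \<rho>) * g (Suc i)"
      by (simp add: cosh_def \<rho>_def algebra_simps)
    finally show ?thesis by (simp add: \<rho>_exp power2_eq_square)
  qed
  have "\<exists>P. (\<forall>i<n. \<forall>j<n. (\<Sum>k<n. P i k * (\<rho> ^ nat \<bar>int k - int j\<bar> + g j)) = (if i = j then 1 else 0)) \<and>
      (\<forall>i<n. \<forall>j<n. i \<noteq> j \<longrightarrow> P i j \<le> 0) \<and> (\<forall>i<n. P i i \<le> d) \<and> (\<forall>i<n. 0 \<le> (\<Sum>k<n. P i k))" (is "\<exists>P. ?Q P")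
    unfolding d_def by (rule exp_plus_rank_one_inverse[OF \<rho>]) (rule g0 right left mid)+
  then obtain P where "?Q P" ..
  note P = this[THEN conjunct1, rule_format] this[THEN conjunct2, THEN conjunct1, rule_format]
    this[THEN conjunct2, THEN conjunct2, THEN conjunct1, rule_format]
    this[THEN conjunct2, THEN conjunct2, THEN conjunct2, rule_format]
  have U: "exp (- lam * \<bar>t i - t j\<bar>) + f (t j) = \<rho> ^ nat \<bar>int i - int j\<bar> + g j" for i j
  proof -
    have "\<bar>t i - t j\<bar> = \<bar>real i - real j\<bar> * h" using h by (simp add: t_def left_diff_distrib[symmetric] abs_mult)
    also have "\<bar>real i - real j\<bar> = real (nat \<bar>int i - int j\<bar>)" by simp
    finally have dist: "\<bar>t i - t j\<bar> = real (nat \<bar>int i - int j\<bar>) * h" .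
    have "exp (- lam * \<bar>t i - t j\<bar>) = exp (real (nat \<bar>int i - int j\<bar>) * (- lam * h))"
      unfolding dist by (simp only: mult_ac)
    then show ?thesis by (simp only: \<rho>_def exp_of_nat_mult g_def)
  qed
  have vec: "permanental_vector M \<alpha> n (\<lambda>i. X (t i)) (Matrix.mat n n (\<lambda>(i, j). \<rho> ^ nat \<bar>int i - int j\<bar> + g j))"
    using process_vector[of n t] t unfolding U by simp
  have "prob {\<omega> \<in> space M. \<forall>i<n. X (t i) \<omega> \<le> x i} \<le> (\<Prod>i<n. \<integral>y. min 1 (exp (x i - y)) \<partial>gamma_dist \<alpha> d)"
    by (rule permanental_joint_small_values[OF prob_space_axioms vec \<alpha> d]) (fact P)+
  then show ?thesis by (simp add: t_def)
qed

text \<open>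
  For \<open>x = b * ln (j * h)\<close> the integral of the test function \<open>min 1 (exp (x - y))\<close> falls short of \<open>1\<close> by an
  amount of order \<open>j powr (- d * b)\<close> up to a logarithm, and this is eventually at least \<open>1 / j\<close>. So the probability that
  all values from index \<open>m\<close> to \<open>m + n - 1\<close> stay below the level is at most a telescoping product that tends to \<open>0\<close>.
\<close>

lemma frequently_lower_bound:
  assumes h: "0 < h" and b: "0 < b"
  defines "\<rho> \<equiv> exp (- lam * h)"
  defines "d \<equiv> (1 + \<rho>\<^sup>2) / (1 - \<rho>\<^sup>2)"
  assumes bd: "d * b < 1"
  shows "AE \<omega> in M. \<forall>m. \<exists>j\<ge>m. b * ln (real j * h) < X (real j * h) \<omega>"
proof -
  have \<rho>: "0 < \<rho>" "\<rho> < 1" using lam h by (auto simp: \<rho>_def)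
  have "0 < 1 - \<rho>\<^sup>2" using \<rho> by (simp add: power_less_one_iff)
  then have d: "0 < d" by (simp add: d_def add_pos_nonneg)
  define K where "K = (1 - exp (- 1)) * (d powr \<alpha> / Gamma \<alpha>) * exp (- 2 * d)"
  have K: "0 < K" unfolding K_def using d \<alpha> Gamma_real_pos[OF \<alpha>] by simp
  define \<beta> where "\<beta> = 1 - d * b"
  have \<beta>: "0 < \<beta>" using bd by (simp add: \<beta>_def)
  define q where "q j = K * exp (- d * (b * ln (real j * h))) / (b * ln (real j * h) + 2)" for j :: nat
  have "\<forall>\<^sub>F j in sequentially. 1 / real j \<le> q j"
  proof -
    have "filterlim (\<lambda>z::real. z powr \<beta> / (b * ln z + 2)) at_top at_top"
      using \<beta> b by real_asymp
    moreover have "filterlim (\<lambda>j. real j * h) at_top sequentially"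
      using h by (intro filterlim_at_top_mult_tendsto_pos[OF tendsto_const] filterlim_real_sequentially) auto
    ultimately have "filterlim (\<lambda>j. (real j * h) powr \<beta> / (b * ln (real j * h) + 2)) at_top sequentially"
      by (rule filterlim_compose)
    then have "\<forall>\<^sub>F j in sequentially. h / K \<le> (real j * h) powr \<beta> / (b * ln (real j * h) + 2)"
      unfolding filterlim_at_top by blast
    then show ?thesis using eventually_gt_at_top[of 0]
    proof eventually_elim
      case (elim j)
      have z: "0 < real j * h" using elim h by simp
      have "exp (- d * (b * ln (real j * h))) = (real j * h) powr (\<beta> - 1)"
        using elim(2) h by (simp add: powr_def \<beta>_def)
      also have "\<dots> = (real j * h) powr \<beta> / (real j * h)" using z by (simp add: powr_diff)
      finally have "q j = K / (real j * h) * ((real j * h) powr \<beta> / (b * ln (real j * h) + 2))"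
        by (simp add: q_def)
      also have "\<dots> \<ge> K / (real j * h) * (h / K)" using elim K z by (intro mult_left_mono) auto
      also have "K / (real j * h) * (h / K) = 1 / real j" using K h by simp
      finally show ?case .
    qed
  qed
  moreover have "\<forall>\<^sub>F j in sequentially. 1 / h \<le> real j"
    using filterlim_real_sequentially unfolding filterlim_at_top by blast
  ultimately have "\<forall>\<^sub>F j in sequentially. 1 / real j \<le> q j \<and> 1 / h \<le> real j"
    by (rule eventually_conj)
  then obtain N where N: "\<And>j. N \<le> j \<Longrightarrow> 1 / real j \<le> q j" "\<And>j. N \<le> j \<Longrightarrow> 1 / h \<le> real j"
    unfolding eventually_sequentially by blast
  have null: "AE \<omega> in M. \<exists>j\<ge>m. b * ln (real j * h) < X (real j * h) \<omega>" if m: "N \<le> m" "2 \<le> m" for m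
  proof -
    define Z where "Z = {\<omega> \<in> space M. \<forall>i. X (real (m + i) * h) \<omega> \<le> b * ln (real (m + i) * h)}"
    have Xm: "X (real (m + i) * h) \<in> borel_measurable M" for i using h by (intro X_measurable) simp
    have Zm: "Z \<in> sets M" unfolding Z_def using Xm by measurable
    have factor: "(\<integral>y. min 1 (exp (b * ln (real (m + i) * h) - y)) \<partial>gamma_dist \<alpha> d) \<le> 1 - 1 / real (m + i)" for i
    proof -
      have "1 \<le> real (m + i) * h" using N(2)[of "m + i"] m h by (simp add: field_simps)
      then have "0 \<le> b * ln (real (m + i) * h)" using b by simp
      from gamma_dist_test_function_bound[OF \<alpha> d this]
      have "(\<integral>y. min 1 (exp (b * ln (real (m + i) * h) - y)) \<partial>gamma_dist \<alpha> d) \<le> 1 - q (m + i)"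
        by (simp add: q_def K_def)
      then show ?thesis using N(1)[of "m + i"] m by simp
    qed
    have telescope: "(\<Prod>i<n. 1 - 1 / real (m + i)) = (real m - 1) / (real (m + n) - 1)" for n
    proof (induction n)
      case (Suc n)
      have "0 < real (m + n) - 1" "0 < real (m + n)" using m by auto
      then show ?case using Suc m by (simp add: field_simps)
    qed (use m in simp)
    have "prob Z \<le> (real m - 1) / (real (m + n) - 1)" for n
    proof -
      have "prob Z \<le> prob {\<omega> \<in> space M. \<forall>i<n. X (real (m + i) * h) \<omega> \<le> b * ln (real (m + i) * h)}"
        unfolding Z_def using Xm by (intro finite_measure_mono) (auto, measurable)
      also have "\<dots> \<le> (\<Prod>i<n. \<integral>y. min 1 (exp (b * ln (real (m + i) * h) - y)) \<partial>gamma_dist \<alpha> d)"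
        unfolding d_def \<rho>_def using h m by (intro grid_small_values) auto
      also have "\<dots> \<le> (\<Prod>i<n. 1 - 1 / real (m + i))"
        by (intro prod_mono conjI factor Bochner_Integration.integral_nonneg) auto
      finally show ?thesis unfolding telescope .
    qed
    moreover have "(\<lambda>n. (real m - 1) / (real (m + n) - 1)) \<longlonglongrightarrow> 0" by real_asymp
    ultimately have "prob Z \<le> 0" by (intro LIMSEQ_le_const) auto
    then have "emeasure M Z = 0" by (simp add: emeasure_eq_measure measure_le_0_iff)
    then have "AE \<omega> in M. \<omega> \<notin> Z" using Zm by (intro AE_not_in) (auto simp: null_sets_def)
    then show ?thesis using AE_space
    proof eventually_elim
      case (elim \<omega>)
      then obtain i where "b * ln (real (m + i) * h) < X (real (m + i) * h) \<omega>" by (auto simp: Z_def not_le)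
      then show ?case by (intro exI[of _ "m + i"]) simp
    qed
  qed
  have "AE \<omega> in M. \<forall>m. \<exists>j\<ge>max m (max N 2). b * ln (real j * h) < X (real j * h) \<omega>"
    by (intro AE_all_countable[THEN iffD2] allI null) auto
  then show ?thesis by eventually_elim (metis max.boundedE)
qed

text \<open>
  Every level \<open>b < 1\<close> is reached along a grid whose spacing \<open>h\<close> is so large that the rate \<open>d\<close> of the
  comparison gamma variables satisfies \<open>d * b < 1\<close>.
\<close>

lemma AE_limsup_lower:
  "AE \<omega> in M. 1 \<le> Limsup at_top (\<lambda>t. ereal (X t \<omega> / ln t))"
proof -
  have lower: "AE \<omega> in M. ereal b \<le> Limsup at_top (\<lambda>t. ereal (X t \<omega> / ln t))" if b: "0 < b" "b < 1" for b
  proof -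
    define D where "D h = (1 + (exp (- lam * h))\<^sup>2) / (1 - (exp (- lam * h))\<^sup>2)" for h
    have "((\<lambda>h. D h * b) \<longlongrightarrow> b) at_top" unfolding D_def using lam by real_asymp
    then have "\<forall>\<^sub>F h in at_top. D h * b < 1" using b by (intro order_tendstoD(2))
    from eventually_happens[OF eventually_conj[OF this eventually_gt_at_top[of 0]]]
    obtain h where h: "D h * b < 1" "0 < h" by auto
    have "AE \<omega> in M. \<forall>m. \<exists>j\<ge>m. b * ln (real j * h) < X (real j * h) \<omega>"
      using h(2) b(1) h(1)[unfolded D_def] by (rule frequently_lower_bound)
    then show ?thesis
    proof eventually_elim
      case (elim \<omega>)
      show ?case
      proof (rule ccontr)
        assume "\<not> ?thesis"
        then have "Limsup at_top (\<lambda>t. ereal (X t \<omega> / ln t)) < ereal b" by simp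
        then have "\<forall>\<^sub>F t in at_top. ereal (X t \<omega> / ln t) < ereal b" by (rule Limsup_lessD)
        then have "\<forall>\<^sub>F t in at_top. X t \<omega> / ln t < b \<and> 1 < t"
          using eventually_gt_at_top[of 1] by eventually_elim simp
        moreover have "filterlim (\<lambda>j. real j * h) at_top sequentially"
          using h(2) by (intro filterlim_at_top_mult_tendsto_pos[OF tendsto_const] filterlim_real_sequentially) auto
        ultimately have "\<forall>\<^sub>F j in sequentially. X (real j * h) \<omega> / ln (real j * h) < b \<and> 1 < real j * h"
          by (rule eventually_compose_filterlim)
        then obtain m where m: "\<And>j. m \<le> j \<Longrightarrow> X (real j * h) \<omega> / ln (real j * h) < b \<and> 1 < real j * h"
          unfolding eventually_sequentially by blast
        from elim obtain j where j: "m \<le> j" "b * ln (real j * h) < X (real j * h) \<omega>" by blast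
        from m[OF j(1)] have "X (real j * h) \<omega> < b * ln (real j * h)" by (simp add: divide_less_eq)
        with j(2) show False by simp
      qed
    qed
  qed
  have "AE \<omega> in M. \<forall>n. ereal (1 - 1 / (real n + 2)) \<le> Limsup at_top (\<lambda>t. ereal (X t \<omega> / ln t))"
    by (intro AE_all_countable[THEN iffD2] allI lower) auto
  then show ?thesis
  proof eventually_elim
    case (elim \<omega>)
    have "(\<lambda>n. ereal (1 - 1 / (real n + 2))) \<longlonglongrightarrow> ereal 1" unfolding lim_ereal by real_asymp
    then have "ereal 1 \<le> Limsup at_top (\<lambda>t. ereal (X t \<omega> / ln t))"
      by (rule LIMSEQ_le_const2) (use elim in auto)
    then show ?case by (simp add: one_ereal_def)
  qed
qed

end

section \<open>The limit superior when f vanishes at infinity\<close>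

context excessive_permanental
begin

lemma AE_limsup_eq_1:
  assumes cont: "AE \<omega> in M. continuous_on {0..} (\<lambda>t. X t \<omega>)" and f: "(f \<longlongrightarrow> 0) at_top"
  shows "AE \<omega> in M. Limsup at_top (\<lambda>t. ereal (X t \<omega> / ln t)) = 1"
  using AE_limsup_upper[OF cont] AE_limsup_lower
proof eventually_elim
  case (elim \<omega>)
  have "Limsup at_top (\<lambda>t. ereal (X t \<omega> / ln t)) \<le> ereal ((1 + e)\<^sup>2)" if e: "0 < e" for e
  proof (rule Limsup_bounded)
    have "Limsup at_top (\<lambda>t. ereal (X t \<omega> / ((1 + f t) * ln t))) < ereal (1 + e)"
      using elim(1) by (rule le_less_trans) (use e in \<open>simp add: one_ereal_def\<close>)
    then have "\<forall>\<^sub>F t in at_top. ereal (X t \<omega> / ((1 + f t) * ln t)) < ereal (1 + e)" by (rule Limsup_lessD)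
    moreover have "\<forall>\<^sub>F t in at_top. f t < e" using f e by (rule order_tendstoD(2))
    ultimately show "\<forall>\<^sub>F t in at_top. ereal (X t \<omega> / ln t) \<le> ereal ((1 + e)\<^sup>2)"
      using eventually_gt_at_top[of 1]
    proof eventually_elim
      case (elim t)
      have lt: "0 < ln t" using elim by simp
      have F: "0 < 1 + f t" using f_nonneg[of t] by simp
      have "X t \<omega> / ln t = X t \<omega> / ((1 + f t) * ln t) * (1 + f t)" using F by simp
      also have "\<dots> \<le> (1 + e) * (1 + f t)" using elim(1) F by (intro mult_right_mono) auto
      also have "\<dots> \<le> (1 + e) * (1 + e)" using elim(2) e by (intro mult_left_mono) auto
      finally show ?case by (simp add: power2_eq_square)
    qed
  qed
  then have le: "Limsup at_top (\<lambda>t. ereal (X t \<omega> / ln t)) \<le> ereal ((1 + 1 / (real n + 1))\<^sup>2)" for n by simp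
  have lim: "(\<lambda>n. ereal ((1 + 1 / (real n + 1))\<^sup>2)) \<longlonglongrightarrow> ereal 1" unfolding lim_ereal by real_asymp
  have "Limsup at_top (\<lambda>t. ereal (X t \<omega> / ln t)) \<le> ereal 1"
    by (rule LIMSEQ_le_const[OF lim]) (use le in blast)
  with elim(2) show ?case by (simp add: one_ereal_def antisym)
qed

end

text \<open>
  Dominated convergence: \<open>potential_density lam x y\<close> is at most \<open>1 / lam\<close> and tends to \<open>0\<close> for fixed \<open>y\<close>.
\<close>

lemma potential_tendsto_0:
  assumes lam: "0 < lam" and h: "L1_plus h" and f: "is_potential_of lam f h"
  shows "(f \<longlongrightarrow> 0) at_top"
proof -
  let ?s = "\<lambda>x y. indicator {0<..} y *\<^sub>R (potential_density lam x y * h y)"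
  have hi: "integrable lebesgue (\<lambda>y. indicator {0<..} y *\<^sub>R h y)"
    using h by (simp add: L1_plus_def set_integrable_def)
  have "((\<lambda>x. \<integral>y. ?s x y \<partial>lebesgue) \<longlongrightarrow> (\<integral>y. 0 \<partial>(lebesgue :: real measure))) at_top"
  proof (rule integral_dominated_convergence_at_top[where s = ?s and M = lebesgue and f = "\<lambda>_. 0" and w = "\<lambda>y. \<bar>indicator {0<..} y *\<^sub>R h y\<bar> / lam"])
    have eq: "?s x y = potential_density lam x y * (indicator {0<..} y *\<^sub>R h y)" for x y by simp
    show "?s x \<in> borel_measurable lebesgue" for x
    proof -
      have "(\<lambda>y. potential_density lam x y) \<in> borel_measurable lborel"
        unfolding potential_density_def by measurable
      then have "(\<lambda>y. potential_density lam x y) \<in> borel_measurable lebesgue"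
        by (rule measurable_completion)
      then show ?thesis unfolding eq using hi by (intro borel_measurable_times) auto
    qed
    show "integrable lebesgue (\<lambda>y. \<bar>indicator {0<..} y *\<^sub>R h y\<bar> / lam)" using hi by (intro integrable_divide integrable_abs) auto
    show "AE y in lebesgue. ((\<lambda>x. ?s x y) \<longlongrightarrow> 0) at_top"
    proof (rule AE_I2)
      fix y
      have "((\<lambda>x. potential_density lam x y) \<longlongrightarrow> 0) at_top"
        unfolding potential_density_def using lam by real_asymp
      from tendsto_mult_left_zero[OF this, of "indicator {0<..} y *\<^sub>R h y"]
      show "((\<lambda>x. ?s x y) \<longlongrightarrow> 0) at_top" unfolding eq .
    qed
    show "\<forall>\<^sub>F x in at_top. AE y in lebesgue. norm (?s x y) \<le> \<bar>indicator {0<..} y *\<^sub>R h y\<bar> / lam"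
    proof (intro always_eventually allI AE_I2)
      fix x y
      have "\<bar>potential_density lam x y\<bar> \<le> 1 / lam"
        using lam by (simp add: potential_density_def divide_le_cancel)
      then have "\<bar>potential_density lam x y\<bar> * \<bar>indicator {0<..} y *\<^sub>R h y\<bar> \<le> 1 / lam * \<bar>indicator {0<..} y *\<^sub>R h y\<bar>"
        by (intro mult_right_mono) auto
      then show "norm (?s x y) \<le> \<bar>indicator {0<..} y *\<^sub>R h y\<bar> / lam" unfolding eq by (simp add: abs_mult)
    qed
  qed simp
  moreover have "f = (\<lambda>x. \<integral>y. ?s x y \<partial>lebesgue)"
    using f unfolding is_potential_of_def set_lebesgue_integral_def by (intro ext) (rule spec)
  ultimately show ?thesis by (simp only: Bochner_Integration.integral_zero)
qed

theorem theorem1p11: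
  fixes lam \<alpha> :: real
    and f :: "real \<Rightarrow> real"
    and P :: "real \<Rightarrow> 'b measure"
    and B :: "real \<Rightarrow> 'b \<Rightarrow> real option"
    and M :: "'a measure"
    and X :: "real \<Rightarrow> 'a \<Rightarrow> real"
  assumes "0 < lam" and "0 < \<alpha>"
    and "C2 f"
    and "killed_brownian_motion (lam\<^sup>2 / 2) P B"
    and "excessive UNIV P B f"
    and "prob_space M"
    and "permanental_process M \<alpha> {0..} X (\<lambda>s t. exp (- lam * \<bar>s - t\<bar>) + f t)"
    and "AE \<omega> in M. continuous_on {0..} (\<lambda>t. X t \<omega>)"
  shows "(AE \<omega> in M. Limsup at_top (\<lambda>t. ereal (X t \<omega> / ((1 + f t) * ln t))) \<le> 1) \<and>
         ((f \<longlongrightarrow> 0) at_top \<longrightarrow>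
            (AE \<omega> in M. Limsup at_top (\<lambda>t. ereal (X t \<omega> / ln t)) = 1)) \<and>
         (\<forall>h. L1_plus h \<and> is_potential_of lam f h \<longrightarrow>
            (AE \<omega> in M. Limsup at_top (\<lambda>t. ereal (X t \<omega> / ln t)) = 1))"
proof -
  note ex = excessive_second_derivative[OF \<open>C2 f\<close> assms(4,5) \<open>0 < lam\<close>]
  note der = C2_derivatives(1,2)[OF \<open>C2 f\<close>]
  interpret prob_space M by (rule assms)
  interpret excessive_permanental M lam \<alpha> f X
  proof unfold_locales
    show "f y \<le> exp (lam * \<bar>y - x\<bar>) * f x" for x y
      by (rule harnack_two_sided[OF \<open>0 < lam\<close> der ex])
    show "f (x - h) + f (x + h) \<le> 2 * cosh (lam * h) * f x" if "0 \<le> h" for x h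
      by (rule three_point_of_second_derivative[OF \<open>0 < lam\<close> that der ex(2)])
  qed (use assms ex in auto)
  show ?thesis
    using AE_limsup_upper[OF assms(8)] AE_limsup_eq_1[OF assms(8)] potential_tendsto_0[OF \<open>0 < lam\<close>]
    by blast
qed

end
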